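(* Consider the block spin Potts model in the asymptotically uniform case $\gamma_k=1/s$ for all $1\le k\le s$. Denote by $\zeta_q:=2\frac{q-1}{q-2}\log(q-1)$ the critical inverse temperature in the $q$-color Potts model, and let $g:=\frac{\beta+(s-1)\alpha}{s}$. Then the $q$-color block spin Potts model has a phase transition. More precisely: (1) If $g<\zeta_q$, then the distribution of $M'_N$ under the Gibbs measure $\mu_{N,\alpha,\beta}$ concentrates (as $N\to\infty$) in a unique point, the $s\times q$ matrix with all entries identical to $1/(sq)$. To describe the "low temperature" behavior, define $\varphi:[0,1]\to\mathbb{R}^q$ by $$\varphi(t):=\Big(\frac{1+(q-1)t}{sq},\frac{1-t}{sq},\dots,\frac{1-t}{sq}\Big),$$ and let $u(g)$ be the largest solution of the equation $$u=\frac{1-e^{-gu}}{1+(q-1)e^{-gu}}.$$ Let $n^1(g):=\varphi(u(g))$ and, for $i=2,\dots,q$, let $n^i(g)$ be $n^1(g)$ with the $i$-th and the first coordinate interchanged. For $i=1,\dots,q$ let $\nu^i(g)$ be the $s\times q$ matrix with all rows identical to $n^i(g)$, and let $Q$ be the $s\times q$ matrix with all entries identical to $1/(sq)$. (2) If $g>\zeta_q$, then the distribution of $M'_N$ under the Gibbs measure $\mu_{N,\alpha,\beta}$ concentrates (as $N\to\infty$) in a (uniform) mixture of the Dirac measures in $\nu^1(g),\dots,\nu^q(g)$. (3) At $g=\zeta_q$ the limit points of $M'_N$ under the Gibbs measure $\mu_{N,\alpha,\beta}$ are $Q$ and $\nu^1(g),\dots,\nu^q(g)$.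
   Context: Block spin Potts model: for each $N$, $S=\{1,\dots,N\}$ is partitioned into $s$ blocks $S_1,\dots,S_s$ (depending on $N$; $s$ is fixed) such that the limits $\gamma_k=\lim_{N\to\infty}|S_k|/N\in(0,1)$ exist, with $\sum_{k=1}^s\gamma_k=1$. Fix an integer $q\ge3$ and reals $0<\alpha<\beta$. For $\omega\in\{1,\dots,q\}^S$, $$H_N(\omega)=-\frac{\beta}{2N}\sum_{i\sim j}\mathbf{1}_{\omega_i=\omega_j}-\frac{\alpha}{2N}\sum_{i\not\sim j}\mathbf{1}_{\omega_i=\omega_j},$$ where the sums run over ordered pairs $(i,j)\in S^2$, $i\sim j$ means that $i,j$ lie in the same block (the case $i=j$ is included), and $i\not\sim j$ means that they do not. The Gibbs measure is $\mu_{N,\alpha,\beta}(\omega)=e^{-H_N(\omega)}/Z_N$ with $Z_N=\sum_{\omega'}e^{-H_N(\omega')}$. $M'_N=(m'_{k,c})\in\mathbb{R}^{s\times q}$ is the random matrix with entries $m'_{k,c}(\omega)=\frac1N\sum_{i\in S_k}\mathbf{1}_{\omega_i=c}$, $1\le k\le s$, $1\le c\le q$.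
   Formalization: In (3), limit points in the usual sense are claimed only if |S_k|-N/s=O(sqrt N) for all k, as Q can drop out otherwise; for all asymptotically uniform blocks, (3) holds for points with no neighbourhood of exponentially small probability. *)

theory Defs
  imports "HOL-Probability.Probability" "HOL-Library.Landau_Symbols"
begin

text \<open>
  Blocks are indexed by a finite type \<open>'s\<close> and colours by a finite type \<open>'q\<close>, so that
  \<open>s = CARD('s)\<close>, \<open>q = CARD('q)\<close> and an \<open>s \<times> q\<close> matrix is an element of \<open>real ^ 'q ^ 's\<close>, with
  rows indexed by blocks.  A single decomposition of \<open>{1..N}\<close> is a map \<open>B :: 's \<Rightarrow> nat set\<close>.
  The colour set has no preferred order, so the points \<open>n\<^sup>i\<close> are indexed by the colour \<open>i\<close> itself.
\<close>

definition block_partition :: "nat \<Rightarrow> ('s::finite \<Rightarrow> nat set) \<Rightarrow> bool" where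
  "block_partition N B \<longleftrightarrow> disjoint_family B \<and> (\<Union>k. B k) = {1..N}"

definition same_block :: "('s::finite \<Rightarrow> nat set) \<Rightarrow> nat \<Rightarrow> nat \<Rightarrow> bool" where
  "same_block B i j \<longleftrightarrow> (\<exists>k. i \<in> B k \<and> j \<in> B k)"

definition configs :: "nat \<Rightarrow> (nat \<Rightarrow> 'q::finite) set" where
  "configs N = {1..N} \<rightarrow>\<^sub>E UNIV"

definition hamiltonian ::
  "real \<Rightarrow> real \<Rightarrow> nat \<Rightarrow> ('s::finite \<Rightarrow> nat set) \<Rightarrow> (nat \<Rightarrow> 'q::finite) \<Rightarrow> real" where
  "hamiltonian \<alpha> \<beta> N B \<omega> =
     - (\<beta> / (2 * real N)) *
         (\<Sum>(i, j) \<in> {(i, j) \<in> {1..N} \<times> {1..N}. same_block B i j}. of_bool (\<omega> i = \<omega> j))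
     - (\<alpha> / (2 * real N)) *
         (\<Sum>(i, j) \<in> {(i, j) \<in> {1..N} \<times> {1..N}. \<not> same_block B i j}. of_bool (\<omega> i = \<omega> j))"

definition partition_function ::
  "'q::finite itself \<Rightarrow> real \<Rightarrow> real \<Rightarrow> nat \<Rightarrow> ('s::finite \<Rightarrow> nat set) \<Rightarrow> real" where
  "partition_function _ \<alpha> \<beta> N B =
     (\<Sum>\<omega> \<in> (configs N :: (nat \<Rightarrow> 'q) set). exp (- hamiltonian \<alpha> \<beta> N B \<omega>))"

definition gibbs ::
  "real \<Rightarrow> real \<Rightarrow> nat \<Rightarrow> ('s::finite \<Rightarrow> nat set) \<Rightarrow> (nat \<Rightarrow> 'q::finite) measure" where
  "gibbs \<alpha> \<beta> N B = point_measure (configs N)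
     (\<lambda>\<omega>. ennreal (exp (- hamiltonian \<alpha> \<beta> N B \<omega>) / partition_function TYPE('q) \<alpha> \<beta> N B))"

definition magnetization ::
  "nat \<Rightarrow> ('s::finite \<Rightarrow> nat set) \<Rightarrow> (nat \<Rightarrow> 'q::finite) \<Rightarrow> real ^ 'q ^ 's" where
  "magnetization N B \<omega> = (\<chi> k c. (1 / real N) * (\<Sum>i \<in> B k. of_bool (\<omega> i = c)))"

definition magnetization_law ::
  "real \<Rightarrow> real \<Rightarrow> nat \<Rightarrow> ('s::finite \<Rightarrow> nat set) \<Rightarrow> (real ^ 'q::finite ^ 's) measure" where
  "magnetization_law \<alpha> \<beta> N B = distr (gibbs \<alpha> \<beta> N B) borel (magnetization N B)"

definition potts_zeta :: "nat \<Rightarrow> real" where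
  "potts_zeta q = 2 * ((real q - 1) / (real q - 2)) * ln (real q - 1)"

text \<open>
  \<open>0\<close> is always a solution, the solution set is closed, and every solution is less than \<open>1\<close>;
  hence the largest solution exists.
\<close>

definition potts_u :: "nat \<Rightarrow> real \<Rightarrow> real" where
  "potts_u q g =
     (GREATEST u. u = (1 - exp (- g * u)) / (1 + (real q - 1) * exp (- g * u)))"

text \<open>
  \<open>phi i t\<close> is the vector \<open>\<phi>(t)\<close> with its distinguished first coordinate moved to position \<open>i\<close>;
  the first argument of type \<open>'s itself\<close> supplies the number \<open>s\<close> of blocks.
\<close>

definition phi :: "'s::finite itself \<Rightarrow> 'q::finite \<Rightarrow> real \<Rightarrow> real ^ 'q" where
  "phi _ i t = (\<chi> c. if c = i
       then (1 + (real CARD('q) - 1) * t) / (real CARD('s) * real CARD('q))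
       else (1 - t) / (real CARD('s) * real CARD('q)))"

definition nu :: "real \<Rightarrow> 'q::finite \<Rightarrow> real ^ 'q ^ 's::finite" where
  "nu g i = (\<chi> k. phi TYPE('s) i (potts_u CARD('q) g))"

definition Q_matrix :: "real ^ 'q::finite ^ 's::finite" where
  "Q_matrix = (\<chi> k c. 1 / (real CARD('s) * real CARD('q)))"

text \<open>Weak convergence; the library's \<open>weak_conv_m\<close> covers only measures on the real line.\<close>

definition weakly_converges ::
  "(nat \<Rightarrow> 'a::topological_space measure) \<Rightarrow> 'a measure \<Rightarrow> bool" where
  "weakly_converges L M \<longleftrightarrow>
     (\<forall>f :: 'a \<Rightarrow> real. continuous_on UNIV f \<and> bounded (range f) \<longrightarrow>
        (\<lambda>N. \<integral>x. f x \<partial>L N) \<longlonglongrightarrow> (\<integral>x. f x \<partial>M))"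

definition uniform_dirac_mixture ::
  "('i::finite \<Rightarrow> 'a::topological_space) \<Rightarrow> 'a measure" where
  "uniform_dirac_mixture x = uniform_count_measure UNIV \<bind> (\<lambda>i. return borel (x i))"

text \<open>
  Two notions of limit points of a sequence of laws.  The first consists of the points all of whose
  neighbourhoods keep a non-vanishing probability (along a subsequence).  The second consists
  of the points none of whose neighbourhoods has exponentially small probability; under a large
  deviation principle with speed \<open>N\<close> these are the zeros of the rate function.
  The second set always contains the first.  The inclusion can be strict for \<^const>\<open>magnetization_law\<close>
  at the critical temperature: block sizes deviating from \<open>N / s\<close> by much more than \<open>sqrt N\<close> favour
  the ordered phases, although only by a subexponential factor.
\<close>

definition limit_points :: "(nat \<Rightarrow> 'a::topological_space measure) \<Rightarrow> 'a set" where
  "limit_points L =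
     {x. \<forall>U. open U \<and> x \<in> U \<longrightarrow> \<not> (\<lambda>N. measure (L N) U) \<longlonglongrightarrow> 0}"

definition ld_limit_points :: "(nat \<Rightarrow> 'a::topological_space measure) \<Rightarrow> 'a set" where
  "ld_limit_points L =
     {x. \<forall>U. open U \<and> x \<in> U \<longrightarrow>
        (\<forall>\<epsilon>>0. \<exists>\<^sub>F N in sequentially. exp (- \<epsilon> * real N) \<le> measure (L N) U)}"

end

theory Submission
  imports Defs
begin

text \<open>
  Since \<open>\<alpha>\<close> and \<open>\<beta> - \<alpha>\<close> are positive, the interaction is at most \<open>g s / 2\<close> times the square norm of the
  magnetization matrix, with equality for equal rows, so the blocks decouple into copies of the
  mean-field Potts model at inverse temperature \<open>g\<close>, whose free energy is studied in its dual
  form \<open>G(x) = g / 2 * |x|\<^sup>2 - ln (\<Sum> exp (g x\<^sub>c))\<close> on the whole space. A critical point of \<open>G\<close> takes at most two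
  values, a minimizer takes the larger one at most once, and the remaining one-dimensional problem
  is settled at \<open>\<zeta>\<^sub>q\<close>, where the ordered solution is explicitly \<open>u = (q - 2) / (q - 1)\<close>.

  Tilting by a minimizer \<open>x\<close> writes the Gibbs weight as \<open>exp (- N G(x))\<close> times a product measure times
  the exponential of a nonnegative quadratic form centred at \<open>x / s\<close>. Lower bounds are thus a law of
  large numbers, upper bounds come from optimal tilting, and colour symmetry yields the uniform
  mixture. At \<open>\<zeta>\<^sub>q < q\<close> every minimizer is nondegenerate, so block deviations of order \<open>\<surd>N\<close> give every
  phase a weight of exact order \<open>exp (- N G(x))\<close>.
\<close>

section \<open>The one-dimensional problem\<close>

text \<open>Two upper bounds of different precision are needed. Tilting at the observed
  magnetization and counting magnetization values loses a polynomial factor. This is harmless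
  between points of different free energy, but at \<zeta> the ordered and disordered phases tie on
  the exponential scale, and a polynomial factor could decide between them. Near each minimizer the
  quadratic remainder is therefore kept, linearised entry by entry in the manner of
  Hubbard-Stratonovich, and averaged under the product weight with a loss bounded in N. The
  resulting sum over integers j converges because the covariance of a minimizer, read as a colour
  law, is at most 1/q and g < q. The linearising field is of order j / sqrt N, so a block whose size
  is off by order sqrt N only adds a multiple of |j| to the exponent, which the Gaussian decay in j
  absorbs. For (2) the weights of the ordered phases are never computed: averaging a test function
  over colour permutations keeps its integral and makes it constant on the limit points.\<close>

definition potts_gap :: "real \<Rightarrow> real \<Rightarrow> real \<Rightarrow> real" where
  "potts_gap r g u = g * (r - 1) / (2 * r) * u\<^sup>2 + g * u / r - ln (exp (g * u) + r - 1) + ln r"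

text \<open>With r colours, \<open>potts_gap r g u\<close> is the free energy of
  \<open>colour_vec i u\<close> minus that of \<open>colour_vec i 0\<close>.
  \<open>potts_slope\<close> is the self-consistency equation in logarithmic form: the log ratio of
  the two coordinate values minus g times their difference. For g > 0 it has the sign of the
  derivative of \<open>potts_gap\<close> on [0, 1), and its own derivative is rational.\<close>

definition potts_slope :: "real \<Rightarrow> real \<Rightarrow> real \<Rightarrow> real" where
  "potts_slope r g u = ln (1 + (r - 1) * u) - ln (1 - u) - g * u"

lemma potts_gap_0 [simp]: "potts_gap r g 0 = 0"
  by (simp add: potts_gap_def)

lemma potts_slope_0 [simp]: "potts_slope r g 0 = 0"
  by (simp add: potts_slope_def)

lemma potts_gap_deriv:
  assumes "r > 1"
  shows "(potts_gap r g has_real_derivative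
           g * ((1 + (r - 1) * u) / r - exp (g * u) / (exp (g * u) + r - 1))) (at u)"
proof -
  have pos: "exp (g * u) + r - 1 > 0" using assms exp_gt_zero[of "g*u"] by linarith
  define A where "A = g * (r - 1) / (2 * r)"
  have d1: "((\<lambda>u. ln (exp (g * u) + r - 1)) has_real_derivative
      1 / (exp (g * u) + r - 1) * (g * exp (g * u))) (at u)"
    using DERIV_ln_divide[OF pos]
    by (rule DERIV_chain2[where f=ln and g="\<lambda>u. exp (g * u) + r - 1"])
      (auto intro!: derivative_eq_intros)
  have d2: "((\<lambda>u. A * u\<^sup>2 + g * u / r) has_real_derivative A * (2 * u) + g / r) (at u)"
    using assms by (auto intro!: derivative_eq_intros)
  have "((\<lambda>u. A * u\<^sup>2 + g * u / r - ln (exp (g * u) + r - 1) + ln r) has_real_derivative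
      A * (2 * u) + g / r - 1 / (exp (g * u) + r - 1) * (g * exp (g * u)) + 0) (at u)"
    by (rule DERIV_add[OF DERIV_diff[OF d2 d1] DERIV_const])
  moreover have "A * (2 * u) + g / r = g * ((1 + (r - 1) * u) / r)"
    using assms by (simp add: A_def add_divide_distrib distrib_left)
  ultimately show ?thesis
    unfolding potts_gap_def[abs_def] A_def by (simp add: right_diff_distrib mult_ac)
qed

text \<open>Both sides are probabilities, with odds \<open>a / ((r - 1) * b)\<close> and
  \<open>e / (r - 1)\<close>; comparing them means comparing \<open>a / b\<close> with
  \<open>e\<close>, whose logarithms differ by \<open>potts_slope\<close>.\<close>

lemma potts_gap_deriv_sign:
  assumes "r > 1" "0 \<le> u" "u < 1"
  shows "potts_slope r g u > 0 \<Longrightarrow> (1 + (r - 1) * u) / r > exp (g * u) / (exp (g * u) + r - 1)"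
    and "potts_slope r g u < 0 \<Longrightarrow> (1 + (r - 1) * u) / r < exp (g * u) / (exp (g * u) + r - 1)"
    and "potts_slope r g u = 0 \<Longrightarrow> (1 + (r - 1) * u) / r = exp (g * u) / (exp (g * u) + r - 1)"
proof -
  let ?p = "(1 + (r - 1) * u) / r" and ?e = "exp (g * u) / (exp (g * u) + r - 1)"
  define a b e where "a = 1 + (r - 1) * u" and "b = 1 - u" and "e = exp (g * u)"
  have ab: "a > 0" "b > 0" "e > 0" using assms by (auto simp: a_def b_def e_def add_pos_nonneg)
  have r: "r = a + (r - 1) * b" by (simp add: a_def b_def algebra_simps)
  have er: "e + r - 1 > 0" using ab assms by linarith
  have sl: "potts_slope r g u = ln (a / b) - ln e"
    using ab by (simp add: potts_slope_def a_def b_def e_def ln_div)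
  have diff: "a / r - e / (e + r - 1) = (r - 1) * (a - e * b) / (r * (e + r - 1))"
  proof -
    have "a * (e + r - 1) - e * r = (r - 1) * (a - e * b)"
      unfolding a_def b_def by (simp add: algebra_simps)
    moreover have "a / r - e / (e + r - 1) = (a * (e + r - 1) - e * r) / (r * (e + r - 1))"
      using er assms by (simp add: diff_frac_eq)
    ultimately show ?thesis by simp
  qed
  have den: "r * (e + r - 1) > 0" "r - 1 > 0" using er assms by auto
  { assume "potts_slope r g u > 0"
    then have "e < a / b" unfolding sl using ab by (simp add: ln_less_cancel_iff)
    then have "a - e * b > 0" using ab by (simp add: field_simps)
    then have "a / r - e / (e + r - 1) > 0" unfolding diff using den by simp
    then show "?p > ?e"
      by (simp add: a_def e_def) }
  { assume "potts_slope r g u < 0"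
    then have "e > a / b" unfolding sl using ab by simp
    then have "a - e * b < 0" using ab by (simp add: field_simps)
    then have "a / r - e / (e + r - 1) < 0" unfolding diff
      using den by (simp add: divide_neg_pos mult_pos_neg)
    then show "?p < ?e"
      by (simp add: a_def e_def) }
  { assume "potts_slope r g u = 0"
    then have "e = a / b" unfolding sl using ab by simp
    then have "a - e * b = 0" using ab by (simp add: field_simps)
    then have "a / r - e / (e + r - 1) = 0" unfolding diff by simp
    then show "?p = ?e"
      by (simp add: a_def e_def) }
qed

lemma potts_slope_deriv:
  assumes "r > 1" "0 \<le> u" "u < 1"
  shows "(potts_slope r g has_real_derivative r / ((1 + (r - 1) * u) * (1 - u)) - g) (at u)"
proof -
  have pos: "1 + (r - 1) * u > 0" "1 - u > 0" using assms by (auto simp: add_pos_nonneg)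
  have "(r - 1) / (1 + (r - 1) * u) + 1 / (1 - u) = r / ((1 + (r - 1) * u) * (1 - u))"
    using pos by (simp add: divide_simps) (simp add: algebra_simps)
  moreover have "(potts_slope r g has_real_derivative
      (r - 1) / (1 + (r - 1) * u) + 1 / (1 - u) - g) (at u)"
    unfolding potts_slope_def[abs_def]
    by (rule derivative_eq_intros refl | use pos in simp)+
  ultimately show ?thesis by simp
qed

text \<open>The derivative of \<^const>\<open>potts_slope\<close> vanishes exactly at the roots of a quadratic; by Rolle,
  two positive zeros of \<^const>\<open>potts_slope\<close> use up both roots.\<close>

lemma potts_slope_sign_between_zeros:
  assumes r: "r > 1" and g: "g > 0" and uv: "0 < u" "u < v" "v < 1"
    and zero: "potts_slope r g u = 0" "potts_slope r g v = 0"
  shows "\<And>t. 0 < t \<Longrightarrow> t < u \<Longrightarrow> potts_slope r g t > 0"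
    and "\<And>t. u < t \<Longrightarrow> t < v \<Longrightarrow> potts_slope r g t < 0"
proof -
  let ?R = "potts_slope r g"
  define D where "D t = (1 + (r - 1) * t) * (1 - t)" for t :: real
  have Dpos: "D t > 0" if "0 \<le> t" "t < 1" for t
    using that r by (simp add: D_def add_pos_nonneg)
  have der: "(?R has_real_derivative r / D t - g) (at t)" if "0 \<le> t" "t < 1" for t
    using potts_slope_deriv[OF r that] by (simp add: D_def)
  have cont: "continuous_on {x..y} (?R)" if "0 \<le> x" "y < 1" for x y
    by (rule DERIV_continuous_on[where D="\<lambda>t. r / D t - g"])
      (use der that in \<open>auto intro: has_field_derivative_at_within\<close>)
  have rolle: "\<exists>z. x < z \<and> z < y \<and> r / D z - g = 0"
    if xy: "0 \<le> x" "x < y" "y < 1" and eq: "?R x = ?R y" for x y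
  proof -
    have "\<exists>z. x < z \<and> z < y \<and> DERIV (?R) z :> 0"
    proof (rule Rolle[OF xy(2) eq])
      show "?R differentiable (at t)" if "x < t" "t < y" for t
        using der[of t] that xy by (auto simp: real_differentiable_def)
    qed (use cont xy in auto)
    then obtain z where z: "x < z" "z < y" "DERIV (?R) z :> 0" by blast
    have "r / D z - g = 0" using DERIV_unique[OF der[of z] z(3)] z xy by simp
    with z show ?thesis by blast
  qed
  obtain a where a: "0 < a" "a < u" "r / D a - g = 0"
    using rolle[of 0 u] uv zero by auto
  obtain b where b: "u < b" "b < v" "r / D b - g = 0"
    using rolle[of u v] uv zero by auto
  have Da: "r = g * D a" and Db: "r = g * D b"
    using a b Dpos[of a] Dpos[of b] uv by (auto simp: field_simps)
  \<comment> \<open>A quadratic repeats a value only at points symmetric about its vertex. This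
    fixes \<open>a + b\<close> and yields the factorisation \<open>fact\<close>: the slope increases
    up to \<open>a\<close>, decreases between \<open>a\<close> and \<open>b\<close>, and increases
    afterwards.\<close>
  have "D a = D b" using Da Db g by simp
  then have "(a - b) * ((r - 1) * (a + b) - (r - 2)) = 0"
    by (simp add: D_def algebra_simps)
  then have sum: "(r - 1) * (a + b) = r - 2" using a b by simp
  have fact: "r - g * D t = g * (r - 1) * (t - a) * (t - b)" for t
  proof -
    have "r - g * D t = g * (D a - D t)" using Da by (simp add: algebra_simps)
    also have "D a - D t = (t - a) * ((r - 1) * (t + a) - (r - 2))"
      by (simp add: D_def algebra_simps)
    also have "\<dots> = (t - a) * ((r - 1) * (t - b))"
      unfolding sum[symmetric] by (simp add: algebra_simps)
    finally show ?thesis by (simp add: algebra_simps)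
  qed
  have der_eq: "r / D t - g = g * (r - 1) * (t - a) * (t - b) / D t" if "0 \<le> t" "t < 1" for t
    unfolding fact[symmetric] using Dpos[OF that] by (simp add: field_simps)
  have inc: "?R x < ?R y"
    if "0 \<le> x" "x < y" "y < 1" "\<And>t. x < t \<Longrightarrow> t < y \<Longrightarrow> (t - a) * (t - b) > 0" for x y
  proof (rule DERIV_pos_imp_increasing_open[OF that(2)])
    fix t assume t: "x < t" "t < y"
    have "g * (r - 1) * ((t - a) * (t - b)) / D t > 0"
      using that(4)[OF t] that t Dpos[of t] g r by simp
    then show "\<exists>y. (?R has_real_derivative y) (at t) \<and> 0 < y"
      using der[of t] der_eq[of t] that t by (auto simp: mult.assoc)
  qed (use cont that in auto)
  have dec: "?R x > ?R y"
    if "0 \<le> x" "x < y" "y < 1" "\<And>t. x < t \<Longrightarrow> t < y \<Longrightarrow> (t - a) * (t - b) < 0" for x y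
  proof (rule DERIV_neg_imp_decreasing_open[OF that(2)])
    fix t assume t: "x < t" "t < y"
    have "g * (r - 1) * ((t - a) * (t - b)) < 0"
      using that(4)[OF t] g r by (simp add: mult_pos_neg)
    then have "g * (r - 1) * ((t - a) * (t - b)) / D t < 0"
      using that t Dpos[of t] by (simp add: divide_neg_pos)
    then show "\<exists>y. (?R has_real_derivative y) (at t) \<and> y < 0"
      using der[of t] der_eq[of t] that t by (auto simp: mult.assoc)
  qed (use cont that in auto)
  show "?R t > 0" if t: "0 < t" "t < u" for t
  proof (cases "t \<le> a")
    case True
    have "?R 0 < ?R t"
      by (rule inc) (use True t a b uv in \<open>auto intro: mult_neg_neg\<close>)
    then show ?thesis by simp
  next
    case False
    have "?R u < ?R t"
      by (rule dec) (use False t a b uv in \<open>auto intro: mult_pos_neg\<close>)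
    then show ?thesis using zero by simp
  qed
  show "?R t < 0" if t: "u < t" "t < v" for t
  proof (cases "t \<le> b")
    case True
    have "?R t < ?R u"
      by (rule dec) (use True t a b uv in \<open>auto intro: mult_pos_neg\<close>)
    then show ?thesis using zero by simp
  next
    case False
    have "?R t < ?R v"
      by (rule inc) (use False t a b uv in \<open>auto intro: mult_pos_pos\<close>)
    then show ?thesis using zero by simp
  qed
qed

text \<open>The gap rises from 0 to \<open>u\<close> and falls from \<open>u\<close> to
  \<open>v\<close>, so \<open>u\<close> is a barrier and \<open>v\<close> the well behind it. Hence
  a positive zero below another one neither minimizes the gap nor has gap 0.\<close>

lemma potts_gap_between_zeros:
  assumes r: "r > 1" and g: "g > 0" and uv: "0 < u" "u < v" "v < 1"
    and zero: "potts_slope r g u = 0" "potts_slope r g v = 0"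
  shows "0 < potts_gap r g u" "potts_gap r g v < potts_gap r g u"
proof -
  note der = potts_gap_deriv[OF r]
  have cont: "continuous_on A (potts_gap r g)" for A
    by (rule DERIV_continuous_on, rule has_field_derivative_at_within, rule der)
  have "potts_gap r g 0 < potts_gap r g u"
  proof (rule DERIV_pos_imp_increasing_open[OF uv(1)])
    fix t assume t: "0 < t" "t < u"
    from potts_gap_deriv_sign(1)[OF r _ _ potts_slope_sign_between_zeros(1)[OF r g uv zero t]]
    have "g * ((1 + (r - 1) * t) / r - exp (g * t) / (exp (g * t) + r - 1)) > 0"
      using t uv g by simp
    then show "\<exists>y. (potts_gap r g has_real_derivative y) (at t) \<and> 0 < y" using der by blast
  qed (rule cont)
  then show "0 < potts_gap r g u" by simp
  show "potts_gap r g v < potts_gap r g u"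
  proof (rule DERIV_neg_imp_decreasing_open[OF uv(2)])
    fix t assume t: "u < t" "t < v"
    from potts_gap_deriv_sign(2)[OF r _ _ potts_slope_sign_between_zeros(2)[OF r g uv zero t]]
    have "g * ((1 + (r - 1) * t) / r - exp (g * t) / (exp (g * t) + r - 1)) < 0"
      using t uv g by (simp add: mult_pos_neg)
    then show "\<exists>y. (potts_gap r g has_real_derivative y) (at t) \<and> y < 0" using der by blast
  qed (rule cont)
qed

text \<open>At the zero, \<open>p\<close> is the Gibbs probability of the favoured colour, and
  passing from g to g' at fixed \<open>u\<close> multiplies the partition sum by the Bernoulli
  average \<open>1 - p + p * exp d\<close>. Jensen bounds its logarithm below by
  \<open>p * d\<close>, and the remaining terms add up to \<open>- ?A\<close>.\<close>

lemma potts_gap_strict_antimono: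
  assumes r: "r > 1" and u: "0 < u" "u < 1" and zero: "potts_slope r g u = 0" and gg: "g < g'"
  shows "potts_gap r g' u < potts_gap r g u"
proof -
  define e where "e = exp (g * u)"
  define d where "d = (g' - g) * u"
  define p where "p = (1 + (r - 1) * u) / r"
  let ?A = "(g' - g) * (r - 1) / (2 * r) * u\<^sup>2" and ?J = "1 - p + p * exp d"
  have e: "e > 0" by (simp add: e_def)
  with r have e1: "e + r - 1 > 0" by linarith
  note e = e e1
  have p: "p = e / (e + r - 1)"
    using potts_gap_deriv_sign(3)[OF r _ _ zero] u by (simp add: p_def e_def)
  have p01: "0 < p" "p < 1" using e r by (auto simp: p)
  have e': "exp (g' * u) + r - 1 = (e + r - 1) * ?J"
  proof -
    have "exp (g' * u) = e * exp d" by (simp add: e_def d_def exp_add[symmetric] algebra_simps)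
    moreover have "(e + r - 1) * p = e" using e by (simp add: p)
    then have "(e + r - 1) * ?J = (e + r - 1) - e + e * exp d"
      by (simp add: distrib_left right_diff_distrib mult.assoc[symmetric])
    ultimately show ?thesis by simp
  qed
  have jen: "exp (p * d) \<le> ?J"
  proof -
    have cx: "convex_on UNIV (exp :: real \<Rightarrow> real)"
      by (rule f''_ge0_imp_convex[where f'=exp and f''=exp]) (auto intro: DERIV_exp)
    from convex_onD[OF this, of p 0 d] show ?thesis using p01 by simp
  qed
  have "p * d = ln (exp (p * d))" by simp
  also have "\<dots> \<le> ln ?J"
    using jen by (meson exp_gt_zero ln_mono less_le_trans)
  finally have "p * d \<le> ln ?J" .
  moreover have "ln (exp (g' * u) + r - 1) = ln (e + r - 1) + ln ?J"
    unfolding e' using e jen by (intro ln_mult_pos) (auto intro: less_le_trans[OF exp_gt_zero])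
  ultimately have ln: "ln (exp (g' * u) + r - 1) \<ge> ln (e + r - 1) + p * d" by linarith
  have "potts_gap r g' u - potts_gap r g u = ?A
      + (g' - g) * u / r - (ln (exp (g' * u) + r - 1) - ln (e + r - 1))"
    by (simp add: potts_gap_def e_def left_diff_distrib diff_divide_distrib)
  also have "\<dots> \<le> ?A + (g' - g) * u / r - p * d"
    using ln by simp
  also have "\<dots> = - ?A"
    using r by (simp add: p_def d_def field_simps power2_eq_square)
  also have "\<dots> < 0" using r u gg by simp
  finally show ?thesis by simp
qed

lemma potts_zeta_pos:
  assumes "q \<ge> 3" shows "potts_zeta q > 0"
proof -
  have "ln (real q - 1) > 0" using assms by (intro ln_gt_zero) auto
  then show ?thesis using assms by (simp add: potts_zeta_def)
qed

text \<open>At this \<open>u\<close> one has \<open>1 + (r - 1) * u = r - 1\<close> and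
  \<open>1 - u = inverse (r - 1)\<close>, so \<zeta> u = 2 ln (r - 1) and all exponentials and
  logarithms become explicit.\<close>

lemma
  assumes "q \<ge> 3"
  defines "u \<equiv> (real q - 2) / (real q - 1)"
  shows potts_critical_range: "0 < u" "u < 1"
    and potts_slope_critical: "potts_slope (real q) (potts_zeta q) u = 0"
    and potts_gap_critical: "potts_gap (real q) (potts_zeta q) u = 0"
proof -
  define r where "r = real q"
  define L where "L = ln (r - 1)"
  have r: "r \<ge> 3" using assms by (simp add: r_def)
  show u: "0 < u" "u < 1" using r by (auto simp: u_def r_def[symmetric])
  have z: "potts_zeta q * u = 2 * L"
  proof -
    have one: "(r - 1) / (r - 2) * ((r - 2) / (r - 1)) = 1" using r by simp
    have "potts_zeta q * u = 2 * L * ((r - 1) / (r - 2) * ((r - 2) / (r - 1)))"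
      unfolding potts_zeta_def u_def L_def r_def by (simp only: mult_ac)
    then show ?thesis unfolding one by simp
  qed
  have a: "1 + (r - 1) * u = r - 1" using r by (simp add: u_def r_def[symmetric])
  have b: "1 - u = inverse (r - 1)" using r by (simp add: u_def r_def[symmetric] field_simps)
  show "potts_slope (real q) (potts_zeta q) u = 0"
    using r unfolding potts_slope_def z r_def[symmetric] a b by (simp add: ln_inverse L_def)
  have "exp (2 * L) = exp L * exp L" by (simp only: mult_2 exp_add)
  also have "\<dots> = (r - 1)\<^sup>2" using r by (simp add: L_def power2_eq_square)
  finally have "exp (2 * L) = (r - 1)\<^sup>2" .
  then have e: "exp (2 * L) + r - 1 = (r - 1) * r" by (simp add: power2_eq_square algebra_simps)
  have l: "ln (exp (potts_zeta q * u) + r - 1) = L + ln r"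
    unfolding z e using r by (simp add: ln_mult_pos L_def)
  have "potts_zeta q * (r - 1) / (2 * r) * u\<^sup>2 = (potts_zeta q * u) * (((r - 1) * u) / (2 * r))"
    by (simp add: power2_eq_square)
  also have "(r - 1) * u = r - 2" using r by (simp add: u_def r_def[symmetric])
  also have "(potts_zeta q * u) * ((r - 2) / (2 * r)) = L * ((r - 2) / r)" unfolding z by simp
  also have "(r - 2) / r = 1 - 2 / r" using r by (simp add: diff_divide_distrib)
  finally have "potts_zeta q * (r - 1) / (2 * r) * u\<^sup>2 = L * (1 - 2 / r)" .
  then show "potts_gap (real q) (potts_zeta q) u = 0"
    unfolding potts_gap_def r_def[symmetric] l unfolding z by (simp add: algebra_simps)
qed

text \<open>With y = q - 1 the claim reads 2 ln y < y - 1/y; the difference vanishes at 1 and has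
  derivative (1 - 1/y)^2. This inequality makes the critical minimizers nondegenerate.\<close>

lemma potts_zeta_less:
  assumes "q \<ge> 3" shows "potts_zeta q < real q"
proof -
  define y where "y = real q - 1"
  have y: "y \<ge> 2" using assms by (simp add: y_def)
  define f where "f z = z - inverse z - 2 * ln z" for z :: real
  have der: "(f has_real_derivative (1 - inverse x)\<^sup>2) (at x)" if "x > 0" for x
  proof -
    have "(f has_real_derivative 1 - - (inverse x * 1 * inverse x) - 2 * (inverse x)) (at x)"
      unfolding f_def[abs_def]
      by (intro DERIV_diff DERIV_ident DERIV_inverse' DERIV_cmult DERIV_ln) (use that in auto)
    moreover have "1 - - (inverse x * 1 * inverse x) - 2 * (inverse x) = (1 - inverse x)\<^sup>2"
      by (simp add: power2_eq_square algebra_simps)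
    ultimately show ?thesis by simp
  qed
  have "f 1 < f y"
  proof (rule DERIV_pos_imp_increasing_open[of 1 y f])
    fix x :: real assume x: "1 < x" "x < y"
    then have "(1 - inverse x)\<^sup>2 > 0" by simp
    then show "\<exists>d. (f has_real_derivative d) (at x) \<and> 0 < d" using der[of x] x by force
  next
    show "continuous_on {1..y} f"
      by (rule DERIV_continuous_on[where D="\<lambda>x. (1 - inverse x)\<^sup>2"],
          rule has_field_derivative_at_within, rule der) simp
  qed (use y in simp)
  then have "2 * ln y < y - inverse y" by (simp add: f_def)
  then have "2 * ln y * y < (y - inverse y) * y" using y by (intro mult_strict_right_mono) auto
  also have "(y - inverse y) * y = (y + 1) * (y - 1)" using y by (simp add: algebra_simps)
  finally have "2 * ln y * y / (y - 1) < y + 1" using y by (simp add: pos_divide_less_eq)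
  moreover have "potts_zeta q = 2 * ln y * y / (y - 1)" by (simp add: potts_zeta_def y_def)
  ultimately show ?thesis by (simp add: y_def)
qed

section \<open>The self-consistency equation and its largest solution\<close>

lemma potts_equation_less_1:
  assumes "r > 1" "u = (1 - exp (- g * u)) / (1 + (r - 1) * exp (- g * u))"
  shows "u < (1::real)"
proof -
  have "(1 - exp (- g * u)) / (1 + (r - 1) * exp (- g * u)) < 1"
  proof -
    have "(r - 1) * exp (- g * u) > 0" using assms(1) by simp
    moreover have "exp (- g * u) > 0" by simp
    ultimately show ?thesis by (subst divide_less_eq_1_pos) linarith+
  qed
  then show ?thesis using assms(2) by linarith
qed

text \<open>Clearing the denominator gives \<open>1 - u = (1 + (r - 1) * u) * exp (- g * u)\<close>;
  both sides are positive on [0, 1), so logarithms can be taken.\<close>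

lemma potts_equation_iff_slope:
  assumes r: "r > 1" and u: "0 \<le> u" "u < 1"
  shows "u = (1 - exp (- g * u)) / (1 + (r - 1) * exp (- g * u)) \<longleftrightarrow> potts_slope r g u = 0"
proof -
  define a b e where "a = 1 + (r - 1) * u" and "b = 1 - u" and "e = exp (- g * u)"
  have ab: "a > 0" "b > 0" "e > 0" using r u by (auto simp: a_def b_def e_def add_pos_nonneg)
  have den: "1 + (r - 1) * e > 0" using ab r by (simp add: add_pos_pos)
  have "u = (1 - e) / (1 + (r - 1) * e) \<longleftrightarrow> u * (1 + (r - 1) * e) = 1 - e"
    by (rule nonzero_eq_divide_eq) (use den in simp)
  also have "\<dots> \<longleftrightarrow> b = a * e"
  proof -
    have "u * (1 + (r - 1) * e) - (1 - e) = a * e - b" by (simp add: a_def b_def algebra_simps)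
    then show ?thesis by linarith
  qed
  also have "\<dots> \<longleftrightarrow> ln b = ln (a * e)" using ab by (simp add: ln_inj_iff)
  also have "ln (a * e) = ln a - g * u" using ab by (simp add: ln_mult_pos e_def)
  also have "ln b = ln a - g * u \<longleftrightarrow> potts_slope r g u = 0"
    unfolding potts_slope_def a_def b_def by linarith
  finally show ?thesis unfolding e_def .
qed

lemma
  assumes q: "q \<ge> 2"
  shows potts_u_range: "0 \<le> potts_u q g" "potts_u q g < 1"
    and potts_slope_potts_u: "potts_slope (real q) g (potts_u q g) = 0"
    and potts_u_greatest: "\<And>v. 0 \<le> v \<Longrightarrow> v < 1 \<Longrightarrow> potts_slope (real q) g v = 0 \<Longrightarrow> v \<le> potts_u q g"
proof -
  define r where "r = real q"
  define F where "F u = (1 - exp (- g * u)) / (1 + (r - 1) * exp (- g * u))" for u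
  have r: "r > 1" using q by (simp add: r_def)
  have den: "1 + (r - 1) * exp (- g * u) \<noteq> 0" for u
  proof -
    have "(r - 1) * exp (- g * u) > 0" using r by simp
    then show ?thesis by linarith
  qed
  have F1: "u < 1" if "u = F u" for u 
    using potts_equation_less_1[OF r that[unfolded F_def]] .
  have slope: "u = F u \<longleftrightarrow> potts_slope (real q) g u = 0" if "0 \<le> u" "u < 1" for u
    using potts_equation_iff_slope[OF r that, of g] unfolding F_def r_def .
  \<comment> \<open>The restriction to \<open>{0..1}\<close> makes the solution set compact without
    affecting its maximum, since 0 is a solution and all solutions are below 1.\<close>
  define A where "A = {0..1} \<inter> {u. u = F u}"
  have A_iff: "v \<in> A \<longleftrightarrow> (0 \<le> v \<and> v \<le> 1) \<and> v = F v" for v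
    unfolding A_def by simp
  have "closed {u. u = F u}"
    unfolding F_def by (intro closed_Collect_eq continuous_intros) (use den in auto)
  then have "compact A" unfolding A_def by (intro compact_Int_closed) auto
  moreover have "0 \<in> A" by (simp add: A_def F_def)
  ultimately obtain w where w: "w \<in> A" "\<And>v. v \<in> A \<Longrightarrow> v \<le> w"
    using compact_attains_sup[of A] by blast
  have "potts_u q g = w"
    unfolding potts_u_def r_def[symmetric] F_def[symmetric]
  proof (rule Greatest_equality)
    show "w = F w" using w(1) unfolding A_iff by blast
    show "v \<le> w" if "v = F v" for v
    proof (cases "v \<ge> 0")
      case True
      then show ?thesis using w(2)[of v] F1[OF that] that unfolding A_iff by linarith
    next
      case False
      then show ?thesis using w(1) unfolding A_iff by linarith
    qed
  qed
  then have U: "potts_u q g = w" .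
  moreover have w': "0 \<le> w" "w < 1" "w = F w"
    using w(1) F1[of w] unfolding A_iff by blast+
  ultimately show "0 \<le> potts_u q g" "potts_u q g < 1" by blast+
  show "potts_slope (real q) g (potts_u q g) = 0"
    unfolding U using slope[of w] w' by blast
  show "v \<le> potts_u q g" if "0 \<le> v" "v < 1" "potts_slope (real q) g v = 0" for v
    unfolding U
    using slope[of v] that w(2)[of v] unfolding A_iff by linarith
qed

text \<open>A positive zero below the largest one would be a barrier, with strictly larger gap than
  \<open>potts_u\<close>.\<close>

lemma potts_u_unique_minimum:
  assumes q: "q \<ge> 2" and g: "g > 0" and u: "0 < u" "u < 1"
    and zero: "potts_slope (real q) g u = 0"
    and le: "\<And>v. 0 < v \<Longrightarrow> v < 1 \<Longrightarrow> potts_gap (real q) g u \<le> potts_gap (real q) g v"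
  shows "u = potts_u q g"
proof (rule ccontr)
  assume "u \<noteq> potts_u q g"
  then have "u < potts_u q g" using potts_u_greatest[OF q, of u g] u zero by simp
  then show False
    using potts_gap_between_zeros(2)[of "real q" g u "potts_u q g"] le[of "potts_u q g"]
      potts_u_range[OF q, of g] potts_slope_potts_u[OF q, of g] q g u zero by simp
qed

section \<open>Minimizers of the mean-field free energy\<close>

text \<open>Log-sum-exp takes the place of the entropy, so no simplex constraint is needed: the
  critical equation \<open>potts_minimizer_critical\<close> by itself puts every minimizer into the
  open simplex.\<close>

definition free_energy :: "real \<Rightarrow> real ^ 'q::finite \<Rightarrow> real" where
  "free_energy g x = g / 2 * (\<Sum>c\<in>UNIV. (x $ c)\<^sup>2) - ln (\<Sum>c\<in>UNIV. exp (g * x $ c))"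

definition potts_minimizers :: "real \<Rightarrow> (real ^ 'q::finite) set" where
  "potts_minimizers g = {x. \<forall>y. free_energy g x \<le> free_energy g (y :: real ^ 'q)}"

text \<open>This is \<open>phi\<close> without the factor 1/s, so its coordinates add up to 1. The
  parameter \<open>u\<close> is the difference between the distinguished coordinate and the
  others.\<close>

definition colour_vec :: "'q::finite \<Rightarrow> real \<Rightarrow> real ^ 'q" where
  "colour_vec i u = (\<chi> c. if c = i then (1 + (real CARD('q) - 1) * u) / real CARD('q)
                          else (1 - u) / real CARD('q))"

lemma sum_exp_pos: "(\<Sum>c\<in>(UNIV :: 'q::finite set). exp (f c :: real)) > 0"
  by (rule sum_pos) auto

lemma sum_exp_neq_0: "(\<Sum>c\<in>(UNIV :: 'q::finite set). exp (f c :: real)) \<noteq> 0"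
  using sum_exp_pos[of f] by linarith

lemma real_CARD_ge_1: "1 \<le> real CARD('q::finite)"
  using zero_less_card_finite[where 'a='q] by linarith

lemma sum_if_eq:
  fixes A B :: real and i :: "'q::finite"
  shows "(\<Sum>c\<in>UNIV. if c = i then A else B) = A + (real CARD('q) - 1) * B"
proof -
  have "(\<Sum>c\<in>UNIV. if c = i then A else B) = A + (\<Sum>c\<in>UNIV - {i}. if c = i then A else B)"
    by (subst sum.remove[of _ i]) auto
  also have "(\<Sum>c\<in>UNIV - {i}. if c = i then A else B) = (\<Sum>c\<in>UNIV - {i}. B)"
    by (rule sum.cong) auto
  also have "\<dots> = (real CARD('q) - 1) * B"
    using real_CARD_ge_1[where 'q='q] by (simp add: card_Diff_singleton of_nat_diff)
  finally show ?thesis .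
qed

lemma free_energy_colour_vec:
  fixes i :: "'q::finite"
  shows "free_energy g (colour_vec i u)
    = potts_gap (real CARD('q)) g u - g / (2 * real CARD('q)) - ln (real CARD('q))"
proof -
  define r where "r = real CARD('q)"
  let ?E = "exp (g * u) + r - 1"
  have r: "r \<ge> 1" unfolding r_def by (rule real_CARD_ge_1)
  define a b where "a = (1 + (r - 1) * u) / r" and "b = (1 - u) / r"
  have ab: "a = b + u" using r by (simp add: a_def b_def field_simps)
  have "(\<Sum>c\<in>UNIV. (colour_vec i u $ c)\<^sup>2) = (\<Sum>c\<in>UNIV. if c = i then a\<^sup>2 else b\<^sup>2)"
    by (rule sum.cong) (auto simp: colour_vec_def a_def b_def r_def)
  then have sq: "(\<Sum>c\<in>UNIV. (colour_vec i u $ c)\<^sup>2) = a\<^sup>2 + (r - 1) * b\<^sup>2"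
    by (simp add: sum_if_eq r_def)
  have rb: "r * b = 1 - u" using r by (simp add: b_def)
  have "a\<^sup>2 + (r - 1) * b\<^sup>2 = b * (r * b) + 2 * b * u + u\<^sup>2"
    unfolding ab by (simp add: power2_eq_square algebra_simps)
  also have "\<dots> = b * (1 + u) + u\<^sup>2" unfolding rb by (simp add: algebra_simps)
  also have "\<dots> = (1 - u) * (1 + u) / r + u\<^sup>2" by (simp add: b_def)
  also have "\<dots> = 1 / r + (r - 1) / r * u\<^sup>2"
    using r by (simp add: field_simps power2_eq_square)
  finally have sq': "a\<^sup>2 + (r - 1) * b\<^sup>2 = 1 / r + (r - 1) / r * u\<^sup>2" .
  have "(\<Sum>c\<in>UNIV. exp (g * colour_vec i u $ c)) = (\<Sum>c\<in>UNIV. if c = i then exp (g * a) else exp (g * b))"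
    by (rule sum.cong) (auto simp: colour_vec_def a_def b_def r_def)
  also have "\<dots> = exp (g * a) + (r - 1) * exp (g * b)" by (simp add: sum_if_eq r_def)
  also have "\<dots> = exp (g * b) * ?E"
    by (simp add: ab exp_add algebra_simps)
  finally have e: "(\<Sum>c\<in>UNIV. exp (g * colour_vec i u $ c)) = exp (g * b) * ?E" .
  have pos: "?E > 0" using r exp_gt_zero[of "g * u"] by linarith
  have "ln (exp (g * b) * ?E) = g * b + ln ?E"
    using pos by (simp add: ln_mult_pos)
  then have "free_energy g (colour_vec i u)
      = g / 2 * (1 / r + (r - 1) / r * u\<^sup>2) - g * b - ln ?E"
    by (simp add: free_energy_def sq sq' e)
  also have "g / 2 * (1 / r + (r - 1) / r * u\<^sup>2) = g / (2 * r) + g * (r - 1) / (2 * r) * u\<^sup>2"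
    by (simp add: distrib_left)
  also have "g * b = g / r - g * u / r" by (simp add: b_def right_diff_distrib diff_divide_distrib)
  finally show ?thesis by (simp add: potts_gap_def r_def[symmetric])
qed

lemma continuous_on_free_energy:
  "continuous_on A (free_energy g :: real ^ 'q::finite \<Rightarrow> real)"
  unfolding free_energy_def[abs_def]
  by (intro continuous_intros) (auto simp: sum_exp_neq_0)

lemma potts_minimizer_exists:
  assumes g: "g > 0"
  shows "potts_minimizers g \<noteq> ({} :: (real ^ 'q::finite) set)"
proof -
  \<comment> \<open>The logarithm is at most ln q + g |y|, so from |y| = 2 on the term g |y|^2 / 2
    outweighs g |y| and the free energy is at least its value - ln q at 0.\<close>
  have "cball (0 :: real ^ 'q) 2 \<noteq> {}" by simp
  from continuous_attains_inf[OF compact_cball this continuous_on_free_energy[where g=g]]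
  obtain x :: "real ^ 'q" where x: "x \<in> cball 0 2"
    "\<And>y. y \<in> cball 0 2 \<Longrightarrow> free_energy g x \<le> free_energy g (y :: real ^ 'q)" by metis
  have "free_energy g x \<le> free_energy g y" for y :: "real ^ 'q"
  proof (cases "norm y \<le> 2")
    case True
    then show ?thesis using x(2) by simp
  next
    case False
    have "(\<Sum>c\<in>UNIV. exp (g * y $ c)) \<le> (\<Sum>c\<in>(UNIV::'q set). exp (g * norm y))"
      using g by (intro sum_mono) (simp add: order_trans[OF abs_ge_self component_le_norm_cart])
    then have "ln (\<Sum>c\<in>UNIV. exp (g * y $ c)) \<le> ln (real CARD('q) * exp (g * norm y))"
      using sum_exp_pos[of "\<lambda>c. g * y $ c"] by simp
    also have "\<dots> = ln (real CARD('q)) + g * norm y" by (simp add: ln_mult_pos)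
    finally have l: "ln (\<Sum>c\<in>UNIV. exp (g * y $ c)) \<le> ln (real CARD('q)) + g * norm y" .
    have n: "(\<Sum>c\<in>UNIV. (y $ c)\<^sup>2) = (norm y)\<^sup>2"
      unfolding power2_norm_eq_inner inner_vec_def by (simp add: power2_eq_square)
    have "g / 2 * norm y * (norm y - 2) \<ge> 0" using False g by simp
    then have "free_energy g y \<ge> - ln (real CARD('q))"
      unfolding free_energy_def n using l by (simp add: power2_eq_square algebra_simps)
    moreover have "free_energy g (0 :: real ^ 'q) = - ln (real CARD('q))"
      by (simp add: free_energy_def)
    moreover have "free_energy g x \<le> free_energy g (0 :: real ^ 'q)" by (rule x(2)) simp
    ultimately show ?thesis by linarith
  qed
  then show ?thesis by (auto simp: potts_minimizers_def)
qed

text \<open>Varying one coordinate suffices: the others enter only through the constants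
  \<open>S1\<close> and \<open>S2\<close>, and the one-variable function \<phi> has a minimum at
  \<open>x $ c\<close>.\<close>

lemma potts_minimizer_critical:
  assumes g: "g > 0" and x: "x \<in> potts_minimizers g"
  shows "x $ c = exp (g * x $ c) / (\<Sum>d\<in>UNIV. exp (g * x $ d))"
proof -
  define S1 where "S1 = (\<Sum>d\<in>UNIV - {c}. (x $ d)\<^sup>2)"
  define S2 where "S2 = (\<Sum>d\<in>UNIV - {c}. exp (g * x $ d))"
  define Z where "Z = (\<Sum>d\<in>UNIV. exp (g * x $ d))"
  define \<phi> where "\<phi> t = g / 2 * (t\<^sup>2 + S1) - ln (exp (g * t) + S2)" for t
  have Z: "Z = exp (g * x $ c) + S2" unfolding Z_def S2_def by (rule sum.remove) auto
  have S2: "S2 \<ge> 0" unfolding S2_def by (rule sum_nonneg) simp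
  have eq: "free_energy g (\<chi> d. if d = c then t else x $ d) = \<phi> t" for t
  proof -
    have "(\<Sum>d\<in>UNIV. (if d = c then t else x $ d)\<^sup>2) = t\<^sup>2 + S1"
      unfolding S1_def by (subst sum.remove[of _ c]) auto
    moreover have "(\<Sum>d\<in>UNIV. exp (g * (if d = c then t else x $ d))) = exp (g * t) + S2"
      unfolding S2_def by (subst sum.remove[of _ c]) auto
    ultimately show ?thesis by (simp add: free_energy_def \<phi>_def)
  qed
  have "(\<chi> d. if d = c then x $ c else x $ d) = x" by (simp add: vec_eq_iff)
  then have x0: "free_energy g x = \<phi> (x $ c)" using eq[of "x $ c"] by simp
  have min: "\<phi> (x $ c) \<le> \<phi> t" for t
  proof -
    have "free_energy g x \<le> free_energy g (\<chi> d. if d = c then t else x $ d)"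
      using x unfolding potts_minimizers_def by blast
    then show ?thesis unfolding x0 eq .
  qed
  have pos: "exp (g * x $ c) + S2 > 0" using S2 by (simp add: add_pos_nonneg)
  have "((\<lambda>t. ln (exp (g * t) + S2)) has_real_derivative
      1 / (exp (g * x $ c) + S2) * (g * exp (g * x $ c))) (at (x $ c))"
    using DERIV_ln_divide[OF pos]
    by (rule DERIV_chain2[where f=ln and g="\<lambda>u. exp (g * u) + S2"])
      (auto intro!: derivative_eq_intros)
  moreover have "((\<lambda>t. g / 2 * (t\<^sup>2 + S1)) has_real_derivative g * x $ c) (at (x $ c))"
    by (auto intro!: derivative_eq_intros)
  ultimately have "(\<phi> has_real_derivative
      g * x $ c - 1 / (exp (g * x $ c) + S2) * (g * exp (g * x $ c))) (at (x $ c))"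
    unfolding \<phi>_def[abs_def] by (intro DERIV_diff)
  from DERIV_local_min[OF this, of 1] min
  have "g * x $ c = g * (exp (g * x $ c) / Z)" by (simp add: Z)
  then have "x $ c = exp (g * x $ c) / Z" using g by (subst (asm) mult_left_cancel) auto
  then show ?thesis unfolding Z_def .
qed

lemma potts_minimizer_pos:
  assumes "g > 0" "x \<in> potts_minimizers g" shows "0 < x $ c"
  using potts_minimizer_critical[OF assms, of c] sum_exp_pos[of "\<lambda>d. g * x $ d"]
  by (metis divide_pos_pos exp_gt_zero)

lemma potts_minimizer_sum:
  assumes "g > 0" "x \<in> potts_minimizers g" shows "(\<Sum>c\<in>UNIV. x $ c) = 1"
proof -
  have "(\<Sum>c\<in>UNIV. x $ c) = (\<Sum>c\<in>UNIV. exp (g * x $ c) / (\<Sum>d\<in>UNIV. exp (g * x $ d)))"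
    by (rule sum.cong[OF refl]) (rule potts_minimizer_critical[OF assms])
  then show ?thesis by (simp add: sum_divide_distrib[symmetric] sum_exp_neq_0)
qed

lemma potts_minimizer_ln:
  assumes g: "g > 0" and x: "x \<in> potts_minimizers g"
  shows "ln (x $ c) = g * x $ c - ln (\<Sum>d\<in>UNIV. exp (g * x $ d))"
  by (subst potts_minimizer_critical[OF g x]) (simp add: ln_div sum_exp_pos sum_exp_neq_0)

text \<open>Moving mass \<open>t\<close> between two coordinates carrying the same value \<open>a\<close> changes the free energy by
  \<open>g t\<^sup>2 - ln (1 + a (exp (g t) + exp (- g t) - 2))\<close>, which is negative for small \<open>t\<close> if \<open>a > 1 / g\<close>.\<close>

lemma potts_minimizer_equal_coords:
  assumes g: "g > 0" and x: "x \<in> potts_minimizers g" and cd: "c \<noteq> d" "x $ c = x $ d"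
  shows "x $ c \<le> 1 / g"
proof -
  define a where "a = x $ c"
  define Z where "Z = (\<Sum>d\<in>UNIV. exp (g * x $ d))"
  have Z: "Z > 0" unfolding Z_def by (rule sum_exp_pos)
  have ea: "exp (g * a) = a * Z"
    using potts_minimizer_critical[OF g x, of c] Z by (simp add: a_def Z_def field_simps)
  have a: "a > 0" unfolding a_def by (rule potts_minimizer_pos[OF g x])
  have bound: "a * exp (- (g * t)) * g\<^sup>2 \<le> g * (1 + a * exp (- (g * t)) * g\<^sup>2 * t\<^sup>2)" if t: "t > 0" for t
  proof -
    define y where "y = (\<chi> e. if e = c then a + t else if e = d then a - t else x $ e)"
    define w where "w = exp (g * t) + exp (- (g * t)) - 2"
    define R :: "'a set" where "R = UNIV - {c, d}"
    have split: "(\<Sum>e\<in>UNIV. f e) = f c + f d + sum f R" for f :: "_ \<Rightarrow> real"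
    proof -
      have "(\<Sum>e\<in>UNIV. f e) = sum f {c, d} + sum f R"
        unfolding R_def by (subst sum.subset_diff[of "{c, d}"]) auto
      then show ?thesis using cd by simp
    qed
    have yx: "y $ c = a + t" "y $ d = a - t" "x $ c = a" "x $ d = a" "\<And>e. e \<in> R \<Longrightarrow> y $ e = x $ e"
      using cd by (auto simp: y_def R_def a_def)
    have sq: "(\<Sum>e\<in>UNIV. (y $ e)\<^sup>2) = (\<Sum>e\<in>UNIV. (x $ e)\<^sup>2) + 2 * t\<^sup>2"
    proof -
      have "(\<Sum>e\<in>R. (y $ e)\<^sup>2) = (\<Sum>e\<in>R. (x $ e)\<^sup>2)"
        by (rule sum.cong) (auto simp: yx)
      moreover have "(a + t)\<^sup>2 + (a - t)\<^sup>2 = a\<^sup>2 + a\<^sup>2 + 2 * t\<^sup>2"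
        by (simp add: power2_eq_square algebra_simps)
      ultimately show ?thesis unfolding split yx by linarith
    qed
    have ex: "(\<Sum>e\<in>UNIV. exp (g * y $ e)) = Z * (1 + a * w)"
    proof -
      have "(\<Sum>e\<in>R. exp (g * y $ e)) = (\<Sum>e\<in>R. exp (g * x $ e))"
        by (rule sum.cong) (auto simp: yx)
      moreover have "Z = exp (g * a) + exp (g * a) + (\<Sum>e\<in>R. exp (g * x $ e))"
        unfolding Z_def split yx ..
      moreover have "exp (g * (a + t)) = exp (g * a) * exp (g * t)"
        by (simp only: distrib_left exp_add)
      moreover have "exp (g * (a - t)) = exp (g * a) * exp (- (g * t))"
        by (simp only: exp_add[symmetric] right_diff_distrib add_uminus_conv_diff)
      ultimately have "(\<Sum>e\<in>UNIV. exp (g * y $ e)) = Z + exp (g * a) * w"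
        unfolding split yx w_def by (simp add: algebra_simps)
      then show ?thesis unfolding ea by (simp add: algebra_simps)
    qed
    \<comment> \<open>With \<open>E = exp (g * t)\<close> one has w = (E - 1)^2 / E, and E - 1 is at
      least g t.\<close>
    have w: "w \<ge> exp (- (g * t)) * (g * t)\<^sup>2"
    proof -
      define E where "E = exp (g * t)"
      have E: "E > 0" "E - 1 \<ge> g * t" "exp (- (g * t)) = inverse E"
        using exp_ge_add_one_self[of "g * t"] unfolding E_def exp_minus by (simp, linarith, simp)
      have "(g * t)\<^sup>2 \<le> (E - 1)\<^sup>2" using E g t by (intro power_mono) auto
      then have "inverse E * (g * t)\<^sup>2 \<le> inverse E * (E - 1)\<^sup>2"
        using E by (intro mult_left_mono) auto
      also have "\<dots> = (inverse E * E) * (E - 2) + inverse E"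
        by (simp add: power2_eq_square algebra_simps)
      also have "inverse E * E = 1" using E by simp
      finally show ?thesis unfolding w_def E(3) E_def[symmetric] by simp
    qed
    define v where "v = a * exp (- (g * t)) * g\<^sup>2 * t\<^sup>2"
    have v: "0 \<le> v" "v \<le> a * w"
      using w a by (auto simp: v_def power_mult_distrib mult.assoc intro: mult_left_mono)
    have "free_energy g x \<le> free_energy g y" using x by (simp add: potts_minimizers_def)
    then have "ln (Z * (1 + a * w)) - ln Z \<le> g * t\<^sup>2"
      by (simp add: free_energy_def sq ex Z_def[symmetric] algebra_simps)
    then have "ln (1 + a * w) \<le> g * t\<^sup>2" using Z v by (simp add: ln_mult_pos)
    moreover have "ln (1 + v) \<le> ln (1 + a * w)" using v by simp
    moreover have "v / (1 + v) \<le> ln (1 + v)"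
    proof -
      have "ln (inverse (1 + v)) \<le> inverse (1 + v) - 1" using v by (intro ln_le_minus_one) simp
      moreover have "1 - inverse (1 + v) = v / (1 + v)" using v by (simp add: field_simps)
      ultimately show ?thesis using v by (simp add: ln_inverse)
    qed
    ultimately have "v / (1 + v) \<le> g * t\<^sup>2" by linarith
    then have "v \<le> g * t\<^sup>2 * (1 + v)" using v by (simp add: pos_divide_le_eq)
    then have "a * exp (- (g * t)) * g\<^sup>2 * t\<^sup>2 \<le> (g * (1 + v)) * t\<^sup>2" by (simp add: v_def mult_ac)
    then have "a * exp (- (g * t)) * g\<^sup>2 \<le> g * (1 + v)" using t by (simp add: mult_le_cancel_right)
    then show ?thesis by (simp add: v_def)
  qed
  \<comment> \<open>The factor t^2 has been cancelled in \<open>bound\<close>, so letting t decrease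
    to 0 leaves a g^2 \<le> g.\<close>
  have l1: "((\<lambda>t. a * exp (- (g * t)) * g\<^sup>2) \<longlongrightarrow> a * exp (- (g * 0)) * g\<^sup>2) (at_right 0)"
    by (intro tendsto_intros)
  have l2: "((\<lambda>t. g * (1 + a * exp (- (g * t)) * g\<^sup>2 * t\<^sup>2)) \<longlongrightarrow>
      g * (1 + a * exp (- (g * 0)) * g\<^sup>2 * 0\<^sup>2)) (at_right 0)"
    by (intro tendsto_intros)
  have "a * exp (- (g * 0)) * g\<^sup>2 \<le> g * (1 + a * exp (- (g * 0)) * g\<^sup>2 * 0\<^sup>2)"
    by (rule tendsto_le[OF _ l2 l1]) (auto simp: eventually_at_right_less eventually_at_filter bound)
  then have "a * g * g \<le> 1 * g" by (simp add: power2_eq_square)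
  then have "a * g \<le> 1" using g mult_le_cancel_right by (metis not_less_iff_gr_or_eq)
  then show ?thesis using g by (simp add: a_def field_simps)
qed

text \<open>All coordinates of a minimizer give \<open>ln t - g * t\<close> the same value, and this
  strictly concave function peaks at 1/g, so two distinct coordinates lie on opposite sides of 1/g.
  In the proof this is ln z < z - 1 for the ratio and for its inverse.\<close>

lemma potts_minimizer_less_coords:
  assumes g: "g > 0" and x: "x \<in> potts_minimizers g" and cd: "x $ c < x $ d"
  shows "x $ c < 1 / g" "1 / g < x $ d"
proof -
  note pos = potts_minimizer_pos[OF g x] and l = potts_minimizer_ln[OF g x]
  have "ln (x $ d / x $ c) = g * (x $ d - x $ c)"
    using pos[of c] pos[of d] by (simp add: ln_div l right_diff_distrib)
  moreover have "ln (x $ d / x $ c) < x $ d / x $ c - 1"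
    using pos[of c] pos[of d] cd ln_eq_minus_one[of "x $ d / x $ c"]
    by (intro order.not_eq_order_implies_strict ln_le_minus_one) auto
  ultimately have "g * (x $ d - x $ c) < (x $ d - x $ c) / x $ c"
    using pos[of c] by (simp add: diff_divide_distrib)
  then have "g * (x $ d - x $ c) < (1 / x $ c) * (x $ d - x $ c)" by simp
  then have "g < 1 / x $ c" using cd by (subst (asm) mult_less_cancel_right_pos) auto
  then show "x $ c < 1 / g" using g pos[of c] by (simp add: field_simps)
  have "ln (x $ c / x $ d) = - (g * (x $ d - x $ c))"
    using pos[of c] pos[of d] by (simp add: ln_div l right_diff_distrib)
  moreover have "ln (x $ c / x $ d) < x $ c / x $ d - 1"
    using pos[of c] pos[of d] cd ln_eq_minus_one[of "x $ c / x $ d"]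
    by (intro order.not_eq_order_implies_strict ln_le_minus_one) auto
  ultimately have "(x $ d - x $ c) / x $ d < g * (x $ d - x $ c)"
    using pos[of d] by (simp add: diff_divide_distrib)
  then have "(1 / x $ d) * (x $ d - x $ c) < g * (x $ d - x $ c)" by simp
  then have "1 / x $ d < g" using cd by (subst (asm) mult_less_cancel_right_pos) auto
  then show "1 / g < x $ d" using g pos[of d] by (simp add: field_simps)
qed

text \<open>Distinct coordinates are separated by 1/g, so there are at most two values, and by
  \<open>potts_minimizer_equal_coords\<close> a value above 1/g occurs only once. The parameter u is
  the difference of the two values.\<close>

lemma potts_minimizer_cases:
  fixes x :: "real ^ 'q::finite"
  assumes q: "CARD('q) \<ge> 2" and g: "g > 0" and x: "x \<in> potts_minimizers g"
  obtains "\<And>i. x = colour_vec i 0"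
  | i u where "0 < u" "u < 1" "x = colour_vec i u" "potts_slope (real CARD('q)) g u = 0"
proof (cases "\<forall>c d. x $ c = x $ d")
  note pos = potts_minimizer_pos[OF g x]
  note sum = potts_minimizer_sum[OF g x]
  { case True
    have "x = colour_vec i 0" for i
    proof -
      have "(\<Sum>e\<in>UNIV. x $ e) = (\<Sum>e\<in>(UNIV::'q set). x $ i)" by (rule sum.cong) (use True in auto)
      then have "x $ i = 1 / real CARD('q)" using sum by (simp add: field_simps)
      then have "x $ e = 1 / real CARD('q)" for e using True by metis
      then show ?thesis by (simp add: vec_eq_iff colour_vec_def)
    qed
    then show thesis by (rule that(1)) }
  { case False
    then obtain c d where cd: "x $ c < x $ d" by (metis linorder_neqE)
    have big: "1 / g < x $ d" and small: "x $ c < 1 / g"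
      using potts_minimizer_less_coords[OF g x cd] by auto
    have others: "x $ e = x $ c" if "e \<noteq> d" for e
    proof -
      have "x $ e \<le> 1 / g"
      proof (rule ccontr)
        assume *: "\<not> x $ e \<le> 1 / g"
        then have "x $ e \<noteq> x $ d" using potts_minimizer_equal_coords[OF g x, of e d] that by auto
        then show False using potts_minimizer_less_coords(1)[OF g x, of e d]
            potts_minimizer_less_coords(1)[OF g x, of d e] big * by fastforce
      qed
      then show ?thesis using potts_minimizer_less_coords(2)[OF g x, of e c]
            potts_minimizer_less_coords(2)[OF g x, of c e] small by fastforce
    qed
    define u where "u = x $ d - x $ c"
    have u0: "u > 0" using cd by (simp add: u_def)
    have "(\<Sum>e\<in>UNIV. x $ e) = (\<Sum>e\<in>UNIV. if e = d then x $ d else x $ c)"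
      by (rule sum.cong) (use others in auto)
    then have one: "x $ d + (real CARD('q) - 1) * x $ c = 1" using sum by (simp add: sum_if_eq)
    then have "real CARD('q) * x $ c = 1 - u" by (simp add: u_def algebra_simps)
    then have xc: "x $ c = (1 - u) / real CARD('q)" by (simp add: field_simps)
    have xd: "x $ d = (1 + (real CARD('q) - 1) * u) / real CARD('q)"
    proof -
      have "real CARD('q) * x $ d = 1 + (real CARD('q) - 1) * u"
        using one by (simp add: u_def algebra_simps)
      then show ?thesis by (simp add: field_simps)
    qed
    have u1: "u < 1" using pos[of c] unfolding xc by (simp add: zero_less_divide_iff)
    have xv: "x = colour_vec d u" using others xc xd by (auto simp: vec_eq_iff colour_vec_def)
    have p: "1 + (real CARD('q) - 1) * u > 0" "1 - u > 0" using u0 u1 q by (auto simp: add_pos_nonneg)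
    have "ln (x $ d) - ln (x $ c) = g * u" by (simp add: potts_minimizer_ln[OF g x] u_def right_diff_distrib)
    then have "potts_slope (real CARD('q)) g u = 0"
      unfolding xc xd using p by (simp add: ln_div potts_slope_def)
    with u0 u1 xv show thesis by (rule that(2)) }
qed

lemma potts_minimizer_colour_vecD:
  fixes i :: "'q::finite"
  assumes q: "CARD('q) \<ge> 2" and g: "g > 0" and u: "0 < u" "u < 1"
    and zero: "potts_slope (real CARD('q)) g u = 0" and min: "colour_vec i u \<in> potts_minimizers g"
  shows "u = potts_u CARD('q) g"
proof (rule potts_u_unique_minimum[OF q g u zero])
  fix v :: real
  have "free_energy g (colour_vec i u) \<le> free_energy g (colour_vec i v)"
    using min unfolding potts_minimizers_def by blast
  then show "potts_gap (real CARD('q)) g u \<le> potts_gap (real CARD('q)) g v"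
    by (simp add: free_energy_colour_vec)
qed

text \<open>If \<open>potts_u\<close> were larger than the explicit zero, that zero would be a
  barrier with positive gap, but its gap is 0. All candidates then have equal free energy; since
  some minimizer exists and is one of them, all of them are minimizers.\<close>

lemma potts_minimizers_critical:
  assumes q: "CARD('q::finite) \<ge> 3" and r: "r = real CARD('q)" and \<zeta>: "\<zeta> = potts_zeta CARD('q)"
  shows "potts_u CARD('q) \<zeta> = (r - 2) / (r - 1)"
    and "potts_minimizers \<zeta> = insert (colour_vec i 0) (range (\<lambda>i::'q. colour_vec i ((r - 2) / (r - 1))))"
proof -
  define u where "u = (r - 2) / (r - 1)"
  have \<zeta>0: "\<zeta> > 0" using potts_zeta_pos[OF q] by (simp add: \<zeta>)
  have u: "0 < u" "u < 1" and s: "potts_slope r \<zeta> u = 0" and h: "potts_gap r \<zeta> u = 0"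
    using potts_critical_range[OF q] potts_slope_critical[OF q] potts_gap_critical[OF q]
    by (auto simp: u_def r \<zeta>)
  have q2: "CARD('q) \<ge> 2" using q by simp
  have r1: "r > 1" using q by (simp add: r)
  let ?U = "potts_u CARD('q) \<zeta>"
  have "u \<le> ?U" using potts_u_greatest[OF q2, of u \<zeta>] u s by (simp add: r)
  moreover have "\<not> u < ?U"
    using potts_gap_between_zeros(1)[OF r1 \<zeta>0 u(1), of ?U] potts_u_range[OF q2, of \<zeta>]
      potts_slope_potts_u[OF q2, of \<zeta>] s h by (auto simp: r)
  ultimately have U: "?U = u" by simp
  then show "potts_u CARD('q) \<zeta> = (r - 2) / (r - 1)" by (simp add: u_def)
  have same: "free_energy \<zeta> (colour_vec j u) = free_energy \<zeta> (colour_vec k 0)" for j k :: 'q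
    using h by (simp add: free_energy_colour_vec r)
  have same0: "colour_vec j 0 = colour_vec k 0" for j k :: 'q
    by (simp add: colour_vec_def vec_eq_iff)
  have sub: "x = colour_vec i 0 \<or> (\<exists>j::'q. x = colour_vec j u)" if x: "x \<in> potts_minimizers \<zeta>" for x
    using q2 \<zeta>0 x
  proof (cases rule: potts_minimizer_cases)
    case (2 j v)
    have "v = potts_u CARD('q) \<zeta>"
      using potts_minimizer_colour_vecD[OF q2 \<zeta>0 2(1,2,4)] x 2(3) by blast
    then show ?thesis using 2 U by auto
  qed auto
  obtain x :: "real ^ 'q" where x: "x \<in> potts_minimizers \<zeta>"
    using potts_minimizer_exists[OF \<zeta>0] by blast
  have val: "free_energy \<zeta> x = free_energy \<zeta> (colour_vec i 0)"
    using sub[OF x] same by auto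
  have "colour_vec i 0 \<in> potts_minimizers \<zeta>" "colour_vec j u \<in> potts_minimizers \<zeta>" for j :: 'q
    using x by (auto simp: potts_minimizers_def same[where k=i] val)
  with sub show "potts_minimizers \<zeta> = insert (colour_vec i 0) (range (\<lambda>i::'q. colour_vec i ((r - 2) / (r - 1))))"
    by (auto simp: u_def[symmetric])
qed

text \<open>An ordered minimizer would have gap at most 0 at g, hence negative gap at \<zeta> by
  monotonicity, although \<open>colour_vec i 0\<close> still minimizes at \<zeta>.\<close>

lemma potts_minimizers_subcritical:
  assumes q: "CARD('q::finite) \<ge> 3" and g: "0 < g" "g < potts_zeta CARD('q)"
  shows "potts_minimizers g \<subseteq> {colour_vec (i::'q) 0}"
proof
  fix x :: "real ^ 'q" assume x: "x \<in> potts_minimizers g"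
  have q2: "CARD('q) \<ge> 2" using q by simp
  show "x \<in> {colour_vec i 0}" using q2 g(1) x
  proof (cases rule: potts_minimizer_cases)
    case (2 j u)
    have "free_energy g x \<le> free_energy g (colour_vec j 0)"
      using x by (simp add: potts_minimizers_def)
    then have "potts_gap (real CARD('q)) g u \<le> 0"
      by (simp add: 2 free_energy_colour_vec)
    moreover have "potts_gap (real CARD('q)) (potts_zeta CARD('q)) u < potts_gap (real CARD('q)) g u"
      using potts_gap_strict_antimono[OF _ 2(1,2,4) g(2)] q by simp
    moreover have "colour_vec j 0 \<in> potts_minimizers (potts_zeta CARD('q))"
      using potts_minimizers_critical(2)[OF q refl refl, of j] by simp
    then have "free_energy (potts_zeta CARD('q)) (colour_vec j 0) \<le> free_energy (potts_zeta CARD('q)) (colour_vec j u)"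
      unfolding potts_minimizers_def by blast
    then have "0 \<le> potts_gap (real CARD('q)) (potts_zeta CARD('q)) u"
      by (simp add: free_energy_colour_vec)
    ultimately show ?thesis by linarith
  qed simp
qed

text \<open>The critical zero serves as a test point: its gap is 0 at \<zeta> and so negative at g,
  which rules out the disordered vector.\<close>

lemma potts_minimizers_supercritical:
  assumes q: "CARD('q::finite) \<ge> 3" and g: "g > potts_zeta CARD('q)"
  shows "potts_minimizers g \<subseteq> range (\<lambda>i::'q. colour_vec i (potts_u CARD('q) g))"
proof
  fix x :: "real ^ 'q" assume x: "x \<in> potts_minimizers g"
  have q2: "CARD('q) \<ge> 2" using q by simp
  have g0: "g > 0" using g potts_zeta_pos[OF q] by simp
  show "x \<in> range (\<lambda>i::'q. colour_vec i (potts_u CARD('q) g))" using q2 g0 x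
  proof (cases rule: potts_minimizer_cases)
    case 1
    define u where "u = (real CARD('q) - 2) / (real CARD('q) - 1)"
    have "potts_gap (real CARD('q)) g u < 0"
      using potts_gap_strict_antimono[OF _ potts_critical_range[OF q] potts_slope_critical[OF q] g]
        potts_gap_critical[OF q] q by (simp add: u_def)
    moreover have "free_energy g x \<le> free_energy g (colour_vec (undefined :: 'q) u)"
      using x by (simp add: potts_minimizers_def)
    then have "0 \<le> potts_gap (real CARD('q)) g u"
      by (simp add: 1[of undefined] free_energy_colour_vec)
    ultimately show ?thesis by linarith
  next
    case (2 j v)
    have "v = potts_u CARD('q) g"
      using potts_minimizer_colour_vecD[OF q2 g0 2(1,2,4)] x 2(3) by blast
    then show ?thesis using 2 by auto
  qed
qed

section \<open>Interaction, partition function and law\<close>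

abbreviation pairing :: "('s::finite \<Rightarrow> 'q::finite \<Rightarrow> real) \<Rightarrow> real ^ 'q ^ 's \<Rightarrow> real" where
  "pairing h m \<equiv> \<Sum>k\<in>UNIV. \<Sum>c\<in>UNIV. h k c * m $ k $ c"

abbreviation sq_sum :: "real ^ 'q::finite ^ 's::finite \<Rightarrow> real" where
  "sq_sum m \<equiv> \<Sum>k\<in>UNIV. \<Sum>c\<in>UNIV. (m $ k $ c)\<^sup>2"

text \<open>Minus the energy per site, as a function of the magnetization. Splitting the same-block
  coupling as (\<beta> - \<alpha>) + \<alpha> displays a sum of two nonnegative forms.\<close>

definition interaction :: "real \<Rightarrow> real \<Rightarrow> real ^ 'q::finite ^ 's::finite \<Rightarrow> real" where
  "interaction \<alpha> \<beta> m = (\<beta> - \<alpha>) / 2 * sq_sum m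
     + \<alpha> / 2 * (\<Sum>c\<in>UNIV. (\<Sum>k\<in>UNIV. m $ k $ c)\<^sup>2)"

definition row_spread :: "real ^ 'q::finite ^ 's::finite \<Rightarrow> real" where
  "row_spread m = (\<Sum>c\<in>UNIV. \<Sum>k\<in>UNIV. \<Sum>l\<in>UNIV. (m $ k $ c - m $ l $ c)\<^sup>2) / 2"

definition constant_rows :: "real ^ 'q::finite \<Rightarrow> real ^ 'q ^ 's::finite" where
  "constant_rows x = (\<chi> k c. x $ c / real CARD('s))"

lemma row_spread_nonneg: "0 \<le> row_spread m"
  unfolding row_spread_def by (simp add: sum_nonneg)

lemma row_spread_eq_0D:
  assumes "row_spread m = 0" shows "m $ k = m $ l"
proof -
  have "(\<Sum>c\<in>UNIV. \<Sum>k\<in>UNIV. \<Sum>l\<in>UNIV. (m $ k $ c - m $ l $ c)\<^sup>2) = 0"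
    using assms by (simp add: row_spread_def)
  then have "(m $ k $ c - m $ l $ c)\<^sup>2 = 0" for c
    by (simp add: sum_nonneg_eq_0_iff sum_nonneg)
  then show ?thesis by (simp add: vec_eq_iff)
qed

lemma sum_square_diff:
  fixes f :: "'s::finite \<Rightarrow> real"
  shows "(\<Sum>k\<in>UNIV. \<Sum>l\<in>UNIV. (f k - f l)\<^sup>2)
    = 2 * real CARD('s) * (\<Sum>k\<in>UNIV. (f k)\<^sup>2) - 2 * (\<Sum>k\<in>UNIV. f k)\<^sup>2"
proof -
  define A B where "A = (\<Sum>k\<in>UNIV. (f k)\<^sup>2)" and "B = (\<Sum>k\<in>UNIV. f k)"
  have "(\<Sum>l\<in>UNIV. (f k - f l)\<^sup>2) = real CARD('s) * (f k)\<^sup>2 + A - 2 * f k * B" for k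
    unfolding A_def B_def
    by (simp add: power2_diff sum.distrib sum_subtractf sum_distrib_left)
  then have "(\<Sum>k\<in>UNIV. \<Sum>l\<in>UNIV. (f k - f l)\<^sup>2) =
     (\<Sum>k\<in>UNIV. real CARD('s) * (f k)\<^sup>2 + A - 2 * f k * B)" by simp
  also have "\<dots> = real CARD('s) * A + real CARD('s) * A - 2 * B * B"
    unfolding sum_subtractf sum.distrib
    by (simp add: A_def B_def sum_distrib_left[symmetric] sum_distrib_right[symmetric])
  finally show ?thesis by (simp add: A_def B_def power2_eq_square)
qed

text \<open>In every column the square of the sum is s times the sum of squares minus the spread
  over unordered pairs of rows. With g s = (\<beta> - \<alpha>) + s \<alpha>, unequal rows appear
  only as a penalty of strength \<alpha>.\<close>

lemma interaction_eq:
  fixes m :: "real ^ 'q::finite ^ 's::finite"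
  assumes g: "g = (\<beta> + (real CARD('s) - 1) * \<alpha>) / real CARD('s)"
  shows "interaction \<alpha> \<beta> m = g * real CARD('s) / 2 * sq_sum m
    - \<alpha> / 2 * row_spread m"
proof -
  define A B where "A = sq_sum m"
    and "B = (\<Sum>c\<in>UNIV. (\<Sum>k\<in>UNIV. m $ k $ c)\<^sup>2)"
  have "row_spread m = (\<Sum>c\<in>UNIV. 2 * real CARD('s) * (\<Sum>k\<in>UNIV. (m $ k $ c)\<^sup>2)
      - 2 * (\<Sum>k\<in>UNIV. m $ k $ c)\<^sup>2) / 2"
    unfolding row_spread_def sum_square_diff ..
  also have "\<dots> = real CARD('s) * (\<Sum>c\<in>UNIV. \<Sum>k\<in>UNIV. (m $ k $ c)\<^sup>2) - B"
    unfolding sum_subtractf by (simp add: sum_distrib_left[symmetric] B_def)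
  also have "(\<Sum>c\<in>UNIV. \<Sum>k\<in>UNIV. (m $ k $ c)\<^sup>2) = A" unfolding A_def by (rule sum.swap)
  finally have D: "row_spread m = real CARD('s) * A - B" .
  have "g * real CARD('s) = \<beta> + (real CARD('s) - 1) * \<alpha>" unfolding g by simp
  then have gs: "g * real CARD('s) = \<beta> - \<alpha> + real CARD('s) * \<alpha>"
    by (simp add: left_diff_distrib)
  show ?thesis unfolding interaction_def A_def[symmetric] B_def[symmetric] gs D
    by (simp add: algebra_simps add_divide_distrib diff_divide_distrib)
qed

lemma interaction_nonneg:
  assumes "0 \<le> \<alpha>" "\<alpha> \<le> \<beta>" shows "0 \<le> interaction \<alpha> \<beta> m"
  unfolding interaction_def using assms
  by (intro add_nonneg_nonneg mult_nonneg_nonneg sum_nonneg) auto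

text \<open>Matrices with equal rows are eigenvectors of the block coupling with eigenvalue g s, so
  in the expansion about \<open>constant_rows x\<close> the linear and constant terms depend on
  \<alpha> and \<beta> only through g.\<close>

lemma interaction_shift:
  fixes m :: "real ^ 'q::finite ^ 's::finite"
  assumes g: "g = (\<beta> + (real CARD('s) - 1) * \<alpha>) / real CARD('s)"
  shows "interaction \<alpha> \<beta> m = g * (\<Sum>k\<in>UNIV. \<Sum>c\<in>UNIV. x $ c * m $ k $ c)
     - g / 2 * (\<Sum>c\<in>UNIV. (x $ c)\<^sup>2) + interaction \<alpha> \<beta> (m - constant_rows x)"
proof -
  define s where "s = real CARD('s)"
  have s: "s > 0" by (simp add: s_def)
  define X Y where "X = (\<Sum>k\<in>UNIV. \<Sum>c\<in>UNIV. x $ c * m $ k $ c)" and "Y = (\<Sum>c\<in>UNIV. (x $ c)\<^sup>2)"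
  have 1: "sq_sum (m - constant_rows x)
    = sq_sum m - 2 / s * X + Y / s"
  proof -
    have "sq_sum (m - constant_rows x)
      = (\<Sum>k\<in>UNIV. \<Sum>c\<in>UNIV. (m $ k $ c)\<^sup>2 - 2 / s * (x $ c * m $ k $ c) + (x $ c)\<^sup>2 / s\<^sup>2)"
      by (intro sum.cong refl) (simp add: constant_rows_def s_def[symmetric] power2_diff power_divide)
    also have "\<dots> = sq_sum m - 2 / s * X
        + (\<Sum>k\<in>(UNIV::'s set). (\<Sum>c\<in>UNIV. (x $ c)\<^sup>2) / s\<^sup>2)"
      unfolding X_def
      by (simp only: sum.distrib sum_subtractf sum_distrib_left sum_divide_distrib)
    also have "(\<Sum>k\<in>(UNIV::'s set). (\<Sum>c\<in>UNIV. (x $ c)\<^sup>2) / s\<^sup>2) = Y / s"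
      using s by (simp add: Y_def s_def[symmetric] power2_eq_square)
    finally show ?thesis .
  qed
  have 2: "(\<Sum>c\<in>UNIV. (\<Sum>k\<in>UNIV. (m - constant_rows x) $ k $ c)\<^sup>2)
    = (\<Sum>c\<in>UNIV. (\<Sum>k\<in>UNIV. m $ k $ c)\<^sup>2) - 2 * X + Y"
  proof -
    have "(\<Sum>k\<in>UNIV. (m - constant_rows x) $ k $ c) = (\<Sum>k\<in>UNIV. m $ k $ c) - x $ c" for c
      using s by (simp add: constant_rows_def sum_subtractf s_def[symmetric])
    then have "(\<Sum>c\<in>UNIV. (\<Sum>k\<in>UNIV. (m - constant_rows x) $ k $ c)\<^sup>2)
      = (\<Sum>c\<in>UNIV. ((\<Sum>k\<in>UNIV. m $ k $ c) - x $ c)\<^sup>2)"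
      by presburger
    also have "\<dots> = (\<Sum>c\<in>UNIV. (\<Sum>k\<in>UNIV. m $ k $ c)\<^sup>2 - 2 * (\<Sum>k\<in>UNIV. x $ c * m $ k $ c) + (x $ c)\<^sup>2)"
      by (intro sum.cong refl) (simp add: power2_diff sum_distrib_left[symmetric])
    also have "\<dots> = (\<Sum>c\<in>UNIV. (\<Sum>k\<in>UNIV. m $ k $ c)\<^sup>2)
      - 2 * (\<Sum>c\<in>UNIV. \<Sum>k\<in>UNIV. x $ c * m $ k $ c) + Y"
      unfolding Y_def by (simp only: sum.distrib sum_subtractf sum_distrib_left)
    also have "(\<Sum>c\<in>UNIV. \<Sum>k\<in>UNIV. x $ c * m $ k $ c) = X" unfolding X_def by (rule sum.swap)
    finally show ?thesis .
  qed
  have gs: "g = (\<beta> - \<alpha>) / s + \<alpha>" using s by (simp add: g s_def[symmetric] field_simps)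
  show ?thesis
    unfolding interaction_def 1 2 X_def[symmetric] Y_def[symmetric] gs
    by (simp add: algebra_simps add_divide_distrib diff_divide_distrib)
qed

section \<open>Block decompositions, the energy and sums over configurations\<close>

lemma block_partition_finite: "block_partition N B \<Longrightarrow> finite (B k)"
proof -
  assume "block_partition N B"
  then have "B k \<subseteq> {1..N}" unfolding block_partition_def by blast
  then show ?thesis by (rule finite_subset) simp
qed

lemma block_partition_sum:
  assumes "block_partition N (B :: 's::finite \<Rightarrow> nat set)"
  shows "(\<Sum>i\<in>{1..N}. f i) = (\<Sum>k\<in>UNIV. \<Sum>i\<in>B k. f i)"
proof -
  have "(\<Sum>i\<in>(\<Union>k. B k). f i) = (\<Sum>k\<in>UNIV. \<Sum>i\<in>B k. f i)"
    using assms block_partition_finite[OF assms]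
    by (intro sum.UNION_disjoint) (auto simp: block_partition_def disjoint_family_on_def)
  then show ?thesis using assms by (simp add: block_partition_def)
qed

lemma block_partition_prod:
  assumes "block_partition N (B :: 's::finite \<Rightarrow> nat set)"
  shows "(\<Prod>i\<in>{1..N}. f i) = (\<Prod>k\<in>UNIV. \<Prod>i\<in>B k. f i)"
proof -
  have "(\<Prod>i\<in>(\<Union>k. B k). f i) = (\<Prod>k\<in>UNIV. \<Prod>i\<in>B k. f i)"
    using assms block_partition_finite[OF assms]
    by (intro prod.UNION_disjoint) (auto simp: block_partition_def disjoint_family_on_def)
  then show ?thesis using assms by (simp add: block_partition_def)
qed

lemma sum_pairs_equal_colour:
  fixes \<omega> :: "nat \<Rightarrow> 'q::finite"
  assumes "finite X"
  shows "(\<Sum>(i, j)\<in>X \<times> X. of_bool (\<omega> i = \<omega> j) :: real) = (\<Sum>c\<in>UNIV. (\<Sum>i\<in>X. of_bool (\<omega> i = c))\<^sup>2)"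
proof -
  have "(\<Sum>c\<in>UNIV. (\<Sum>i\<in>X. of_bool (\<omega> i = c) :: real)\<^sup>2)
     = (\<Sum>c\<in>UNIV. \<Sum>i\<in>X. \<Sum>j\<in>X. of_bool (\<omega> i = c) * of_bool (\<omega> j = c))"
    by (simp add: power2_eq_square sum_product)
  also have "\<dots> = (\<Sum>i\<in>X. \<Sum>j\<in>X. \<Sum>c\<in>UNIV. of_bool (\<omega> i = c) * of_bool (\<omega> j = c))"
    by (subst sum.swap, rule sum.cong[OF refl], rule sum.swap)
  also have "\<dots> = (\<Sum>i\<in>X. \<Sum>j\<in>X. of_bool (\<omega> i = \<omega> j))"
  proof (intro sum.cong refl)
    fix i j
    have "(\<Sum>c\<in>UNIV. of_bool (\<omega> i = c) * of_bool (\<omega> j = c) :: real)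
      = (\<Sum>c\<in>UNIV. if c = \<omega> i then of_bool (\<omega> i = \<omega> j) else 0)"
      by (rule sum.cong) auto
    then show "(\<Sum>c\<in>UNIV. of_bool (\<omega> i = c) * of_bool (\<omega> j = c) :: real) = of_bool (\<omega> i = \<omega> j)"
      by simp
  qed
  finally show ?thesis by (simp add: sum.cartesian_product)
qed

lemma magnetization_scaled:
  assumes "N > 0"
  shows "real N * magnetization N B \<omega> $ k $ c = (\<Sum>i\<in>B k. of_bool (\<omega> i = c))"
  using assms by (simp add: magnetization_def)

text \<open>Same-block pairs, the diagonal included, form the disjoint union of the squares of the
  blocks; the remaining pairs are counted as a complement.\<close>

lemma hamiltonian_eq_interaction:
  fixes \<omega> :: "nat \<Rightarrow> 'q::finite" and B :: "'s::finite \<Rightarrow> nat set"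
  assumes B: "block_partition N B" and N: "N > 0"
  shows "- hamiltonian \<alpha> \<beta> N B \<omega> = real N * interaction \<alpha> \<beta> (magnetization N B \<omega>)"
proof -
  define f :: "nat \<times> nat \<Rightarrow> real" where "f = (\<lambda>(i, j). of_bool (\<omega> i = \<omega> j))"
  define m where "m = magnetization N B \<omega>"
  have m: "(\<Sum>i\<in>B k. of_bool (\<omega> i = c)) = real N * m $ k $ c" for k c
    using magnetization_scaled[OF N, of B \<omega> k c] by (simp add: m_def)
  define P where "P = {(i, j) \<in> {1..N} \<times> {1..N}. same_block B i j}"
  have P_eq: "P = (\<Union>k. B k \<times> B k)"
    using B unfolding P_def block_partition_def same_block_def by blast
  have fin: "finite (B k)" for k by (rule block_partition_finite[OF B])
  have "sum f P = (\<Sum>k\<in>UNIV. sum f (B k \<times> B k))"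
    unfolding P_eq using B fin
    by (intro sum.UNION_disjoint) (auto simp: block_partition_def disjoint_family_on_def)
  also have "\<dots> = (\<Sum>k\<in>UNIV. \<Sum>c\<in>UNIV. (real N * m $ k $ c)\<^sup>2)"
    unfolding f_def sum_pairs_equal_colour[OF fin] m ..
  finally have same: "sum f P = (real N)\<^sup>2 * sq_sum m"
    by (simp add: power_mult_distrib sum_distrib_left)
  have "sum f ({1..N} \<times> {1..N}) = (\<Sum>c\<in>UNIV. (\<Sum>i\<in>{1..N}. of_bool (\<omega> i = c))\<^sup>2)"
    unfolding f_def by (rule sum_pairs_equal_colour) simp
  also have "\<dots> = (\<Sum>c\<in>UNIV. (\<Sum>k\<in>UNIV. real N * m $ k $ c)\<^sup>2)"
    unfolding block_partition_sum[OF B] m ..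
  finally have all: "sum f ({1..N} \<times> {1..N}) = (real N)\<^sup>2 * (\<Sum>c\<in>UNIV. (\<Sum>k\<in>UNIV. m $ k $ c)\<^sup>2)"
    by (simp add: power_mult_distrib sum_distrib_left[symmetric])
  have "{(i, j) \<in> {1..N} \<times> {1..N}. \<not> same_block B i j} = {1..N} \<times> {1..N} - P"
    unfolding P_def by blast
  moreover have "sum f ({1..N} \<times> {1..N} - P) = sum f ({1..N} \<times> {1..N}) - sum f P"
    by (rule sum_diff) (auto simp: P_def)
  ultimately have "hamiltonian \<alpha> \<beta> N B \<omega>
    = - (\<beta> / (2 * real N)) * sum f P - (\<alpha> / (2 * real N)) * (sum f ({1..N} \<times> {1..N}) - sum f P)"
    unfolding hamiltonian_def P_def[symmetric] f_def by simp
  then show ?thesis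
    unfolding same all interaction_def m_def[symmetric]
    using N by (simp add: power2_eq_square algebra_simps diff_divide_distrib add_divide_distrib)
qed

lemma finite_configs: "finite (configs N :: (nat \<Rightarrow> 'q::finite) set)"
  unfolding configs_def by (intro finite_PiE) auto

lemma configs_nonempty: "configs N \<noteq> {}"
  unfolding configs_def by (simp add: PiE_eq_empty_iff)

lemma sum_configs_block_prod:
  fixes w :: "'s::finite \<Rightarrow> 'q::finite \<Rightarrow> real"
  assumes B: "block_partition N B"
  shows "(\<Sum>\<omega>\<in>configs N. \<Prod>k\<in>UNIV. \<Prod>i\<in>B k. w k (\<omega> i)) = (\<Prod>k\<in>UNIV. (\<Sum>c\<in>UNIV. w k c) ^ card (B k))"
proof -
  \<comment> \<open>The block label of a site; by disjointness the choice is unique on {1..N}, which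
    turns the product over blocks into one over sites.\<close>
  define b where "b i = (SOME k. i \<in> B k)" for i
  have b: "b i = k" if "i \<in> B k" for i k
  proof -
    have "i \<in> B (b i)" unfolding b_def by (rule someI) (rule that)
    then show ?thesis using B that unfolding block_partition_def disjoint_family_on_def by blast
  qed
  have "(\<Sum>\<omega>\<in>configs N. \<Prod>k\<in>UNIV. \<Prod>i\<in>B k. w k (\<omega> i)) = (\<Sum>\<omega>\<in>configs N. \<Prod>i\<in>{1..N}. w (b i) (\<omega> i))"
    unfolding block_partition_prod[OF B] by (intro sum.cong prod.cong refl) (simp add: b)
  also have "\<dots> = (\<Prod>i\<in>{1..N}. \<Sum>c\<in>UNIV. w (b i) c)"
    unfolding configs_def by (rule prod_sum_PiE[symmetric]) auto
  also have "\<dots> = (\<Prod>k\<in>UNIV. \<Prod>i\<in>B k. \<Sum>c\<in>UNIV. w k c)"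
    unfolding block_partition_prod[OF B] by (intro prod.cong refl) (simp add: b)
  finally show ?thesis by simp
qed

text \<open>N times a linear functional of the magnetization is a sum over sites, so its exponential
  factorises. All tilting rests on this.\<close>

lemma exp_magnetization_pairing:
  fixes h :: "'s::finite \<Rightarrow> 'q::finite \<Rightarrow> real"
  assumes B: "block_partition N B" and N: "N > 0"
  shows "exp (real N * pairing h (magnetization N B \<omega>))
    = (\<Prod>k\<in>UNIV. \<Prod>i\<in>B k. exp (h k (\<omega> i)))"
proof -
  have "real N * (\<Sum>c\<in>UNIV. h k c * magnetization N B \<omega> $ k $ c) = (\<Sum>i\<in>B k. h k (\<omega> i))" for k
  proof -
    have "real N * (\<Sum>c\<in>UNIV. h k c * magnetization N B \<omega> $ k $ c)
      = (\<Sum>c\<in>UNIV. \<Sum>i\<in>B k. h k c * of_bool (\<omega> i = c))"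
    proof -
      have "real N * (\<Sum>c\<in>UNIV. h k c * magnetization N B \<omega> $ k $ c)
        = (\<Sum>c\<in>UNIV. h k c * (real N * magnetization N B \<omega> $ k $ c))"
        by (simp add: sum_distrib_left mult.left_commute)
      then show ?thesis unfolding magnetization_scaled[OF N] by (simp only: sum_distrib_left)
    qed
    also have "\<dots> = (\<Sum>i\<in>B k. \<Sum>c\<in>UNIV. h k c * of_bool (\<omega> i = c))" by (rule sum.swap)
    also have "\<dots> = (\<Sum>i\<in>B k. h k (\<omega> i))"
    proof (rule sum.cong[OF refl])
      fix i
      have "(\<Sum>c\<in>UNIV. h k c * of_bool (\<omega> i = c)) = (\<Sum>c\<in>UNIV. if c = \<omega> i then h k c else 0)"
        by (rule sum.cong) auto
      then show "(\<Sum>c\<in>UNIV. h k c * of_bool (\<omega> i = c)) = h k (\<omega> i)" by simp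
    qed
    finally show ?thesis .
  qed
  then show ?thesis
    using block_partition_finite[OF B] by (simp add: sum_distrib_left exp_sum)
qed

lemma partition_function_pos: "partition_function TYPE('q::finite) \<alpha> \<beta> N B > 0"
  unfolding partition_function_def by (rule sum_pos) (auto simp: finite_configs configs_nonempty)

lemma
  shows space_gibbs: "space (gibbs \<alpha> \<beta> N B :: (nat \<Rightarrow> 'q::finite) measure) = configs N"
    and measurable_magnetization:
      "magnetization N B \<in> (gibbs \<alpha> \<beta> N B :: (nat \<Rightarrow> 'q) measure) \<rightarrow>\<^sub>M (borel :: (real ^ 'q ^ 's::finite) measure)"
  by (auto simp: gibbs_def space_point_measure sets_point_measure intro!: measurableI)

lemma integral_magnetization_law:
  fixes f :: "real ^ 'q::finite ^ 's::finite \<Rightarrow> real"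
  assumes f: "f \<in> borel_measurable borel"
  shows "(\<integral>x. f x \<partial>magnetization_law \<alpha> \<beta> N B)
    = (\<Sum>\<omega>\<in>configs N. f (magnetization N B \<omega>) * exp (- hamiltonian \<alpha> \<beta> N B \<omega>))
       / partition_function TYPE('q) \<alpha> \<beta> N B"
proof -
  let ?Z = "partition_function TYPE('q) \<alpha> \<beta> N B"
  have Z: "?Z > 0" by (rule partition_function_pos)
  have "(\<integral>x. f x \<partial>magnetization_law \<alpha> \<beta> N B) = (\<integral>\<omega>. f (magnetization N B \<omega>) \<partial>gibbs \<alpha> \<beta> N B)"
    unfolding magnetization_law_def by (rule integral_distr[OF measurable_magnetization f])
  also have "\<dots> = (\<Sum>\<omega>\<in>configs N. (exp (- hamiltonian \<alpha> \<beta> N B \<omega>) / ?Z) *\<^sub>R f (magnetization N B \<omega>))"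
    unfolding gibbs_def using Z
    by (intro lebesgue_integral_point_measure_finite finite_configs) simp
  also have "\<dots> = (\<Sum>\<omega>\<in>configs N. f (magnetization N B \<omega>) * exp (- hamiltonian \<alpha> \<beta> N B \<omega>) / ?Z)"
    by (rule sum.cong) auto
  finally show ?thesis by (simp add: sum_divide_distrib)
qed

lemma sets_magnetization_law: "sets (magnetization_law \<alpha> \<beta> N B) = sets borel"
  by (simp add: magnetization_law_def)

section \<open>Tilting and exponential concentration\<close>

text \<open>The third-order Taylor remainder is at most |t|^3 / 2 because e \<le> 3. The coefficient
  tends to 1/2 as t vanishes; the critical case, where only g < q is available, depends on
  that.\<close>

lemma exp_le_quadratic:
  fixes t :: real
  assumes "\<bar>t\<bar> \<le> 1"
  shows "exp t \<le> 1 + t + (1 + \<bar>t\<bar>) / 2 * t\<^sup>2"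
proof -
  obtain s where s: "\<bar>s\<bar> \<le> \<bar>t\<bar>" "exp t = (\<Sum>m<3. t ^ m / fact m) + exp s / fact 3 * t ^ 3"
    using Maclaurin_exp_le[of t 3] by blast
  have f3: "fact 3 = (6 :: real)" by (simp add: fact_numeral)
  have "exp s \<le> exp (1::real)" using s(1) assms by simp
  then have "exp s \<le> 3" using exp_le by linarith
  then have "exp s * \<bar>t\<bar> ^ 3 \<le> 3 * \<bar>t\<bar> ^ 3" by (intro mult_right_mono) auto
  moreover have "exp s * t ^ 3 \<le> exp s * \<bar>t\<bar> ^ 3"
    by (intro mult_left_mono) (auto simp: power_abs[symmetric])
  ultimately have "exp s / fact 3 * t ^ 3 \<le> \<bar>t\<bar> ^ 3 / 2"
    unfolding f3 by linarith
  moreover have "\<bar>t\<bar> ^ 3 = \<bar>t\<bar> * t\<^sup>2" by (simp add: power3_eq_cube power2_eq_square)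
  moreover have "(\<Sum>m<3. t ^ m / fact m) = 1 + t + t\<^sup>2 / 2"
    by (simp add: numeral_3_eq_3 power2_eq_square)
  ultimately show ?thesis using s(2) by (simp add: add_divide_distrib distrib_right)
qed

text \<open>Unnormalised mass of a magnetization event with an arbitrary weight, so that Gibbs and
  product weights share their union bounds.\<close>

definition config_mass ::
  "nat \<Rightarrow> ('s::finite \<Rightarrow> nat set) \<Rightarrow> ((nat \<Rightarrow> 'q) \<Rightarrow> real) \<Rightarrow> (real ^ 'q::finite ^ 's) set \<Rightarrow> real" where
  "config_mass N B w A = (\<Sum>\<omega> | \<omega> \<in> configs N \<and> magnetization N B \<omega> \<in> A. w \<omega>)"

abbreviation gibbs_mass ::
  "real \<Rightarrow> real \<Rightarrow> nat \<Rightarrow> ('s::finite \<Rightarrow> nat set) \<Rightarrow> (real ^ 'q::finite ^ 's) set \<Rightarrow> real" where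
  "gibbs_mass \<alpha> \<beta> N B \<equiv> config_mass N B (\<lambda>\<omega>. exp (- hamiltonian \<alpha> \<beta> N B \<omega>))"

definition product_weight :: "('s::finite \<Rightarrow> nat set) \<Rightarrow> real ^ 'q::finite \<Rightarrow> (nat \<Rightarrow> 'q) \<Rightarrow> real" where
  "product_weight B x \<omega> = (\<Prod>k\<in>UNIV. \<Prod>i\<in>B k. x $ \<omega> i)"

abbreviation product_mass ::
  "nat \<Rightarrow> ('s::finite \<Rightarrow> nat set) \<Rightarrow> real ^ 'q::finite \<Rightarrow> (real ^ 'q ^ 's) set \<Rightarrow> real" where
  "product_mass N B x \<equiv> config_mass N B (product_weight B x)"

lemma finite_configs_filter: "finite {\<omega> \<in> configs N. P (\<omega> :: nat \<Rightarrow> 'q::finite)}"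
  by (rule finite_subset[OF _ finite_configs]) auto

lemma config_mass_nonneg: "(\<And>\<omega>. 0 \<le> w \<omega>) \<Longrightarrow> 0 \<le> config_mass N B w A"
  unfolding config_mass_def by (intro sum_nonneg)

lemma config_mass_mono:
  assumes "\<And>\<omega>. 0 \<le> w \<omega>" "A \<subseteq> A'"
  shows "config_mass N B w A \<le> config_mass N B w A'"
  unfolding config_mass_def using assms by (intro sum_mono2 finite_configs_filter) auto

lemma config_mass_Un_le:
  fixes w :: "(nat \<Rightarrow> 'q::finite) \<Rightarrow> real" and A A' :: "(real ^ 'q ^ 's::finite) set"
  assumes w: "\<And>\<omega>. 0 \<le> w \<omega>"
  shows "config_mass N B w (A \<union> A') \<le> config_mass N B w A + config_mass N B w A'"
proof -
  define E where "E X = {\<omega> \<in> configs N. magnetization N B \<omega> \<in> X}" for X :: "(real ^ 'q ^ 's) set"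
  have fin: "finite (E X)" for X unfolding E_def by (rule finite_configs_filter)
  have "sum w (E A \<union> E A') \<le> sum w (E A) + sum w (E A')"
    using sum.union_inter[OF fin fin, of w A A'] sum_nonneg[of "E A \<inter> E A'" w, OF w] by linarith
  moreover have "E (A \<union> A') = E A \<union> E A'" unfolding E_def by blast
  ultimately show ?thesis unfolding config_mass_def E_def by simp
qed

lemma config_mass_UN_le:
  fixes w :: "(nat \<Rightarrow> 'q::finite) \<Rightarrow> real" and A :: "'i \<Rightarrow> (real ^ 'q ^ 's::finite) set"
  assumes w: "\<And>\<omega>. 0 \<le> w \<omega>" and I: "finite I"
  shows "config_mass N B w (\<Union>i\<in>I. A i) \<le> (\<Sum>i\<in>I. config_mass N B w (A i))"
  using I
proof (induction I rule: finite_induct)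
  case (insert i I)
  have "config_mass N B w (A i \<union> (\<Union>i\<in>I. A i)) \<le> config_mass N B w (A i) + config_mass N B w (\<Union>i\<in>I. A i)"
    by (rule config_mass_Un_le[OF w])
  then show ?case using insert by simp
qed (simp add: config_mass_def)

lemma gibbs_mass_UNIV:
  "gibbs_mass \<alpha> \<beta> N B (UNIV :: (real ^ 'q::finite ^ 's::finite) set) = partition_function TYPE('q) \<alpha> \<beta> N B"
  by (simp add: config_mass_def partition_function_def)

lemma measure_magnetization_law:
  fixes A :: "(real ^ 'q::finite ^ 's::finite) set"
  assumes A: "A \<in> sets borel"
  shows "measure (magnetization_law \<alpha> \<beta> N B) A
    = gibbs_mass \<alpha> \<beta> N B A / gibbs_mass \<alpha> \<beta> N B (UNIV :: (real ^ 'q ^ 's) set)"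
proof -
  have sp: "space (magnetization_law \<alpha> \<beta> N B) = (UNIV :: (real ^ 'q ^ 's) set)"
    by (simp add: magnetization_law_def)
  have "measure (magnetization_law \<alpha> \<beta> N B) A = (\<integral>x. indicator A x \<partial>magnetization_law \<alpha> \<beta> N B)"
    using A by (simp add: sp sets_magnetization_law)
  also have "\<dots> = (\<Sum>\<omega>\<in>configs N. indicator A (magnetization N B \<omega>) * exp (- hamiltonian \<alpha> \<beta> N B \<omega>))
       / partition_function TYPE('q) \<alpha> \<beta> N B"
    using A by (intro integral_magnetization_law borel_measurable_indicator)
  also have "(\<Sum>\<omega>\<in>configs N. indicator A (magnetization N B \<omega>) * exp (- hamiltonian \<alpha> \<beta> N B \<omega>))
     = gibbs_mass \<alpha> \<beta> N B A"
    unfolding config_mass_def by (subst sum.inter_filter[OF finite_configs]) (auto intro!: sum.cong simp: indicator_def)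
  finally show ?thesis unfolding gibbs_mass_UNIV .
qed

lemma sum_configs_mgf:
  fixes h :: "'s::finite \<Rightarrow> 'q::finite \<Rightarrow> real"
  assumes B: "block_partition N B" and N: "N > 0"
  shows "(\<Sum>\<omega>\<in>configs N. product_weight B x \<omega> *
      exp (real N * pairing h (magnetization N B \<omega>)))
    = (\<Prod>k\<in>UNIV. (\<Sum>c\<in>UNIV. x $ c * exp (h k c)) ^ card (B k))"
  unfolding product_weight_def exp_magnetization_pairing[OF B N] prod.distrib[symmetric]
  by (rule sum_configs_block_prod[OF B, of "\<lambda>k c. x $ c * exp (h k c)"])

lemma product_mass_UNIV:
  assumes B: "block_partition N B" and x: "(\<Sum>c\<in>UNIV. x $ c) = 1"
  shows "product_mass N B x UNIV = 1"
  using sum_configs_block_prod[OF B, of "\<lambda>k c. x $ c"] x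
  by (simp add: config_mass_def product_weight_def)

lemma product_weight_nonneg: "(\<And>c. 0 \<le> x $ c) \<Longrightarrow> 0 \<le> product_weight B x \<omega>"
  unfolding product_weight_def by (intro prod_nonneg) auto

text \<open>Linearising the (positive definite) interaction at \<open>constant_rows x\<close> turns the Gibbs weight
  into a product weight with colour distribution \<open>x\<close>, up to a factor that is at least 1.\<close>

lemma gibbs_weight_eq:
  fixes x :: "real ^ 'q::finite" and B :: "'s::finite \<Rightarrow> nat set"
  assumes B: "block_partition N B" and N: "N > 0"
    and g: "g = (\<beta> + (real CARD('s) - 1) * \<alpha>) / real CARD('s)" and g0: "g > 0"
    and x: "x \<in> potts_minimizers g"
  shows "exp (- hamiltonian \<alpha> \<beta> N B \<omega>) = exp (- real N * free_energy g x) *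
    product_weight B x \<omega> * exp (real N * interaction \<alpha> \<beta> (magnetization N B \<omega> - constant_rows x))"
proof -
  let ?I = "interaction \<alpha> \<beta> (magnetization N B \<omega> - constant_rows x)"
    and ?Q = "g / 2 * (\<Sum>c\<in>UNIV. (x $ c)\<^sup>2)"
  define Z where "Z = (\<Sum>c\<in>UNIV. exp (g * x $ c))"
  have Z: "Z > 0" unfolding Z_def by (rule sum_exp_pos)
  have e: "exp (g * x $ c) = Z * x $ c" for c
    using potts_minimizer_critical[OF g0 x, of c] Z unfolding Z_def[symmetric]
    by (metis less_irrefl nonzero_eq_divide_eq mult.commute)
  define T where "T = (\<Sum>k\<in>UNIV. \<Sum>c\<in>UNIV. x $ c * magnetization N B \<omega> $ k $ c)"
  have "exp (real N * (g * T)) = exp (real N * pairing (\<lambda>k c. g * x $ c) (magnetization N B \<omega>))"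
    by (simp add: T_def sum_distrib_left mult.assoc)
  also have "\<dots> = (\<Prod>k\<in>UNIV. \<Prod>i\<in>B k. Z * x $ \<omega> i)"
    unfolding exp_magnetization_pairing[OF B N, of "\<lambda>k c. g * x $ c"] e ..
  also have "\<dots> = (\<Prod>i\<in>{1..N}. Z) * product_weight B x \<omega>"
    unfolding product_weight_def block_partition_prod[OF B] by (simp add: prod.distrib)
  also have "(\<Prod>i\<in>{1..N}. Z) = exp (real N * ln Z)"
    using Z by (simp add: exp_of_nat_mult)
  finally have T: "exp (real N * (g * T)) = exp (real N * ln Z) * product_weight B x \<omega>" .
  have "real N * interaction \<alpha> \<beta> (magnetization N B \<omega>) = real N * (g * T) +
    - (real N * ?Q) +
    real N * ?I"
    using arg_cong[OF interaction_shift[OF g, of "magnetization N B \<omega>" x], of "\<lambda>z. real N * z"]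
    unfolding T_def[symmetric] by (simp add: algebra_simps)
  then have "exp (- hamiltonian \<alpha> \<beta> N B \<omega>) = exp (real N * (g * T)) *
    exp (- (real N * ?Q)) *
    exp (real N * ?I)"
    unfolding hamiltonian_eq_interaction[OF B N] by (simp only: exp_add)
  moreover have "exp (- real N * free_energy g x) =
      exp (real N * ln Z) * exp (- (real N * ?Q))"
    unfolding exp_add[symmetric] free_energy_def Z_def[symmetric] by (simp add: algebra_simps)
  ultimately show ?thesis unfolding T by (simp add: mult_ac)
qed

section \<open>The exponent of the upper bound, and its minimizers\<close>

definition block_free_energy :: "real \<Rightarrow> real \<Rightarrow> real ^ 'q::finite ^ 's::finite \<Rightarrow> real" where
  "block_free_energy \<alpha> g m = (\<Sum>k\<in>UNIV. free_energy g (real CARD('s) *\<^sub>R m $ k)) / real CARD('s)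
     + \<alpha> / 2 * row_spread m"

lemma continuous_on_block_free_energy:
  "continuous_on A (block_free_energy \<alpha> g :: real ^ 'q::finite ^ 's::finite \<Rightarrow> real)"
  unfolding block_free_energy_def[abs_def] row_spread_def
  by (intro continuous_intros continuous_on_compose2[OF continuous_on_free_energy[of UNIV]]) auto

lemma block_free_energy_ge:
  fixes m :: "real ^ 'q::finite ^ 's::finite"
  assumes "0 \<le> \<alpha>" and x: "(x :: real ^ 'q) \<in> potts_minimizers g"
  shows "free_energy g x \<le> block_free_energy \<alpha> g m"
proof -
  have "(\<Sum>k\<in>(UNIV::'s set). free_energy g x) \<le> (\<Sum>k\<in>UNIV. free_energy g (real CARD('s) *\<^sub>R m $ k))"
    using x by (intro sum_mono) (simp add: potts_minimizers_def)
  then have "free_energy g x \<le> (\<Sum>k\<in>UNIV. free_energy g (real CARD('s) *\<^sub>R m $ k)) / real CARD('s)"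
    by (simp add: field_simps)
  then show ?thesis unfolding block_free_energy_def using assms(1) row_spread_nonneg[of m]
    by (smt (verit) divide_nonneg_nonneg mult_nonneg_nonneg)
qed

text \<open>Equality forces both the spread term and the excess of the averaged free energies to
  vanish. As \<alpha> > 0 the rows agree, and s times the common row is a minimizer.\<close>

lemma block_free_energy_eqD:
  fixes m :: "real ^ 'q::finite ^ 's::finite"
  assumes \<alpha>: "0 < \<alpha>" and x: "(x :: real ^ 'q) \<in> potts_minimizers g"
    and eq: "block_free_energy \<alpha> g m = free_energy g x"
  shows "m \<in> constant_rows ` potts_minimizers g"
proof -
  define F where "F k = free_energy g (real CARD('s) *\<^sub>R m $ k)" for k
  have ge: "free_energy g x \<le> F k" for k
    using x by (simp add: potts_minimizers_def F_def)
  have s: "real CARD('s) > 0" by simp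
  have "(\<Sum>k\<in>(UNIV::'s set). free_energy g x) \<le> sum F UNIV"
    by (intro sum_mono ge)
  then have 1: "free_energy g x \<le> sum F UNIV / real CARD('s)"
    using s by (simp add: pos_le_divide_eq mult.commute)
  have 2: "0 \<le> \<alpha> / 2 * row_spread m" using \<alpha> row_spread_nonneg[of m] by simp
  have eq': "sum F UNIV / real CARD('s) + \<alpha> / 2 * row_spread m = free_energy g x"
    using eq by (simp add: block_free_energy_def F_def[abs_def])
  have "\<alpha> / 2 * row_spread m = 0" using 1 2 eq' by linarith
  then have rows: "m $ k = m $ l" for k l using \<alpha> row_spread_eq_0D[of m] by simp
  have "sum F UNIV / real CARD('s) = free_energy g x" using 1 2 eq' by linarith
  moreover have "F k = F undefined" for k unfolding F_def rows[of k undefined] ..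
  then have "sum F UNIV = (\<Sum>k\<in>(UNIV::'s set). F undefined)" by (intro sum.cong refl)
  ultimately have "F undefined = free_energy g x" by simp
  then have "real CARD('s) *\<^sub>R m $ undefined \<in> potts_minimizers g"
    using x by (simp add: potts_minimizers_def F_def)
  moreover have "m = constant_rows (real CARD('s) *\<^sub>R m $ undefined)"
    using rows[of _ undefined] by (simp add: constant_rows_def vec_eq_iff)
  ultimately show ?thesis by blast
qed

text \<open>On the event that the magnetization equals \<open>m\<close>, the weight can be rewritten
  with the field \<open>g * s * m $ k $ c\<close>; dropping the event leaves a sum that factorises.
  Replacing block sizes by N/s costs at most N \<delta> times the bound g s + ln q on each
  \<open>lse k\<close>.\<close>

lemma gibbs_mass_singleton_le:
  fixes m :: "real ^ 'q::finite ^ 's::finite"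
  assumes B: "block_partition N B" and N: "N > 0" and \<alpha>\<beta>: "0 < \<alpha>" "\<alpha> < \<beta>"
    and g: "g = (\<beta> + (real CARD('s) - 1) * \<alpha>) / real CARD('s)" and g0: "g > 0"
    and m: "\<And>k c. 0 \<le> m $ k $ c" "\<And>k c. m $ k $ c \<le> 1"
    and \<delta>: "(\<Sum>k\<in>UNIV. \<bar>real (card (B k)) / real N - 1 / real CARD('s)\<bar>) \<le> \<delta>"
  shows "gibbs_mass \<alpha> \<beta> N B {m} \<le>
    exp (- real N * (block_free_energy \<alpha> g m - \<delta> * (g * real CARD('s) + ln (real CARD('q)))))"
proof -
  define s where "s = real CARD('s)"
  have s: "s > 0" by (simp add: s_def)
  define A where "A = sq_sum m"
  define lse where "lse k = ln (\<Sum>c\<in>UNIV. exp (g * s * m $ k $ c))" for k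
  let ?C = "g * s + ln (real CARD('q))" and ?Z = "\<lambda>k. \<Sum>c\<in>UNIV. exp (g * s * m $ k $ c)"
    and ?d = "\<lambda>k. real (card (B k)) / real N - 1 / s"
    and ?e = "\<lambda>\<omega>. exp (real N * (interaction \<alpha> \<beta> m - g * s * A)) *
      exp (real N * pairing (\<lambda>k c. g * s * m $ k $ c) (magnetization N B \<omega>))"
  have elt: "exp (- hamiltonian \<alpha> \<beta> N B \<omega>) = ?e \<omega>"
    if "magnetization N B \<omega> = m" for \<omega>
  proof -
    have "pairing (\<lambda>k c. g * s * m $ k $ c) m = g * s * A"
      by (simp add: A_def sum_distrib_left power2_eq_square mult.assoc)
    then show ?thesis unfolding hamiltonian_eq_interaction[OF B N] that exp_add[symmetric]
      by (simp add: algebra_simps)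
  qed
  have "gibbs_mass \<alpha> \<beta> N B {m} = (\<Sum>\<omega> | \<omega> \<in> configs N \<and> magnetization N B \<omega> \<in> {m}. ?e \<omega>)"
    unfolding config_mass_def by (rule sum.cong[OF refl], rule elt) simp
  also have "\<dots> \<le> (\<Sum>\<omega>\<in>configs N. ?e \<omega>)"
    by (rule sum_mono2[OF finite_configs]) auto
  also have "\<dots> = exp (real N * (interaction \<alpha> \<beta> m - g * s * A)) *
     (\<Prod>k\<in>UNIV. ?Z k ^ card (B k))"
    unfolding sum_distrib_left[symmetric] exp_magnetization_pairing[OF B N, of "\<lambda>k c. g * s * m $ k $ c"]
      sum_configs_block_prod[OF B, of "\<lambda>k c. exp (g * s * m $ k $ c)"] ..
  also have "(\<Prod>k\<in>UNIV. ?Z k ^ card (B k))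
    = exp (\<Sum>k\<in>UNIV. real (card (B k)) * lse k)"
  proof -
    have "exp (real (card (B k)) * lse k) = ?Z k ^ card (B k)" for k
      unfolding lse_def using sum_exp_pos[of "\<lambda>c. g * s * m $ k $ c"] by (simp add: exp_of_nat_mult)
    then show ?thesis by (simp add: exp_sum)
  qed
  also have "exp (real N * (interaction \<alpha> \<beta> m - g * s * A)) * exp (\<Sum>k\<in>UNIV. real (card (B k)) * lse k)
    \<le> exp (- real N * (block_free_energy \<alpha> g m - \<delta> * ?C))"
  proof -
    have lse01: "lse k \<ge> 0 \<and> lse k \<le> ?C" for k
    proof -
      have "(\<Sum>c\<in>(UNIV::'q set). 1) \<le> ?Z k"
        using g0 s m by (intro sum_mono) simp
      then have 1: "real CARD('q) \<le> ?Z k" by simp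
      have "?Z k \<le> (\<Sum>c\<in>(UNIV::'q set). exp (g * s))"
        using g0 s m by (intro sum_mono) (simp add: mult_left_le)
      then have 2: "?Z k \<le> real CARD('q) * exp (g * s)" by simp
      have "lse k \<le> ln (real CARD('q) * exp (g * s))"
        unfolding lse_def using 1 2 sum_exp_pos[of "\<lambda>c. g * s * m $ k $ c"] by simp
      also have "\<dots> = ?C" by (simp add: ln_mult_pos)
      finally have "lse k \<le> ?C" .
      moreover have "1 \<le> ?Z k"
        using 1 real_CARD_ge_1[where 'q='q] by linarith
      then have "0 \<le> lse k" unfolding lse_def by (rule ln_ge_zero)
      ultimately show ?thesis by blast
    qed
    have lse: "\<bar>lse k\<bar> \<le> ?C" for k using lse01[of k] by linarith
    have "(\<Sum>k\<in>UNIV. ?d k * lse k)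
      \<le> (\<Sum>k\<in>UNIV. \<bar>?d k\<bar> * ?C)"
    proof (rule sum_mono)
      fix k
      have "?d k * lse k
        \<le> \<bar>?d k\<bar> * \<bar>lse k\<bar>"
        unfolding abs_mult[symmetric] by (rule abs_ge_self)
      also have "\<dots> \<le> \<bar>?d k\<bar> * ?C"
        by (rule mult_left_mono[OF lse]) simp
      finally show "?d k * lse k
        \<le> \<bar>?d k\<bar> * ?C" .
    qed
    also have "\<dots> \<le> \<delta> * ?C"
      unfolding sum_distrib_right[symmetric] using \<delta> g0 s real_CARD_ge_1[where 'q='q]
      by (intro mult_right_mono) (auto simp: s_def intro!: add_nonneg_nonneg)
    finally have d: "(\<Sum>k\<in>UNIV. ?d k * lse k) \<le> \<delta> * ?C" .
    have fe: "free_energy g (s *\<^sub>R m $ k) = g * s\<^sup>2 / 2 * (\<Sum>c\<in>UNIV. (m $ k $ c)\<^sup>2) - lse k" for k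
      by (simp add: free_energy_def lse_def power_mult_distrib sum_distrib_left[symmetric] mult.assoc)
    have "(\<Sum>k\<in>UNIV. free_energy g (s *\<^sub>R m $ k)) / s = g * s / 2 * A - (\<Sum>k\<in>UNIV. lse k) / s"
      unfolding fe sum_subtractf A_def sum_distrib_left[symmetric] using s
      by (simp add: diff_divide_distrib power2_eq_square)
    then have bfe: "block_free_energy \<alpha> g m = g * s / 2 * A - (\<Sum>k\<in>UNIV. lse k) / s + \<alpha> / 2 * row_spread m"
      by (simp add: block_free_energy_def s_def)
    have "(\<Sum>k\<in>UNIV. real (card (B k)) * lse k) = real N * (\<Sum>k\<in>UNIV. real (card (B k)) / real N * lse k)"
      using N by (simp add: sum_distrib_left)
    also have "(\<Sum>k\<in>UNIV. real (card (B k)) / real N * lse k)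
      = (\<Sum>k\<in>UNIV. ?d k * lse k) + (\<Sum>k\<in>UNIV. lse k) / s"
      by (simp add: left_diff_distrib sum_subtractf sum_divide_distrib)
    finally have "(\<Sum>k\<in>UNIV. real (card (B k)) * lse k)
      \<le> real N * (\<delta> * ?C + (\<Sum>k\<in>UNIV. lse k) / s)"
      using d by (simp add: mult_left_mono)
    moreover have intm: "interaction \<alpha> \<beta> m = g * s / 2 * A - \<alpha> / 2 * row_spread m"
      using interaction_eq[OF g, of m] by (simp add: A_def s_def)
    ultimately have "real N * (interaction \<alpha> \<beta> m - g * s * A) + (\<Sum>k\<in>UNIV. real (card (B k)) * lse k)
      \<le> - real N * (block_free_energy \<alpha> g m - \<delta> * ?C)"
      unfolding bfe intm by (simp add: algebra_simps)
    then show ?thesis by (simp only: exp_add[symmetric] exp_le_cancel_iff)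
  qed
  finally show ?thesis by (simp add: s_def)
qed

lemma magnetization_bounds:
  fixes B :: "'s::finite \<Rightarrow> nat set"
  assumes B: "block_partition N B" and N: "N > 0"
  shows "\<exists>n\<le>N. magnetization N B \<omega> $ k $ c = real n / real N"
proof -
  have sub: "B k \<subseteq> {1..N}" using B unfolding block_partition_def by blast
  define X where "X = {i \<in> B k. \<omega> i = c}"
  have "X \<subseteq> {1..N}" using sub by (auto simp: X_def)
  then have "card X \<le> card {1..N}" by (intro card_mono) auto
  moreover have "(\<Sum>i\<in>B k. of_bool (\<omega> i = c) :: real) = (\<Sum>i\<in>X. 1)"
    unfolding X_def by (subst sum.inter_filter[OF block_partition_finite[OF B]]) (auto intro!: sum.cong)
  ultimately show ?thesis by (intro exI[of _ "card X"]) (simp add: magnetization_def)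
qed

text \<open>Each of the s q entries is a multiple of 1/N in [0, 1]; the polynomial count is
  negligible on the exponential scale.\<close>

lemma card_magnetization_image:
  fixes B :: "'s::finite \<Rightarrow> nat set"
  assumes B: "block_partition N B" and N: "N > 0"
  shows "card ((magnetization N B :: (nat \<Rightarrow> 'q::finite) \<Rightarrow> _) ` configs N) \<le> (N + 1) ^ (CARD('s) * CARD('q))"
proof -
  define T where "T = (UNIV :: ('s \<times> 'q) set) \<rightarrow>\<^sub>E {0..N}"
  define \<Phi> :: "('s \<times> 'q \<Rightarrow> nat) \<Rightarrow> real ^ 'q ^ 's" where
    "\<Phi> f = (\<chi> k c. real (f (k, c)) / real N)" for f
  have finT: "finite T" unfolding T_def by (intro finite_PiE) auto
  have "magnetization N B ` configs N \<subseteq> \<Phi> ` T"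
  proof
    fix m :: "real ^ 'q ^ 's" assume "m \<in> magnetization N B ` configs N"
    then obtain \<omega> where \<omega>: "m = magnetization N B \<omega>" by blast
    have "\<forall>p. \<exists>n\<le>N. m $ fst p $ snd p = real n / real N"
      unfolding \<omega> using magnetization_bounds[OF B N] by blast
    then obtain f where f: "\<And>p. f p \<le> N" "\<And>p. m $ fst p $ snd p = real (f p) / real N" by metis
    have "m = \<Phi> f" unfolding \<Phi>_def vec_eq_iff by (simp add: f(2)[symmetric])
    moreover have "f \<in> T" unfolding T_def using f(1) by auto
    ultimately show "m \<in> \<Phi> ` T" by blast
  qed
  then have "card (magnetization N B ` configs N :: (real ^ 'q ^ 's) set) \<le> card (\<Phi> ` T)"
    using finT by (intro card_mono) auto
  also have "\<dots> \<le> card T" by (rule card_image_le[OF finT])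
  also have "\<dots> = (N + 1) ^ (CARD('s) * CARD('q))"
    unfolding T_def by (subst card_funcsetE) auto
  finally show ?thesis .
qed

lemma poly_le_exp_eventually:
  assumes "\<epsilon> > (0::real)"
  shows "\<forall>\<^sub>F N in sequentially. (real N + 1) ^ d \<le> exp (\<epsilon> * real N)"
proof -
  have "((\<lambda>x. x ^ d / exp x) \<longlongrightarrow> (0::real)) at_top" by (rule tendsto_power_div_exp_0)
  moreover have "filterlim (\<lambda>N. \<epsilon> * (real N + 1)) at_top sequentially"
  proof -
    have "filterlim (\<lambda>N. real (Suc N)) at_top sequentially"
      by (rule filterlim_compose[OF filterlim_real_sequentially filterlim_Suc])
    then have "filterlim (\<lambda>N. \<epsilon> * real (Suc N)) at_top sequentially"
      by (rule filterlim_tendsto_pos_mult_at_top[OF tendsto_const assms])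
    then show ?thesis by (simp add: add.commute)
  qed
  ultimately have "((\<lambda>N. (\<epsilon> * (real N + 1)) ^ d / exp (\<epsilon> * (real N + 1))) \<longlongrightarrow> 0) sequentially"
    by (rule filterlim_compose)
  \<comment> \<open>The threshold contains exp (- \<epsilon>) to undo the shift from N to N + 1 in
    the exponential.\<close>
  then have "\<forall>\<^sub>F N in sequentially. (\<epsilon> * (real N + 1)) ^ d / exp (\<epsilon> * (real N + 1)) < \<epsilon> ^ d * exp (- \<epsilon>)"
    using assms by (intro order_tendstoD(2)) auto
  then show ?thesis
  proof eventually_elim
    case (elim N)
    then have "(\<epsilon> * (real N + 1)) ^ d < \<epsilon> ^ d * exp (- \<epsilon>) * exp (\<epsilon> * (real N + 1))"
      by (simp add: pos_divide_less_eq)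
    also have "\<dots> = \<epsilon> ^ d * exp (\<epsilon> * real N)" by (simp add: mult.assoc exp_add[symmetric] distrib_left)
    finally have "\<epsilon> ^ d * (real N + 1) ^ d < \<epsilon> ^ d * exp (\<epsilon> * real N)" by (simp add: power_mult_distrib)
    then show ?case using assms by simp
  qed
qed

definition unit_cube :: "(real ^ 'q::finite ^ 's::finite) set" where
  "unit_cube = {m. \<forall>k c. 0 \<le> m $ k $ c \<and> m $ k $ c \<le> 1}"

lemma norm_le_sum_abs:
  fixes m :: "real ^ 'q::finite ^ 's::finite"
  shows "norm m \<le> (\<Sum>k\<in>UNIV. \<Sum>c\<in>UNIV. \<bar>m $ k $ c\<bar>)"
proof -
  have "norm m \<le> (\<Sum>k\<in>UNIV. norm (m $ k))" by (simp add: norm_vec_def L2_set_le_sum)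
  also have "\<dots> \<le> (\<Sum>k\<in>UNIV. \<Sum>c\<in>UNIV. \<bar>m $ k $ c\<bar>)" by (intro sum_mono norm_le_l1_cart)
  finally show ?thesis .
qed

lemma compact_unit_cube: "compact (unit_cube :: (real ^ 'q::finite ^ 's::finite) set)"
proof -
  have "closed (unit_cube :: (real ^ 'q ^ 's) set)"
    unfolding unit_cube_def
    by (intro closed_Collect_all closed_Collect_conj closed_Collect_le continuous_intros)
  moreover have "bounded (unit_cube :: (real ^ 'q ^ 's) set)"
    unfolding bounded_iff
  proof (intro exI ballI)
    fix m :: "real ^ 'q ^ 's" assume m: "m \<in> unit_cube"
    have "norm m \<le> (\<Sum>k\<in>UNIV. \<Sum>c\<in>UNIV. \<bar>m $ k $ c\<bar>)" by (rule norm_le_sum_abs)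
    also have "\<dots> \<le> (\<Sum>k\<in>(UNIV::'s set). \<Sum>c\<in>(UNIV::'q set). 1)"
      using m by (intro sum_mono) (simp add: unit_cube_def)
    finally show "norm m \<le> (\<Sum>k\<in>(UNIV::'s set). \<Sum>c\<in>(UNIV::'q set). 1)" .
  qed
  ultimately show ?thesis by (simp add: compact_eq_bounded_closed)
qed

lemma magnetization_unit_cube:
  fixes B :: "'s::finite \<Rightarrow> nat set"
  assumes "block_partition N B" "N > 0"
  shows "magnetization N B \<omega> \<in> unit_cube"
  unfolding unit_cube_def
proof (intro CollectI allI)
  fix k c
  obtain n where "n \<le> N" "magnetization N B \<omega> $ k $ c = real n / real N"
    using magnetization_bounds[OF assms] by blast
  then show "0 \<le> magnetization N B \<omega> $ k $ c \<and> magnetization N B \<omega> $ k $ c \<le> 1"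
    using assms(2) by (simp add: divide_le_eq_1)
qed

section \<open>Gibbs masses along a sequence of asymptotically equal blocks\<close>

locale block_spin_potts =
  fixes S :: "nat \<Rightarrow> 's::finite \<Rightarrow> nat set" and \<alpha> \<beta> g :: real
  assumes \<alpha>: "0 < \<alpha>" and \<alpha>\<beta>: "\<alpha> < \<beta>"
    and blocks: "\<And>N. block_partition N (S N)"
    and uniform: "\<And>k. (\<lambda>N. real (card (S N k)) / real N) \<longlonglongrightarrow> 1 / real CARD('s)"
    and g: "g = (\<beta> + (real CARD('s) - 1) * \<alpha>) / real CARD('s)"
begin

abbreviation mag :: "nat \<Rightarrow> (nat \<Rightarrow> 'q::finite) \<Rightarrow> real ^ 'q ^ 's" where
  "mag N \<equiv> magnetization N (S N)"

abbreviation block_dev :: "nat \<Rightarrow> 's \<Rightarrow> real" where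
  "block_dev N k \<equiv> real (card (S N k)) - real N / real CARD('s)"

abbreviation mass :: "nat \<Rightarrow> (real ^ 'q::finite ^ 's) set \<Rightarrow> real" where
  "mass N A \<equiv> gibbs_mass \<alpha> \<beta> N (S N) A"

abbreviation pmass :: "nat \<Rightarrow> real ^ 'q::finite \<Rightarrow> (real ^ 'q ^ 's) set \<Rightarrow> real" where
  "pmass N x A \<equiv> product_mass N (S N) x A"

abbreviation law :: "nat \<Rightarrow> (real ^ 'q::finite ^ 's) measure" where
  "law N \<equiv> magnetization_law \<alpha> \<beta> N (S N)"

definition imbalance :: "nat \<Rightarrow> real" where
  "imbalance N = (\<Sum>k\<in>UNIV. \<bar>real (card (S N k)) / real N - 1 / real CARD('s)\<bar>)"

lemma g_pos: "g > 0"
proof -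
  have "(real CARD('s) - 1) * \<alpha> \<ge> 0" using \<alpha> real_CARD_ge_1[where 'q='s] by simp
  then have "\<beta> + (real CARD('s) - 1) * \<alpha> > 0" using \<alpha> \<alpha>\<beta> by linarith
  then show ?thesis unfolding g by simp
qed

lemma imbalance_tendsto_0: "imbalance \<longlonglongrightarrow> 0"
proof -
  have "(\<lambda>N. \<Sum>k\<in>UNIV. \<bar>real (card (S N k)) / real N - 1 / real CARD('s)\<bar>) \<longlonglongrightarrow>
     (\<Sum>k\<in>(UNIV::'s set). \<bar>1 / real CARD('s) - 1 / real CARD('s)\<bar>)"
    by (intro tendsto_intros uniform)
  then show ?thesis by (simp add: imbalance_def[abs_def])
qed

lemma mass_pos: "mass N (UNIV :: (real ^ 'q::finite ^ 's) set) > 0"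
  unfolding gibbs_mass_UNIV by (rule partition_function_pos)

lemma mass_ge_pmass:
  fixes x :: "real ^ 'q::finite"
  assumes N: "N > 0" and x: "x \<in> potts_minimizers g"
  shows "exp (- real N * free_energy g x) * pmass N x A \<le> mass N A"
proof -
  have "exp (- real N * free_energy g x) * product_weight (S N) x \<omega> \<le> exp (- hamiltonian \<alpha> \<beta> N (S N) \<omega>)" for \<omega>
  proof -
    have "0 \<le> real N * interaction \<alpha> \<beta> (mag N \<omega> - constant_rows x)"
      using \<alpha> \<alpha>\<beta> by (intro mult_nonneg_nonneg interaction_nonneg) auto
    then have "1 \<le> exp (real N * interaction \<alpha> \<beta> (mag N \<omega> - constant_rows x))" by simp
    moreover have "0 \<le> exp (- real N * free_energy g x) * product_weight (S N) x \<omega>"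
      using potts_minimizer_pos[OF g_pos x] by (intro mult_nonneg_nonneg product_weight_nonneg) (auto intro: less_imp_le)
    ultimately show ?thesis
      unfolding gibbs_weight_eq[OF blocks N g g_pos x] by (metis mult_left_mono mult.right_neutral)
  qed
  then show ?thesis
    unfolding config_mass_def sum_distrib_left by (intro sum_mono)
qed

lemma mass_UNIV_ge:
  fixes x :: "real ^ 'q::finite"
  assumes N: "N > 0" and x: "x \<in> potts_minimizers g"
  shows "exp (- real N * free_energy g x) \<le> mass N (UNIV :: (real ^ 'q ^ 's) set)"
  using mass_ge_pmass[OF assms, of UNIV] product_mass_UNIV[OF blocks potts_minimizer_sum[OF g_pos x]]
  by simp

text \<open>Half of \<epsilon> pays for the block imbalance, the other half for the number of
  magnetization values.\<close>

lemma mass_le_eventually: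
  fixes A :: "(real ^ 'q::finite ^ 's) set"
  assumes a: "\<And>m. m \<in> A \<Longrightarrow> m \<in> unit_cube \<Longrightarrow> a \<le> block_free_energy \<alpha> g m" and \<epsilon>: "\<epsilon> > 0"
  shows "\<forall>\<^sub>F N in sequentially. mass N A \<le> exp (- real N * (a - \<epsilon>))"
proof -
  let ?E = "\<lambda>N. exp (- real N * (a - \<epsilon> / 2))"
  define C where "C = g * real CARD('s) + ln (real CARD('q))"
  have C: "C > 0" unfolding C_def using g_pos real_CARD_ge_1[where 'q='q]
    by (intro add_pos_nonneg) auto
  define d where "d = CARD('s) * CARD('q)"
  have "\<forall>\<^sub>F N in sequentially. imbalance N < \<epsilon> / (2 * C)"
    using imbalance_tendsto_0 \<epsilon> C by (intro order_tendstoD(2)) auto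
  moreover have "\<forall>\<^sub>F N in sequentially. (real N + 1) ^ d \<le> exp (\<epsilon> / 2 * real N)"
    using \<epsilon> by (intro poly_le_exp_eventually) simp
  ultimately show ?thesis using eventually_gt_at_top[of 0]
  proof eventually_elim
    case (elim N)
    let ?M = "mag N :: (nat \<Rightarrow> 'q) \<Rightarrow> real ^ 'q ^ 's"
    define E where "E = ?M ` configs N \<inter> A"
    have fE: "finite E" unfolding E_def using finite_configs by blast
    have "mass N A = (\<Sum>m\<in>E. mass N {m})"
    proof -
      have "mass N A = (\<Sum>m\<in>E. \<Sum>\<omega> | \<omega> \<in> {\<omega> \<in> configs N. ?M \<omega> \<in> A} \<and> ?M \<omega> = m.
          exp (- hamiltonian \<alpha> \<beta> N (S N) \<omega>))"
        unfolding config_mass_def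
        by (intro sum.group[symmetric] fE finite_subset[OF _ finite_configs]) (auto simp: E_def)
      also have "\<dots> = (\<Sum>m\<in>E. mass N {m})"
        unfolding config_mass_def by (intro sum.cong refl) (auto simp: E_def)
      finally show ?thesis .
    qed
    also have "\<dots> \<le> (\<Sum>m\<in>E. ?E N)"
    proof (rule sum_mono)
      fix m assume m: "m \<in> E"
      then have cube: "m \<in> unit_cube" "m \<in> A"
        using magnetization_unit_cube[OF blocks elim(3)] by (auto simp: E_def)
      have "mass N {m} \<le> exp (- real N * (block_free_energy \<alpha> g m - imbalance N * C))"
        unfolding C_def using cube elim(3) \<alpha> \<alpha>\<beta> g_pos
        by (intro gibbs_mass_singleton_le blocks g) (auto simp: unit_cube_def imbalance_def)
      also have "imbalance N * C \<le> \<epsilon> / 2" using elim(1) C by (simp add: field_simps)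
      then have "- real N * (block_free_energy \<alpha> g m - imbalance N * C) \<le> - real N * (a - \<epsilon> / 2)"
        using a[OF cube(2,1)] by (intro mult_left_mono_neg) auto
      then have "exp (- real N * (block_free_energy \<alpha> g m - imbalance N * C)) \<le> ?E N"
        by (simp only: exp_le_cancel_iff)
      finally show "mass N {m} \<le> ?E N" .
    qed
    also have "\<dots> = real (card E) * ?E N" by simp
    also have "\<dots> \<le> exp (\<epsilon> / 2 * real N) * ?E N"
    proof (rule mult_right_mono)
      have "card E \<le> card (?M ` configs N)" unfolding E_def using finite_configs by (intro card_mono) auto
      also have "\<dots> \<le> (N + 1) ^ d" unfolding d_def by (rule card_magnetization_image[OF blocks elim(3)])
      finally have "real (card E) \<le> real ((N + 1) ^ d)" by (simp only: of_nat_le_iff)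
      then show "real (card E) \<le> exp (\<epsilon> / 2 * real N)" using elim(2) by (simp add: add.commute)
    qed simp
    also have "\<dots> = exp (- real N * (a - \<epsilon>))"
      unfolding exp_add[symmetric] by (simp add: algebra_simps)
    finally show ?case .
  qed
qed

text \<open>On the compact part of the cube outside \<open>U\<close> the exponent attains its
  minimum, which exceeds the global one by \<open>block_free_energy_eqD\<close>; half of the excess
  survives as \<epsilon>.\<close>

lemma mass_complement_exp_small:
  fixes U :: "(real ^ 'q::finite ^ 's) set"
  assumes U: "open U" "constant_rows ` potts_minimizers g \<subseteq> U" and x: "x \<in> potts_minimizers g"
  shows "\<exists>\<epsilon>>0. \<forall>\<^sub>F N in sequentially. mass N (- U) \<le> exp (- real N * (free_energy g (x :: real ^ 'q) + \<epsilon>))"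
proof (cases "unit_cube \<inter> - U = {}")
  case True
  \<comment> \<open>The hypothesis on \<open>a\<close> is vacuous here, so any exponent is
    admissible; 2 - 1 leaves a gap of 1.\<close>
  have "\<forall>\<^sub>F N in sequentially. mass N (- U) \<le> exp (- real N * ((free_energy g x + 2) - 1))"
    by (rule mass_le_eventually) (use True in auto)
  then show ?thesis by (intro exI[of _ 1]) (simp add: add.commute)
next
  case False
  have "compact (unit_cube \<inter> - U)" using U(1) compact_unit_cube by (intro compact_Int_closed) auto
  from continuous_attains_inf[OF this False continuous_on_block_free_energy[where \<alpha>=\<alpha> and g=g]]
  obtain m where m: "m \<in> unit_cube \<inter> - U"
    "\<And>n. n \<in> unit_cube \<inter> - U \<Longrightarrow> block_free_energy \<alpha> g m \<le> block_free_energy \<alpha> g n" by blast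
  define \<epsilon> where "\<epsilon> = (block_free_energy \<alpha> g m - free_energy g x) / 2"
  have "block_free_energy \<alpha> g m \<noteq> free_energy g x"
    using block_free_energy_eqD[OF \<alpha> x, of m] m(1) U(2) by blast
  then have \<epsilon>: "\<epsilon> > 0" using block_free_energy_ge[OF _ x, of \<alpha> m] \<alpha> by (simp add: \<epsilon>_def)
  have "\<forall>\<^sub>F N in sequentially. mass N (- U) \<le> exp (- real N * (block_free_energy \<alpha> g m - \<epsilon>))"
    by (rule mass_le_eventually[OF _ \<epsilon>]) (use m in auto)
  moreover have "block_free_energy \<alpha> g m - \<epsilon> = free_energy g x + \<epsilon>" by (simp add: \<epsilon>_def field_simps)
  ultimately show ?thesis using \<epsilon> by auto
qed

lemma law_complement_exp_small:
  fixes U :: "(real ^ 'q::finite ^ 's) set"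
  assumes U: "open U" "constant_rows ` potts_minimizers g \<subseteq> U"
  shows "\<exists>\<epsilon>>0. \<forall>\<^sub>F N in sequentially. measure (law N) (- U) \<le> exp (- \<epsilon> * real N)"
proof -
  obtain x :: "real ^ 'q" where x: "x \<in> potts_minimizers g" using potts_minimizer_exists[OF g_pos] by blast
  obtain \<epsilon> where \<epsilon>: "\<epsilon> > 0"
    "\<forall>\<^sub>F N in sequentially. mass N (- U) \<le> exp (- real N * (free_energy g x + \<epsilon>))"
    using mass_complement_exp_small[OF U x] by blast
  have "\<forall>\<^sub>F N in sequentially. measure (law N) (- U) \<le> exp (- \<epsilon> * real N)"
    using \<epsilon>(2) eventually_gt_at_top[of 0]
  proof eventually_elim
    case (elim N)
    have "measure (law N) (- U) = mass N (- U) / mass N (UNIV :: (real ^ 'q ^ 's) set)"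
      using U by (intro measure_magnetization_law) auto
    also have "\<dots> \<le> exp (- real N * (free_energy g x + \<epsilon>)) / exp (- real N * free_energy g x)"
      using elim mass_UNIV_ge[OF elim(2) x] config_mass_nonneg by (intro frac_le) auto
    also have "\<dots> = exp (- \<epsilon> * real N)" unfolding exp_diff[symmetric] by (simp add: algebra_simps)
    finally show ?case .
  qed
  with \<epsilon>(1) show ?thesis by blast
qed

text \<open>Exponential Markov inequality with field \<open>h\<close>; under the product weight the
  moment generating function is a product over blocks.\<close>

lemma pmass_chernoff:
  fixes h :: "'s \<Rightarrow> 'q::finite \<Rightarrow> real" and A :: "(real ^ 'q ^ 's) set"
  assumes N: "N > 0" and x: "\<And>c. 0 \<le> x $ c"
    and a: "\<And>m. m \<in> A \<Longrightarrow> a \<le> pairing h m"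
  shows "pmass N x A \<le> exp (- real N * a) * (\<Prod>k\<in>UNIV. (\<Sum>c\<in>UNIV. x $ c * exp (h k c)) ^ card (S N k))"
proof -
  let ?e = "\<lambda>\<omega>. exp (- real N * a) * (product_weight (S N) x \<omega> * exp (real N * pairing h (mag N \<omega>)))"
  have "pmass N x A \<le> (\<Sum>\<omega> | \<omega> \<in> configs N \<and> mag N \<omega> \<in> A. ?e \<omega>)"
    unfolding config_mass_def
  proof (rule sum_mono)
    fix \<omega> assume "\<omega> \<in> {\<omega> \<in> configs N. mag N \<omega> \<in> A}"
    then have "real N * a \<le> real N * pairing h (mag N \<omega>)"
      using a by (intro mult_left_mono) auto
    then have "1 \<le> exp (- real N * a) * exp (real N * pairing h (mag N \<omega>))"
      unfolding exp_add[symmetric] by simp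
    from mult_left_mono[OF this product_weight_nonneg[OF x, of "S N" \<omega>]]
    show "product_weight (S N) x \<omega> \<le> ?e \<omega>"
      by (simp add: mult_ac)
  qed
  also have "\<dots> \<le> (\<Sum>\<omega>\<in>configs N. ?e \<omega>)"
    by (rule sum_mono2[OF finite_configs])
      (auto intro!: mult_nonneg_nonneg product_weight_nonneg x)
  also have "\<dots> = exp (- real N * a) * (\<Prod>k\<in>UNIV. (\<Sum>c\<in>UNIV. x $ c * exp (h k c)) ^ card (S N k))"
    unfolding sum_distrib_left[symmetric] sum_configs_mgf[OF blocks N] ..
  finally show ?thesis .
qed

end

section \<open>Law of large numbers under the product weight, and lower bounds\<close>

lemma open_contains_box:
  fixes m0 :: "real ^ 'q::finite ^ 's::finite"
  assumes "open U" "m0 \<in> U"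
  shows "\<exists>\<delta>>0. \<delta> \<le> 1 \<and> (\<forall>m. (\<forall>k c. \<bar>m $ k $ c - m0 $ k $ c\<bar> < \<delta>) \<longrightarrow> m \<in> U)"
proof -
  obtain e where e: "e > 0" "ball m0 e \<subseteq> U" using assms open_contains_ball by blast
  define n where "n = real CARD('s) * real CARD('q)"
  have n: "n > 0" by (simp add: n_def)
  \<comment> \<open>Each of the n entries contributes at most e / (2 n) to the norm; the cap at 1
    keeps the later Chernoff parameter small.\<close>
  define \<delta> where "\<delta> = min 1 (e / (2 * n))"
  have "m \<in> U" if "\<And>k c. \<bar>m $ k $ c - m0 $ k $ c\<bar> < \<delta>" for m
  proof -
    have "norm (m - m0) \<le> (\<Sum>k\<in>UNIV. \<Sum>c\<in>UNIV. \<bar>(m - m0) $ k $ c\<bar>)" by (rule norm_le_sum_abs)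
    also have "\<dots> \<le> (\<Sum>k\<in>(UNIV::'s set). \<Sum>c\<in>(UNIV::'q set). e / (2 * n))"
    proof (intro sum_mono)
      fix k c show "\<bar>(m - m0) $ k $ c\<bar> \<le> e / (2 * n)" using that[of k c] by (simp add: \<delta>_def)
    qed
    also have "\<dots> = n * (e / (2 * n))" by (simp add: n_def)
    also have "\<dots> < e" using n e(1) by simp
    finally have "dist m0 m < e" by (simp add: dist_norm norm_minus_commute)
    then show ?thesis using e(2) by auto
  qed
  moreover have "\<delta> > 0" "\<delta> \<le> 1" using e n by (auto simp: \<delta>_def)
  ultimately show ?thesis by blast
qed

lemma (in block_spin_potts) block_deviation_le_imbalance:
  "\<bar>real (card (S N k)) / real N - 1 / real CARD('s)\<bar> \<le> imbalance N"
  unfolding imbalance_def by (rule member_le_sum) auto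

lemma (in block_spin_potts) card_block_le: "real (card (S N k)) \<le> real N"
proof -
  have "S N k \<subseteq> {1..N}" using blocks[of N] unfolding block_partition_def by blast
  then have "card (S N k) \<le> card {1..N}" by (intro card_mono) auto
  then show ?thesis by simp
qed

lemma (in block_spin_potts) pmass_coordinate_deviation:
  fixes x :: "real ^ 'q::finite"
  assumes x: "x \<in> potts_minimizers g" and \<delta>: "0 < \<delta>" "\<delta> \<le> 1" and \<sigma>: "\<sigma> = 1 \<or> \<sigma> = -1"
  shows "\<forall>\<^sub>F N in sequentially. pmass N x {m. \<delta> \<le> \<sigma> * (m $ k0 $ c0 - x $ c0 / real CARD('s))}
     \<le> exp (- (real N * (\<delta>\<^sup>2 / 8)))"
proof -
  let ?e = "\<lambda>N. exp (- (real N * (\<delta>\<^sup>2 / 8)))"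
  define s where "s = real CARD('s)"
  define p where "p = x $ c0"
  have xpos: "0 < x $ c" for c by (rule potts_minimizer_pos[OF g_pos x])
  have xsum: "(\<Sum>c\<in>UNIV. x $ c) = 1" by (rule potts_minimizer_sum[OF g_pos x])
  have p: "0 \<le> p" "p \<le> 1"
    using xpos[of c0] member_le_sum[of c0 UNIV "\<lambda>c. x $ c"] xpos xsum by (auto simp: p_def less_imp_le)
  \<comment> \<open>With this tilt the deviation gains \<delta>^2 / 4 per site, while the
    second-order term and the block imbalance cost at most \<delta>^2 / 16 each, leaving \<delta>^2
    / 8.\<close>
  define \<tau> where "\<tau> = \<sigma> * \<delta> / 4"
  have abs\<tau>: "\<bar>\<tau>\<bar> = \<delta> / 4" using \<sigma> \<delta> by (auto simp: \<tau>_def)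
  have sq\<tau>: "\<tau>\<^sup>2 = \<delta>\<^sup>2 / 16" using \<sigma> by (auto simp: \<tau>_def power2_eq_square)
  define h where "h k c = (if k = k0 \<and> c = c0 then \<tau> else 0)" for k :: 's and c :: 'q
  have hm: "pairing h m = \<tau> * m $ k0 $ c0" for m :: "real ^ 'q ^ 's"
  proof -
    have "(\<Sum>c\<in>UNIV. h k c * m $ k $ c) = (if k = k0 then \<tau> * m $ k0 $ c0 else 0)" for k
    proof -
      have "(\<Sum>c\<in>UNIV. h k c * m $ k $ c) = (\<Sum>c\<in>UNIV. if c = c0 then (if k = k0 then \<tau> * m $ k0 $ c0 else 0) else 0)"
        by (rule sum.cong) (auto simp: h_def)
      then show ?thesis by simp
    qed
    then show ?thesis by simp
  qed
  define P where "P = (\<Sum>c\<in>UNIV. x $ c * exp (h k0 c))"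
  have "P = (\<Sum>c\<in>UNIV. x $ c + (if c = c0 then p * (exp \<tau> - 1) else 0))"
    unfolding P_def by (rule sum.cong) (auto simp: h_def p_def algebra_simps)
  then have P: "P = 1 + p * (exp \<tau> - 1)" by (simp add: sum.distrib xsum)
  have P0: "0 \<le> P" unfolding P_def using xpos by (intro sum_nonneg mult_nonneg_nonneg) (auto intro: less_imp_le)
  have "exp \<tau> \<le> 1 + \<tau> + (1 + \<bar>\<tau>\<bar>) / 2 * \<tau>\<^sup>2" using abs\<tau> \<delta> by (intro exp_le_quadratic) simp
  also have "\<dots> \<le> 1 + \<tau> + 1 * \<tau>\<^sup>2" using abs\<tau> \<delta> by (intro add_left_mono mult_right_mono) auto
  finally have "p * (exp \<tau> - 1) \<le> p * (\<tau> + \<tau>\<^sup>2)" using p by (intro mult_left_mono) auto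
  also have "\<dots> \<le> p * \<tau> + 1 * \<tau>\<^sup>2" unfolding distrib_left using p by (intro add_left_mono mult_right_mono) auto
  finally have "P \<le> 1 + (p * \<tau> + \<tau>\<^sup>2)" by (simp add: P)
  also have "\<dots> \<le> exp (p * \<tau> + \<tau>\<^sup>2)" by (rule exp_ge_add_one_self)
  finally have Ple: "P \<le> exp (p * \<tau> + \<tau>\<^sup>2)" .
  have prod: "(\<Prod>k\<in>UNIV. (\<Sum>c\<in>UNIV. x $ c * exp (h k c)) ^ card (S N k)) = P ^ card (S N k0)" for N
  proof -
    have "(\<Prod>k\<in>UNIV. (\<Sum>c\<in>UNIV. x $ c * exp (h k c)) ^ card (S N k))
      = (\<Prod>k\<in>UNIV. if k = k0 then P ^ card (S N k0) else 1)"
      by (rule prod.cong) (auto simp: P_def h_def xsum)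
    then show ?thesis by simp
  qed
  define A :: "(real ^ 'q ^ 's) set" where "A = {m. \<delta> \<le> \<sigma> * (m $ k0 $ c0 - x $ c0 / real CARD('s))}"
  define a where "a = \<tau> * (p / s) + \<delta>\<^sup>2 / 4"
  have a: "a \<le> pairing h m" if "m \<in> A" for m
  proof -
    have "\<delta> * \<delta> \<le> \<delta> * (\<sigma> * (m $ k0 $ c0 - p / s))"
      using that \<delta> by (intro mult_left_mono) (auto simp: A_def p_def s_def)
    then show ?thesis unfolding hm a_def \<tau>_def by (simp add: power2_eq_square algebra_simps)
  qed
  have "\<forall>\<^sub>F N in sequentially. imbalance N < \<delta> / 4"
    using imbalance_tendsto_0 \<delta> by (intro order_tendstoD(2)) auto
  then have "\<forall>\<^sub>F N in sequentially. pmass N x A \<le> ?e N"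
    using eventually_gt_at_top[of 0]
  proof eventually_elim
    case (elim N)
    define n where "n = real (card (S N k0))"
    let ?t = "(n / real N - 1 / s) * (p * \<tau>)" and ?w = "real N * (\<delta>\<^sup>2 / 16)"
    have n: "0 \<le> n" "n \<le> real N" using card_block_le by (auto simp: n_def)
    have dev: "\<bar>n / real N - 1 / s\<bar> \<le> \<delta> / 4"
      using block_deviation_le_imbalance[of N k0] elim(1) by (simp add: n_def s_def)
    have "pmass N x A \<le> exp (- real N * a) * P ^ card (S N k0)"
      unfolding prod[symmetric] using xpos a by (intro pmass_chernoff elim(2)) (auto intro: less_imp_le)
    also have "\<dots> \<le> exp (- real N * a) * exp (p * \<tau> + \<tau>\<^sup>2) ^ card (S N k0)"
      using Ple P0 by (intro mult_left_mono power_mono) auto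
    also have "\<dots> = exp (- real N * a + n * (p * \<tau> + \<tau>\<^sup>2))"
      by (simp only: n_def exp_add exp_of_nat_mult)
    also have "\<dots> \<le> ?e N"
    proof -
      have "n * (p * \<tau>) = real N * (\<tau> * (p / s)) + real N * ?t"
        using elim(2) by (simp add: algebra_simps)
      moreover have "?t \<le> \<delta>\<^sup>2 / 16"
      proof -
        have "?t \<le> \<bar>n / real N - 1 / s\<bar> * \<bar>p * \<tau>\<bar>"
          unfolding abs_mult[symmetric] by (rule abs_ge_self)
        also have "\<dots> \<le> (\<delta> / 4) * (1 * (\<delta> / 4))"
          unfolding abs_mult abs\<tau> using dev p \<delta> by (intro mult_mono) auto
        finally show ?thesis by (simp add: power2_eq_square)
      qed
      then have "real N * ?t \<le> ?w"
        by (intro mult_left_mono) auto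
      moreover have "n * \<tau>\<^sup>2 \<le> ?w" unfolding sq\<tau> using n by (intro mult_right_mono) auto
      moreover have "- real N * a + n * (p * \<tau> + \<tau>\<^sup>2) =
          - (real N * (\<tau> * (p / s))) - 4 * ?w + n * (p * \<tau>) + n * \<tau>\<^sup>2"
        by (simp add: a_def algebra_simps)
      moreover have "real N * (\<delta>\<^sup>2 / 8) = 2 * ?w" by simp
      ultimately show ?thesis by (simp only: exp_le_cancel_iff)
    qed
    finally show ?case .
  qed
  then show ?thesis by (simp add: A_def)
qed

lemma tendsto_exp_neg_real: "c > 0 \<Longrightarrow> (\<lambda>N. exp (- (real N * c))) \<longlonglongrightarrow> 0"
proof -
  assume c: "c > 0"
  have "(\<lambda>N. exp (- c) ^ N) \<longlonglongrightarrow> 0" using c by (intro LIMSEQ_realpow_zero) auto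
  then show ?thesis by (simp add: exp_of_nat_mult[symmetric])
qed

lemma tendsto_0_of_exp_small:
  assumes "\<epsilon> > 0" "\<And>N. 0 \<le> f N" "\<forall>\<^sub>F N in sequentially. f N \<le> exp (- \<epsilon> * real N)"
  shows "f \<longlonglongrightarrow> 0"
proof (rule tendsto_sandwich[OF _ _ tendsto_const tendsto_exp_neg_real[OF assms(1)]])
  show "\<forall>\<^sub>F N in sequentially. f N \<le> exp (- (real N * \<epsilon>))"
    using assms(3) by eventually_elim (simp add: mult.commute)
qed (simp add: assms(2))

text \<open>A union bound over the one-sided deviations of all entries, two for each.\<close>

lemma (in block_spin_potts) pmass_concentrates:
  fixes x :: "real ^ 'q::finite"
  assumes x: "x \<in> potts_minimizers g" and U: "open U" "constant_rows x \<in> U"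
  shows "(\<lambda>N. pmass N x U) \<longlonglongrightarrow> 1"
proof -
  have xpos: "0 \<le> x $ c" for c using potts_minimizer_pos[OF g_pos x, of c] by simp
  note wpos = product_weight_nonneg[of x, OF xpos]
  obtain \<delta> where \<delta>: "0 < \<delta>" "\<delta> \<le> 1"
    "\<And>m. (\<And>k c. \<bar>m $ k $ c - constant_rows x $ k $ c\<bar> < \<delta>) \<Longrightarrow> m \<in> U"
    using open_contains_box[OF U] by blast
  let ?e = "\<lambda>N. exp (- (real N * (\<delta>\<^sup>2 / 8)))"
  define A :: "'s \<times> 'q \<times> real \<Rightarrow> (real ^ 'q ^ 's) set" where
    "A = (\<lambda>(k, c, \<sigma>). {m. \<delta> \<le> \<sigma> * (m $ k $ c - x $ c / real CARD('s))})"
  define I where "I = (UNIV :: 's set) \<times> (UNIV :: 'q set) \<times> {1, - 1 :: real}"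
  have fI: "finite I" by (simp add: I_def)
  have "- U \<subseteq> (\<Union>i\<in>I. A i)"
  proof
    fix m assume "m \<in> - U"
    then obtain k c where "\<not> \<bar>m $ k $ c - constant_rows x $ k $ c\<bar> < \<delta>" using \<delta>(3)[of m] by auto
    then have "m \<in> A (k, c, 1) \<or> m \<in> A (k, c, - 1)"
      by (auto simp: A_def constant_rows_def abs_if split: if_splits)
    then show "m \<in> (\<Union>i\<in>I. A i)" by (auto simp: I_def)
  qed
  then have le: "pmass N x (- U) \<le> (\<Sum>i\<in>I. pmass N x (A i))" for N
    by (rule order_trans[OF config_mass_mono[OF wpos] config_mass_UN_le[OF wpos fI]])
  have "\<forall>\<^sub>F N in sequentially. \<forall>i\<in>I. pmass N x (A i) \<le> ?e N"
    using fI pmass_coordinate_deviation[OF x \<delta>(1,2)]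
    by (intro eventually_ball_finite) (auto simp: I_def A_def)
  then have upper: "\<forall>\<^sub>F N in sequentially. pmass N x (- U) \<le> real (card I) * ?e N"
  proof eventually_elim
    case (elim N)
    have "(\<Sum>i\<in>I. pmass N x (A i)) \<le> (\<Sum>i\<in>I. ?e N)"
      using elim by (intro sum_mono) auto
    then show ?case using le[of N] by simp
  qed
  have lim: "(\<lambda>N. real (card I) * ?e N) \<longlonglongrightarrow> 0"
    using \<delta> by (intro tendsto_mult_right_zero tendsto_exp_neg_real) simp
  have lower: "\<forall>\<^sub>F N in sequentially. 0 \<le> pmass N x (- U)"
    by (intro always_eventually allI config_mass_nonneg wpos)
  have "(\<lambda>N. pmass N x (- U)) \<longlonglongrightarrow> 0"
    by (rule tendsto_sandwich[OF lower upper tendsto_const lim])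
  then have "(\<lambda>N. 1 - pmass N x (- U)) \<longlonglongrightarrow> 1 - 0" by (intro tendsto_intros)
  moreover have "1 - pmass N x (- U) = pmass N x U" for N
  proof -
    have "pmass N x U + pmass N x (- U) = pmass N x UNIV"
      unfolding config_mass_def
      by (subst sum.union_disjoint[symmetric]) (auto intro!: sum.cong finite_subset[OF _ finite_configs])
    then show ?thesis using product_mass_UNIV[OF blocks potts_minimizer_sum[OF g_pos x]] by simp
  qed
  ultimately show ?thesis by simp
qed

text \<open>\<open>D\<close> measures the loss in the upper bound of the partition function: a small
  exponential in \<open>law_ge_exp\<close>, a constant at criticality in
  \<open>law_bounded_below\<close>.\<close>

lemma (in block_spin_potts) law_ge_inverse:
  fixes x :: "real ^ 'q::finite" and U :: "(real ^ 'q ^ 's) set"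
  assumes x: "x \<in> potts_minimizers g" and U: "open U" and N: "N > 0" and half: "pmass N x U > 1 / 2"
    and Z: "mass N (UNIV :: (real ^ 'q ^ 's) set) \<le> D * exp (- real N * free_energy g x)"
  shows "1 / (2 * D) \<le> measure (law N) U"
proof -
  define E where "E = exp (- real N * free_energy g x)"
  have "1 / (2 * D) = (E * (1 / 2)) / (D * E)" by (simp add: E_def)
  also have "\<dots> \<le> mass N U / mass N (UNIV :: (real ^ 'q ^ 's) set)"
  proof (rule frac_le)
    have "E * (1 / 2) \<le> E * pmass N x U" using half by (intro mult_left_mono) (auto simp: E_def)
    also have "\<dots> \<le> mass N U" unfolding E_def by (rule mass_ge_pmass[OF N x])
    finally show "E * (1 / 2) \<le> mass N U" .
    show "0 \<le> mass N U" by (rule config_mass_nonneg) simp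
  qed (use Z mass_pos in \<open>auto simp: E_def\<close>)
  also have "\<dots> = measure (law N) U" using U by (intro measure_magnetization_law[symmetric]) auto
  finally show ?thesis .
qed

lemma (in block_spin_potts) law_ge_exp:
  fixes x :: "real ^ 'q::finite" and U :: "(real ^ 'q ^ 's) set"
  assumes x: "x \<in> potts_minimizers g" and U: "open U" "constant_rows x \<in> U" and \<epsilon>: "\<epsilon> > 0"
  shows "\<forall>\<^sub>F N in sequentially. exp (- \<epsilon> * real N) \<le> measure (law N) U"
proof -
  define G where "G = free_energy g x"
  have "\<forall>\<^sub>F N in sequentially. pmass N x U > 1 / 2"
    using pmass_concentrates[OF x U] by (intro order_tendstoD(1)) auto
  moreover have "\<forall>\<^sub>F N in sequentially. mass N (UNIV :: (real ^ 'q ^ 's) set) \<le> exp (- real N * (G - \<epsilon> / 2))"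
    using \<epsilon> \<alpha> block_free_energy_ge[OF _ x, of \<alpha>] unfolding G_def by (intro mass_le_eventually) auto
  moreover have "\<forall>\<^sub>F N in sequentially. exp (- (real N * (\<epsilon> / 2))) < 1 / 2"
    using tendsto_exp_neg_real[of "\<epsilon> / 2"] \<epsilon> by (intro order_tendstoD(2)) auto
  ultimately show ?thesis using eventually_gt_at_top[of 0]
  proof eventually_elim
    case (elim N)
    \<comment> \<open>Half of the exponent covers the loss in the partition function; the other half
      eventually absorbs the factor 1/2.\<close>
    define t where "t = real N * (\<epsilon> / 2)"
    have "- real N * (G - \<epsilon> / 2) = t + - real N * G" by (simp add: t_def algebra_simps)
    then have "1 / (2 * exp t) \<le> measure (law N) U"
      using law_ge_inverse[OF x U(1) elim(4,1), of "exp t"] elim(2) by (simp only: exp_add G_def)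
    moreover have "exp (- \<epsilon> * real N) = exp (- t) * exp (- t)"
      unfolding exp_add[symmetric] by (simp add: t_def)
    moreover have "exp (- t) * exp (- t) \<le> 1 / 2 * exp (- t)"
      using elim(3) unfolding t_def[symmetric] by (intro mult_right_mono) auto
    ultimately show ?case by (simp add: exp_minus inverse_eq_divide)
  qed
qed

section \<open>Weak limits\<close>

lemma prob_space_magnetization_law:
  "prob_space (magnetization_law \<alpha> \<beta> N B :: (real ^ 'q::finite ^ 's::finite) measure)"
proof -
  let ?G = "gibbs \<alpha> \<beta> N B :: (nat \<Rightarrow> 'q) measure"
  let ?Z = "partition_function TYPE('q) \<alpha> \<beta> N B"
  have Z: "?Z > 0" by (rule partition_function_pos)
  have "emeasure ?G (space ?G) = (\<Sum>\<omega>\<in>(configs N :: (nat \<Rightarrow> 'q) set). ennreal (exp (- hamiltonian \<alpha> \<beta> N B \<omega>) / ?Z))"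
    unfolding space_gibbs unfolding gibbs_def by (rule emeasure_point_measure_finite) (auto simp: finite_configs)
  also have "\<dots> = ennreal (\<Sum>\<omega>\<in>(configs N :: (nat \<Rightarrow> 'q) set). exp (- hamiltonian \<alpha> \<beta> N B \<omega>) / ?Z)"
    using Z by (intro sum_ennreal) auto
  also have "(\<Sum>\<omega>\<in>(configs N :: (nat \<Rightarrow> 'q) set). exp (- hamiltonian \<alpha> \<beta> N B \<omega>) / ?Z) = 1"
    unfolding sum_divide_distrib[symmetric] using Z by (simp add: partition_function_def)
  finally have "prob_space ?G" by (intro prob_spaceI) simp
  then show ?thesis unfolding magnetization_law_def
    by (rule prob_space.prob_space_distr[OF _ measurable_magnetization])
qed

text \<open>Concentration on a set suffices as long as \<open>f\<close> is constant on it. The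
  integrand \<open>f x - a\<close> is below e/2 in modulus on \<open>U\<close> and bounded by
  \<open>D\<close> elsewhere.\<close>

lemma integral_tendsto_of_concentration:
  fixes L :: "nat \<Rightarrow> ('a::topological_space) measure" and f :: "'a \<Rightarrow> real"
  assumes L: "\<And>N. prob_space (L N)" "\<And>N. sets (L N) = sets borel"
    and f: "continuous_on UNIV f" "\<And>x. \<bar>f x\<bar> \<le> C" and X: "\<And>x. x \<in> X \<Longrightarrow> f x = a"
    and conc: "\<And>U. open U \<Longrightarrow> X \<subseteq> U \<Longrightarrow> (\<lambda>N. measure (L N) (- U)) \<longlonglongrightarrow> 0"
  shows "(\<lambda>N. \<integral>x. f x \<partial>L N) \<longlonglongrightarrow> a"
proof (rule LIMSEQ_I)
  fix e :: real assume e: "e > 0"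
  define D where "D = max 1 (C + \<bar>a\<bar>)"
  have D: "D > 0" by (simp add: D_def)
  define U where "U = {x. \<bar>f x - a\<bar> < e / 2}"
  have U: "open U" unfolding U_def by (intro open_Collect_less continuous_intros f)
  have "X \<subseteq> U" using X e by (auto simp: U_def)
  then have "(\<lambda>N. measure (L N) (- U)) \<longlonglongrightarrow> 0" using U by (intro conc)
  then have "\<forall>\<^sub>F N in sequentially. measure (L N) (- U) < e / (2 * D)"
    using e D by (intro order_tendstoD(2)) auto
  then obtain N0 where N0: "\<And>N. N \<ge> N0 \<Longrightarrow> measure (L N) (- U) < e / (2 * D)"
    unfolding eventually_sequentially by blast
  have "norm ((\<integral>x. f x \<partial>L N) - a) < e" if N: "N \<ge> N0" for N
  proof -
    interpret prob_space "L N" by (rule L)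
    have sp: "space (L N) = UNIV" using sets_eq_imp_space_eq[OF L(2)[of N]] by simp
    have meas: "f \<in> borel_measurable (L N)"
      using borel_measurable_continuous_onI[OF f(1)] by (simp add: measurable_cong_sets[OF L(2)])
    have int: "integrable (L N) f"
      by (rule integrable_const_bound[of _ C]) (auto simp: f meas)
    have Um: "- U \<in> sets (L N)" using U unfolding L(2) by auto
    have "(\<integral>x. f x \<partial>L N) - a = (\<integral>x. f x - a \<partial>L N)" using int by (simp add: prob_space)
    then have "norm ((\<integral>x. f x \<partial>L N) - a) \<le> (\<integral>x. norm (f x - a) \<partial>L N)"
      by (simp only: integral_norm_bound)
    also have "\<dots> \<le> (\<integral>x. e / 2 + D * indicator (- U) x \<partial>L N)"
    proof (rule integral_mono)
      show "norm (f x - a) \<le> e / 2 + D * indicator (- U) x" for x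
        using f(2)[of x] e by (cases "x \<in> U") (auto simp: U_def D_def)
    qed (use int Um in \<open>auto simp: sp less_top[symmetric] intro!: Bochner_Integration.integrable_add integrable_mult_right\<close>)
    also have "\<dots> = e / 2 + D * measure (L N) (- U)"
      using Um prob_space by (simp add: sp less_top[symmetric])
    also have "\<dots> < e / 2 + D * (e / (2 * D))" using N0[OF N] D by (intro add_strict_left_mono mult_strict_left_mono)
    also have "\<dots> = e" using D by simp
    finally show ?thesis .
  qed
  then show "\<exists>N0. \<forall>N\<ge>N0. norm ((\<integral>x. f x \<partial>L N) - a) < e" by blast
qed

lemma integral_uniform_dirac_mixture:
  fixes f :: "'a::topological_space \<Rightarrow> real" and x :: "'i::finite \<Rightarrow> 'a"
  assumes f: "f \<in> borel_measurable borel"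
  shows "(\<integral>y. f y \<partial>uniform_dirac_mixture x) = (\<Sum>i\<in>UNIV. f (x i)) / real CARD('i)"
proof -
  let ?u = "uniform_count_measure (UNIV :: 'i set)"
  have x: "x \<in> ?u \<rightarrow>\<^sub>M borel" by (rule measurableI) (auto simp: sets_uniform_count_measure)
  have "uniform_dirac_mixture x = distr ?u borel x"
    unfolding uniform_dirac_mixture_def
    by (rule bind_return_distr'[OF _ x]) (simp add: space_uniform_count_measure)
  then have "(\<integral>y. f y \<partial>uniform_dirac_mixture x) = (\<integral>i. f (x i) \<partial>?u)"
    by (simp add: integral_distr[OF x f])
  also have "\<dots> = (\<Sum>i\<in>UNIV. (1 / real CARD('i)) *\<^sub>R f (x i))"
    unfolding uniform_count_measure_def
    by (rule lebesgue_integral_point_measure_finite) auto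
  finally show ?thesis by (simp add: sum_divide_distrib)
qed

section \<open>Colour symmetry and the weak limits\<close>

definition permute_colours :: "('q \<Rightarrow> 'q) \<Rightarrow> real ^ 'q::finite ^ 's::finite \<Rightarrow> real ^ 'q ^ 's" where
  "permute_colours p m = (\<chi> k c. m $ k $ p c)"

lemma continuous_on_permute_colours:
  "continuous_on UNIV f \<Longrightarrow> continuous_on UNIV (\<lambda>m. f (permute_colours p m))"
  unfolding permute_colours_def
  by (rule continuous_on_compose2[of UNIV f]) (auto intro!: continuous_intros)

lemma interaction_permute_colours:
  assumes "bij p" shows "interaction \<alpha> \<beta> (permute_colours p m) = interaction \<alpha> \<beta> m"
proof -
  have "(\<Sum>c\<in>UNIV. F (p c)) = (\<Sum>c\<in>UNIV. F c)" for F :: "_ \<Rightarrow> real"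
    using sum.reindex_bij_betw[OF assms, of F] by simp
  from this[of "\<lambda>c. (m $ k $ c)\<^sup>2" for k] this[of "\<lambda>c. (\<Sum>k\<in>UNIV. m $ k $ c)\<^sup>2"]
  show ?thesis by (simp add: interaction_def permute_colours_def)
qed

text \<open>Recolouring by \<open>inv p\<close> is an energy-preserving bijection of the
  configurations that acts on the magnetization as \<open>permute_colours p\<close>.\<close>

lemma integral_permute_colours:
  fixes f :: "real ^ 'q::finite ^ 's::finite \<Rightarrow> real"
  assumes B: "block_partition N B" and N: "N > 0" and p: "bij p" and f: "continuous_on UNIV f"
  shows "(\<integral>m. f (permute_colours p m) \<partial>magnetization_law \<alpha> \<beta> N B) = (\<integral>m. f m \<partial>magnetization_law \<alpha> \<beta> N B)"
proof -
  note cont = continuous_on_permute_colours[OF f]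
  \<comment> \<open>The restriction keeps recoloured functions \<open>undefined\<close> outside
    {1..N}, as membership in \<open>configs N\<close> demands.\<close>
  define T where "T p \<omega> = (\<lambda>i\<in>{1..N}. p (\<omega> i))" for p :: "'q \<Rightarrow> 'q" and \<omega> :: "nat \<Rightarrow> 'q"
  have Tconf: "T p \<omega> \<in> configs N" if "\<omega> \<in> configs N" for p \<omega>
    unfolding T_def configs_def by auto
  have TT: "T p (T p' \<omega>) = \<omega>" if "\<omega> \<in> configs N" "\<And>c. p (p' c) = c" for p p' \<omega>
  proof (rule ext)
    fix i
    show "T p (T p' \<omega>) i = \<omega> i"
    proof (cases "i \<in> {1..N}")
      case True
      then show ?thesis using that(2)[of "\<omega> i"] by (simp add: T_def)
    next
      case False
      then have "\<omega> i = undefined" using that(1) unfolding configs_def by (rule PiE_arb[rotated])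
      then show ?thesis using False unfolding T_def restrict_def by (simp only: if_False)
    qed
  qed
  have sub: "B k \<subseteq> {1..N}" for k using B unfolding block_partition_def by blast
  have M: "magnetization N B (T (inv p) \<omega>) = permute_colours p (magnetization N B \<omega>)" for \<omega>
  proof -
    have "(\<Sum>i\<in>B k. of_bool (T (inv p) \<omega> i = c)) = (\<Sum>i\<in>B k. of_bool (\<omega> i = p c) :: real)" for k c
    proof (rule sum.cong[OF refl])
      fix i assume "i \<in> B k"
      then have "T (inv p) \<omega> i = inv p (\<omega> i)" using sub[of k] unfolding T_def by (intro restrict_apply') blast
      moreover have "inv p (\<omega> i) = c \<longleftrightarrow> \<omega> i = p c" using bij_inv_eq_iff[OF p, of c "\<omega> i"] by auto
      ultimately show "of_bool (T (inv p) \<omega> i = c) = (of_bool (\<omega> i = p c) :: real)" by simp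
    qed
    then show ?thesis by (simp add: magnetization_def permute_colours_def vec_eq_iff)
  qed
  have "(\<Sum>\<omega>\<in>configs N. f (permute_colours p (magnetization N B \<omega>)) * exp (- hamiltonian \<alpha> \<beta> N B \<omega>))
    = (\<Sum>\<omega>\<in>configs N. f (magnetization N B \<omega>) * exp (- hamiltonian \<alpha> \<beta> N B \<omega>))"
  proof (rule sum.reindex_bij_witness[of _ "T p" "T (inv p)"])
    fix \<omega> :: "nat \<Rightarrow> 'q" assume \<omega>: "\<omega> \<in> configs N"
    show "T p (T (inv p) \<omega>) = \<omega>" using TT[OF \<omega>] p by (simp add: bij_is_surj surj_f_inv_f)
    show "T (inv p) (T p \<omega>) = \<omega>" using TT[OF \<omega>] p by (simp add: bij_is_inj)
    show "f (magnetization N B (T (inv p) \<omega>)) * exp (- hamiltonian \<alpha> \<beta> N B (T (inv p) \<omega>))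
      = f (permute_colours p (magnetization N B \<omega>)) * exp (- hamiltonian \<alpha> \<beta> N B \<omega>)"
      unfolding hamiltonian_eq_interaction[OF B N] M interaction_permute_colours[OF p] ..
  qed (use Tconf in auto)
  then show ?thesis
    using integral_magnetization_law[OF borel_measurable_continuous_onI[OF cont]]
      integral_magnetization_law[OF borel_measurable_continuous_onI[OF f]] by simp
qed

text \<open>Composition with a transposition shows that the sum does not depend on \<open>i\<close>;
  summing over all \<open>i\<close> and exchanging the sums evaluates it.\<close>

lemma sum_over_permutations:
  fixes F :: "'q::finite \<Rightarrow> real" and i :: 'q
  shows "(\<Sum>p | bij p. F (inv p i)) / real (card {p :: 'q \<Rightarrow> 'q. bij p}) = (\<Sum>j\<in>UNIV. F j) / real CARD('q)"
proof -
  define P where "P = {p :: 'q \<Rightarrow> 'q. bij p}"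
  define A where "A i = (\<Sum>p\<in>P. F (inv p i))" for i
  have "id \<in> P" by (simp add: P_def)
  then have P: "real (card P) > 0" by (simp add: card_gt_0_iff) blast
  have eq: "A j = A i" for i j
  proof -
    define t where "t = Transposition.transpose i j"
    have t: "bij t" "t \<circ> t = id" "t i = j" unfolding t_def by auto
    have invt: "inv t = t" using t by (metis inv_unique_comp)
    have "bij_betw (\<lambda>p. t \<circ> p) P P"
      by (rule bij_betwI[where g="\<lambda>p. t \<circ> p"])
        (use t in \<open>auto simp: P_def bij_comp comp_assoc[symmetric]\<close>)
    then have "(\<Sum>p\<in>P. F (inv (t \<circ> p) i)) = A i"
      unfolding A_def by (rule sum.reindex_bij_betw)
    moreover have "inv (t \<circ> p) i = inv p j" if "p \<in> P" for p
      using that t by (simp add: P_def o_inv_distrib invt)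
    ultimately show ?thesis by (simp add: A_def)
  qed
  have "(\<Sum>j\<in>UNIV. A j) = (\<Sum>j\<in>(UNIV :: 'q set). A i)" by (rule sum.cong[OF refl eq])
  then have "real CARD('q) * A i = (\<Sum>j\<in>UNIV. A j)" by simp
  also have "\<dots> = (\<Sum>p\<in>P. \<Sum>j\<in>UNIV. F (inv p j))" unfolding A_def by (rule sum.swap)
  also have "\<dots> = (\<Sum>p\<in>P. \<Sum>j\<in>UNIV. F j)"
  proof (rule sum.cong[OF refl])
    fix p assume "p \<in> P"
    then have "bij (inv p)" by (simp add: P_def bij_imp_bij_inv)
    then show "(\<Sum>j\<in>UNIV. F (inv p j)) = (\<Sum>j\<in>UNIV. F j)" by (rule sum.reindex_bij_betw)
  qed
  finally have "real CARD('q) * A i = real (card P) * (\<Sum>j\<in>UNIV. F j)" by simp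
  moreover have "P \<noteq> {}" using \<open>id \<in> P\<close> by blast
  ultimately show ?thesis using P unfolding P_def[symmetric] A_def[symmetric]
    by (simp add: frac_eq_eq mult.commute)
qed

lemma (in block_spin_potts) law_complement_tendsto_0:
  fixes U :: "(real ^ 'q::finite ^ 's) set"
  assumes U: "open U" "constant_rows ` potts_minimizers g \<subseteq> U"
  shows "(\<lambda>N. measure (law N) (- U)) \<longlonglongrightarrow> 0"
proof -
  obtain \<epsilon> where \<epsilon>: "\<epsilon> > 0" "\<forall>\<^sub>F N in sequentially. measure (law N) (- U) \<le> exp (- \<epsilon> * real N)"
    using law_complement_exp_small[OF U] by blast
  then show ?thesis by (intro tendsto_0_of_exp_small[of \<epsilon>]) auto
qed

lemma nu_eq_constant_rows:
  "nu g i = constant_rows (colour_vec i (potts_u CARD('q) g))" for i :: "'q::finite"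
  by (simp add: nu_def phi_def constant_rows_def colour_vec_def vec_eq_iff mult.commute)

lemma Q_matrix_eq_constant_rows: "Q_matrix = constant_rows (colour_vec i 0)"
  by (simp add: Q_matrix_def constant_rows_def colour_vec_def vec_eq_iff mult.commute)

lemma (in block_spin_potts) weak_limit_subcritical:
  assumes q: "CARD('q::finite) \<ge> 3" and sub: "g < potts_zeta CARD('q)"
  shows "weakly_converges (law :: nat \<Rightarrow> (real ^ 'q ^ 's) measure) (return borel Q_matrix)"
  unfolding weakly_converges_def
proof (intro allI impI)
  fix f :: "real ^ 'q ^ 's \<Rightarrow> real"
  assume "continuous_on UNIV f \<and> bounded (range f)"
  then obtain C where f: "continuous_on UNIV f" "\<And>x. \<bar>f x\<bar> \<le> C" by (auto simp: bounded_iff)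
  have "(\<lambda>N. \<integral>x. f x \<partial>law N) \<longlonglongrightarrow> f Q_matrix"
  proof (rule integral_tendsto_of_concentration[OF prob_space_magnetization_law sets_magnetization_law f _ law_complement_tendsto_0])
    fix m :: "real ^ 'q ^ 's" assume "m \<in> constant_rows ` potts_minimizers g"
    then have "m = constant_rows (colour_vec (undefined :: 'q) 0)"
      using potts_minimizers_subcritical[OF q g_pos sub, of undefined] by auto
    then show "f m = f Q_matrix" by (simp add: Q_matrix_eq_constant_rows[of undefined])
  qed
  moreover have "(\<integral>x. f x \<partial>return borel Q_matrix) = f Q_matrix"
    using borel_measurable_continuous_onI[OF f(1)] by (intro integral_return) auto
  ultimately show "(\<lambda>N. \<integral>x. f x \<partial>law N) \<longlonglongrightarrow> (\<integral>x. f x \<partial>return borel Q_matrix)" by simp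
qed

text \<open>The symmetrised test function \<open>F\<close> has the same integral as \<open>f\<close>
  for N > 0 and is constant on the points \<open>nu g i\<close>, where its value is the uniform
  average of \<open>f\<close>.\<close>

lemma (in block_spin_potts) weak_limit_supercritical:
  assumes q: "CARD('q::finite) \<ge> 3" and super: "g > potts_zeta CARD('q)"
  shows "weakly_converges (law :: nat \<Rightarrow> (real ^ 'q ^ 's) measure) (uniform_dirac_mixture (nu g))"
  unfolding weakly_converges_def
proof (intro allI impI)
  fix f :: "real ^ 'q ^ 's \<Rightarrow> real"
  assume "continuous_on UNIV f \<and> bounded (range f)"
  then obtain C where f: "continuous_on UNIV f" "\<And>x. \<bar>f x\<bar> \<le> C" by (auto simp: bounded_iff)
  define P where "P = {p :: 'q \<Rightarrow> 'q. bij p}"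
  have "id \<in> P" by (simp add: P_def)
  then have cP: "real (card P) > 0" by (simp add: card_gt_0_iff) blast
  define F where "F m = (\<Sum>p\<in>P. f (permute_colours p m)) / real (card P)" for m
  note cont = continuous_on_permute_colours[OF f(1)]
  have contF: "continuous_on UNIV F" unfolding F_def[abs_def] using cP by (intro continuous_intros cont) auto
  have bF: "\<bar>F m\<bar> \<le> C" for m
  proof -
    have "\<bar>\<Sum>p\<in>P. f (permute_colours p m)\<bar> \<le> (\<Sum>p\<in>P. C)"
      by (rule order_trans[OF sum_abs]) (intro sum_mono f)
    then show ?thesis using cP by (simp add: F_def field_simps)
  qed
  \<comment> \<open>Columns are permuted by precomposition, so the distinguished colour moves by the
    inverse permutation.\<close>
  have permnu: "permute_colours p (nu g i) = (nu g (inv p i) :: real ^ 'q ^ 's)" if "bij p" for p and i :: 'q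
    using that by (auto simp: permute_colours_def nu_def phi_def vec_eq_iff bij_inv_eq_iff)
  have Fnu: "F (nu g i) = (\<Sum>j\<in>UNIV. f (nu g j)) / real CARD('q)" for i
  proof -
    have "(\<Sum>p\<in>P. f (permute_colours p (nu g i))) = (\<Sum>p\<in>P. f (nu g (inv p i)))"
      by (rule sum.cong) (auto simp: P_def permnu)
    then show ?thesis unfolding F_def using sum_over_permutations[of "\<lambda>j. f (nu g j)" i] by (simp add: P_def)
  qed
  have "(\<lambda>N. \<integral>m. F m \<partial>law N) \<longlonglongrightarrow> (\<Sum>j\<in>UNIV. f (nu g j)) / real CARD('q)"
  proof (rule integral_tendsto_of_concentration[OF prob_space_magnetization_law sets_magnetization_law contF bF _ law_complement_tendsto_0])
    fix m :: "real ^ 'q ^ 's" assume "m \<in> constant_rows ` potts_minimizers g"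
    then have "m \<in> range (nu g)" using potts_minimizers_supercritical[OF q super] by (auto simp: nu_eq_constant_rows)
    then show "F m = (\<Sum>j\<in>UNIV. f (nu g j)) / real CARD('q)" using Fnu by auto
  qed
  moreover have "\<forall>\<^sub>F N in sequentially. (\<integral>m. F m \<partial>law N) = (\<integral>m. f m \<partial>law N)"
    using eventually_gt_at_top[of 0]
  proof eventually_elim
    case (elim N)
    interpret prob_space "law N :: (real ^ 'q ^ 's) measure" by (rule prob_space_magnetization_law)
    have int: "integrable (law N) (\<lambda>m. f (permute_colours p m))" for p
      using borel_measurable_continuous_onI[OF cont]
      by (intro integrable_const_bound[of _ C])
        (auto simp: f measurable_cong_sets[OF sets_magnetization_law refl])
    have "(\<integral>m. F m \<partial>law N) = (\<Sum>p\<in>P. \<integral>m. f (permute_colours p m) \<partial>law N) / real (card P)"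
      unfolding F_def using int by simp
    also have "(\<Sum>p\<in>P. \<integral>m. f (permute_colours p m) \<partial>law N) = (\<Sum>p\<in>P. \<integral>m. f m \<partial>law N)"
      using elim by (intro sum.cong refl integral_permute_colours blocks f) (auto simp: P_def)
    finally show ?case using cP \<open>id \<in> P\<close> by (simp split: if_splits)
  qed
  ultimately have "(\<lambda>N. \<integral>m. f m \<partial>law N) \<longlonglongrightarrow> (\<Sum>j\<in>UNIV. f (nu g j)) / real CARD('q)"
    by (rule Lim_transform_eventually)
  then show "(\<lambda>N. \<integral>x. f x \<partial>law N) \<longlonglongrightarrow> (\<integral>x. f x \<partial>uniform_dirac_mixture (nu g))"
    unfolding integral_uniform_dirac_mixture[OF borel_measurable_continuous_onI[OF f(1)]] .
qed

section \<open>Limit points on the exponential scale\<close>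

lemma (in block_spin_potts) law_exp_small_near_nonminimizer:
  fixes y :: "real ^ 'q::finite ^ 's"
  assumes closed: "closed (constant_rows ` potts_minimizers g :: (real ^ 'q ^ 's) set)"
    and y: "y \<notin> constant_rows ` potts_minimizers g"
  obtains W \<epsilon> where "open W" "y \<in> W" "\<epsilon> > 0"
    "\<forall>\<^sub>F N in sequentially. measure (law N) W \<le> exp (- \<epsilon> * real N)"
proof -
  let ?X = "constant_rows ` potts_minimizers g :: (real ^ 'q ^ 's) set"
  have "open (- ?X)" "y \<in> - ?X" using closed y by auto
  then obtain e where e: "e > 0" "ball y e \<subseteq> - ?X" using open_contains_ball by blast
  \<comment> \<open>Removing the closed ball of half the radius leaves an open set that still
    contains all limit matrices, while its complement contains a neighbourhood of
    \<open>y\<close>.\<close>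
  define V where "V = - cball y (e / 2)"
  have V: "open V" unfolding V_def by (intro open_Compl closed_cball)
  have "?X \<subseteq> V"
  proof
    fix z assume "z \<in> ?X"
    then have "z \<notin> ball y e" using e by blast
    then show "z \<in> V" using e(1) by (simp add: V_def)
  qed
  then obtain \<epsilon> where \<epsilon>: "\<epsilon> > 0" "\<forall>\<^sub>F N in sequentially. measure (law N) (- V) \<le> exp (- \<epsilon> * real N)"
    using law_complement_exp_small[OF V] by blast
  have le: "measure (law N) (ball y (e / 2)) \<le> measure (law N) (- V)" for N
  proof -
    interpret prob_space "law N :: (real ^ 'q ^ 's) measure" by (rule prob_space_magnetization_law)
    show ?thesis
    proof (rule finite_measure_mono)
      show "ball y (e / 2) \<subseteq> - V" unfolding V_def using ball_subset_cball by blast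
      show "- V \<in> sets (law N)" unfolding sets_magnetization_law using V by auto
    qed
  qed
  show thesis
  proof (rule that[of "ball y (e / 2)" \<epsilon>])
    show "\<forall>\<^sub>F N in sequentially. measure (law N) (ball y (e / 2)) \<le> exp (- \<epsilon> * real N)"
      using \<epsilon>(2) by eventually_elim (rule order_trans[OF le])
  qed (use e(1) \<epsilon>(1) in auto)
qed

lemma (in block_spin_potts) ld_limit_points_law:
  assumes closed: "closed (constant_rows ` potts_minimizers g :: (real ^ 'q::finite ^ 's) set)"
  shows "ld_limit_points (law :: nat \<Rightarrow> (real ^ 'q ^ 's) measure) = constant_rows ` potts_minimizers g"
proof (intro equalityI subsetI)
  fix y :: "real ^ 'q ^ 's" assume "y \<in> constant_rows ` potts_minimizers g"
  then obtain x where x: "x \<in> potts_minimizers g" "y = constant_rows x" by blast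
  show "y \<in> ld_limit_points law"
    unfolding ld_limit_points_def
  proof (intro CollectI allI impI)
    fix U :: "(real ^ 'q ^ 's) set" and \<epsilon> :: real
    assume U: "open U \<and> y \<in> U" and \<epsilon>: "\<epsilon> > 0"
    have "\<forall>\<^sub>F N in sequentially. exp (- \<epsilon> * real N) \<le> measure (law N) U"
      by (rule law_ge_exp[OF x(1) _ _ \<epsilon>]) (use U x(2) in auto)
    then show "\<exists>\<^sub>F N in sequentially. exp (- \<epsilon> * real N) \<le> measure (law N) U"
      by (rule eventually_frequently[rotated]) simp
  qed
next
  fix y :: "real ^ 'q ^ 's" assume y: "y \<in> ld_limit_points law"
  show "y \<in> constant_rows ` potts_minimizers g"
  proof (rule ccontr)
    assume "y \<notin> constant_rows ` potts_minimizers g"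
    with closed obtain W \<epsilon> where W: "open W" "y \<in> W" and \<epsilon>: "\<epsilon> > 0"
      "\<forall>\<^sub>F N in sequentially. measure (law N) W \<le> exp (- \<epsilon> * real N)"
      by (rule law_exp_small_near_nonminimizer)
    \<comment> \<open>Half the decay rate: a lower bound at this rate contradicts decay at rate
      \<epsilon> for any N > 0.\<close>
    have "\<epsilon> / 2 > 0" using \<epsilon>(1) by simp
    with y W have "\<exists>\<^sub>F N in sequentially. exp (- (\<epsilon> / 2) * real N) \<le> measure (law N) W"
      unfolding ld_limit_points_def by blast
    moreover have "\<forall>\<^sub>F N in sequentially. measure (law N) W \<le> exp (- \<epsilon> * real N) \<and> N > 0"
      using \<epsilon>(2) eventually_gt_at_top[of 0] by (rule eventually_conj)
    ultimately obtain N where N: "exp (- (\<epsilon> / 2) * real N) \<le> measure (law N) W"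
      "measure (law N) W \<le> exp (- \<epsilon> * real N)" "N > 0"
      using frequently_ex[OF frequently_eventually_frequently] by blast
    then have "exp (- (\<epsilon> / 2) * real N) \<le> exp (- \<epsilon> * real N)" by linarith
    then have "\<epsilon> * real N \<le> 0" by simp
    moreover have "\<epsilon> * real N > 0" using \<epsilon>(1) N(3) by simp
    ultimately show False by linarith
  qed
qed

section \<open>Weights of the phases at criticality\<close>

text \<open>The covariance matrix of the colour law \<open>x\<close> is at most 1/q, a bound
  attained in both phases. The second derivative of the free energy at \<open>x\<close> is therefore
  at least g (1 - g/q), positive since \<zeta> < q.\<close>

lemma potts_minimizer_variance_critical:
  fixes x v :: "real ^ 'q::finite"
  assumes q: "CARD('q) \<ge> 3" and x: "x \<in> potts_minimizers (potts_zeta CARD('q))"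
  shows "(\<Sum>c\<in>UNIV. x $ c * (v $ c)\<^sup>2) - (\<Sum>c\<in>UNIV. x $ c * v $ c)\<^sup>2 \<le> (\<Sum>c\<in>UNIV. (v $ c)\<^sup>2) / real CARD('q)"
proof -
  define r where "r = real CARD('q)"
  have r: "r \<ge> 3" using q by (simp add: r_def)
  obtain i :: 'q where "x = colour_vec i 0 \<or> x = colour_vec i ((r - 2) / (r - 1))"
    using x potts_minimizers_critical(2)[OF q refl refl, of undefined] by (auto simp: r_def)
  then show ?thesis
  proof
    assume x: "x = colour_vec i 0"
    have "(\<Sum>c\<in>UNIV. x $ c * (v $ c)\<^sup>2) = (\<Sum>c\<in>UNIV. (v $ c)\<^sup>2) / real CARD('q)"
      unfolding sum_divide_distrib by (rule sum.cong) (auto simp: x colour_vec_def)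
    then show ?thesis by simp
  next
    assume x: "x = colour_vec i ((r - 2) / (r - 1))"
    define n where "n = r - 1"
    have n: "n \<ge> 2" "r = n + 1" using r by (auto simp: n_def)
    define w T V where "w = v $ i" and "T = (\<Sum>c\<in>UNIV - {i}. v $ c)" and "V = (\<Sum>c\<in>UNIV - {i}. (v $ c)\<^sup>2)"
    let ?v = "n / r * w\<^sup>2 + 1 / (r * n) * V - (n / r * w + 1 / (r * n) * T)\<^sup>2"
    have xi: "x $ i = n / r" using r by (simp add: x colour_vec_def r_def[symmetric] n_def)
    have xc: "x $ c = 1 / (r * n)" if "c \<noteq> i" for c
    proof -
      have "1 - (r - 2) / (r - 1) = 1 / n" using r by (simp add: n_def field_simps)
      then show ?thesis using that by (simp add: x colour_vec_def r_def[symmetric])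
    qed
    have 1: "(\<Sum>c\<in>UNIV. x $ c * (v $ c)\<^sup>2) = n / r * w\<^sup>2 + 1 / (r * n) * V"
    proof -
      have "(\<Sum>c\<in>UNIV - {i}. x $ c * (v $ c)\<^sup>2) = 1 / (r * n) * V"
        unfolding V_def sum_distrib_left by (rule sum.cong) (auto simp: xc)
      then show ?thesis by (subst sum.remove[of _ i]) (auto simp: xi w_def)
    qed
    have 2: "(\<Sum>c\<in>UNIV. x $ c * v $ c) = n / r * w + 1 / (r * n) * T"
    proof -
      have "(\<Sum>c\<in>UNIV - {i}. x $ c * v $ c) = 1 / (r * n) * T"
        unfolding T_def sum_distrib_left by (rule sum.cong) (auto simp: xc)
      then show ?thesis by (subst sum.remove[of _ i]) (auto simp: xi w_def)
    qed
    have 3: "(\<Sum>c\<in>UNIV. (v $ c)\<^sup>2) = w\<^sup>2 + V"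
      unfolding V_def w_def by (rule sum.remove) auto
    have cs: "T\<^sup>2 \<le> n * V"
    proof -
      have "T\<^sup>2 \<le> (\<Sum>c\<in>UNIV - {i}. 1\<^sup>2) * (\<Sum>c\<in>UNIV - {i}. (v $ c)\<^sup>2)"
        using Cauchy_Schwarz_ineq_sum[of "\<lambda>c. 1" "\<lambda>c. v $ c" "UNIV - {i}"] by (simp add: T_def)
      moreover have "(\<Sum>c\<in>UNIV - {i}. 1\<^sup>2) = n"
        using q by (simp add: card_Diff_singleton of_nat_diff n_def r_def)
      ultimately show ?thesis by (simp add: V_def)
    qed
    \<comment> \<open>Multiplied out, the deficit is a square plus a multiple of the Cauchy-Schwarz
      deficit of the n = q - 1 equal coordinates.\<close>
    have id: "r\<^sup>2 * n\<^sup>2 * ((w\<^sup>2 + V) / r - ?v)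
      = n\<^sup>2 * (w + T)\<^sup>2 + (n\<^sup>2 - 1) * (n * V - T\<^sup>2)"
    proof -
      have "r\<^sup>2 * n\<^sup>2 * ((w\<^sup>2 + V) / r - ?v)
        = r * n\<^sup>2 * (w\<^sup>2 + V) - (r * n ^ 3 * w\<^sup>2 + r * n * V - (n\<^sup>2 * w + T)\<^sup>2)"
      proof -
        have a: "r\<^sup>2 * n\<^sup>2 * ((w\<^sup>2 + V) / r) = r * n\<^sup>2 * (w\<^sup>2 + V)"
          using n by (simp add: power2_eq_square)
        have b: "r\<^sup>2 * n\<^sup>2 * (n / r * w\<^sup>2) = r * n ^ 3 * w\<^sup>2"
          using n by (simp add: power2_eq_square power3_eq_cube)
        have c: "r\<^sup>2 * n\<^sup>2 * (1 / (r * n) * V) = r * n * V"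
          using n by (simp add: power2_eq_square)
        have "r * n * (n / r * w + 1 / (r * n) * T) = n\<^sup>2 * w + T"
          using n by (simp add: distrib_left power2_eq_square)
        then have d: "r\<^sup>2 * n\<^sup>2 * (n / r * w + 1 / (r * n) * T)\<^sup>2 = (n\<^sup>2 * w + T)\<^sup>2"
          by (simp only: power_mult_distrib[symmetric])
        show ?thesis by (simp only: right_diff_distrib distrib_left[of "r\<^sup>2 * n\<^sup>2"] a b c d)
      qed
      then show ?thesis unfolding n(2)
        by (simp add: power2_eq_square power3_eq_cube algebra_simps)
    qed
    have "0 \<le> n\<^sup>2 * (w + T)\<^sup>2 + (n\<^sup>2 - 1) * (n * V - T\<^sup>2)"
      using cs n one_le_power[of n 2] by (intro add_nonneg_nonneg mult_nonneg_nonneg) auto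
    moreover have "r\<^sup>2 * n\<^sup>2 > 0" using n by simp
    ultimately have "0 \<le> (w\<^sup>2 + V) / r - ?v"
      unfolding id[symmetric] by (simp add: zero_le_mult_iff)
    then show ?thesis unfolding 1 2 3 r_def[symmetric] by linarith
  qed
qed

text \<open>After centring, the values are at most 2 \<rho> in modulus, so
  \<open>exp_le_quadratic\<close> gives the coefficient (1 + 2 \<rho>) / 2; the linear term has mean
  zero.\<close>

lemma mgf_le_exp_variance:
  fixes x h :: "'q::finite \<Rightarrow> real"
  assumes x: "\<And>c. 0 \<le> x c" "(\<Sum>c\<in>UNIV. x c) = 1" and h: "\<And>c. \<bar>h c\<bar> \<le> \<rho>" and \<rho>: "\<rho> \<le> 1 / 2"
  defines "\<mu> \<equiv> \<Sum>c\<in>UNIV. x c * h c"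
  shows "(\<Sum>c\<in>UNIV. x c * exp (h c)) \<le> exp (\<mu> + (1 / 2 + \<rho>) * ((\<Sum>c\<in>UNIV. x c * (h c)\<^sup>2) - \<mu>\<^sup>2))"
proof -
  have mu: "\<bar>\<mu>\<bar> \<le> \<rho>"
  proof -
    have "\<bar>\<mu>\<bar> \<le> (\<Sum>c\<in>UNIV. x c * \<rho>)" unfolding \<mu>_def
      by (rule order_trans[OF sum_abs]) (auto simp: abs_mult x(1) intro!: sum_mono mult_left_mono h)
    then show ?thesis by (simp add: sum_distrib_right[symmetric] x(2))
  qed
  define var where "var = (\<Sum>c\<in>UNIV. x c * (h c - \<mu>)\<^sup>2)"
  have var: "var = (\<Sum>c\<in>UNIV. x c * (h c)\<^sup>2) - \<mu>\<^sup>2"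
  proof -
    have "var = (\<Sum>c\<in>UNIV. x c * (h c)\<^sup>2 - 2 * \<mu> * (x c * h c) + \<mu>\<^sup>2 * x c)"
      unfolding var_def by (rule sum.cong) (auto simp: power2_diff algebra_simps)
    also have "\<dots> = (\<Sum>c\<in>UNIV. x c * (h c)\<^sup>2) - 2 * \<mu> * \<mu> + \<mu>\<^sup>2 * 1"
      unfolding sum.distrib sum_subtractf sum_distrib_left[symmetric] x(2) \<mu>_def[symmetric] ..
    finally show ?thesis by (simp add: power2_eq_square)
  qed
  have "(\<Sum>c\<in>UNIV. x c * exp (h c - \<mu>)) \<le> (\<Sum>c\<in>UNIV. x c * (1 + (h c - \<mu>) + (1 / 2 + \<rho>) * (h c - \<mu>)\<^sup>2))"
  proof (intro sum_mono mult_left_mono x)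
    fix c
    have b: "\<bar>h c - \<mu>\<bar> \<le> 2 * \<rho>" using h[of c] mu by linarith
    then have "exp (h c - \<mu>) \<le> 1 + (h c - \<mu>) + (1 + \<bar>h c - \<mu>\<bar>) / 2 * (h c - \<mu>)\<^sup>2"
      using \<rho> by (intro exp_le_quadratic) linarith
    also have "\<dots> \<le> 1 + (h c - \<mu>) + (1 / 2 + \<rho>) * (h c - \<mu>)\<^sup>2"
      using b by (intro add_left_mono mult_right_mono) auto
    finally show "exp (h c - \<mu>) \<le> 1 + (h c - \<mu>) + (1 / 2 + \<rho>) * (h c - \<mu>)\<^sup>2" .
  qed
  also have "\<dots> = (\<Sum>c\<in>UNIV. x c + (x c * h c - \<mu> * x c) + (1 / 2 + \<rho>) * (x c * (h c - \<mu>)\<^sup>2))"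
    by (rule sum.cong) (auto simp: algebra_simps)
  also have "\<dots> = 1 + (\<mu> - \<mu> * 1) + (1 / 2 + \<rho>) * var"
    unfolding sum.distrib sum_subtractf sum_distrib_left[symmetric] x(2) \<mu>_def[symmetric] var_def ..
  also have "\<dots> \<le> exp ((1 / 2 + \<rho>) * var)" using exp_ge_add_one_self[of "(1 / 2 + \<rho>) * var"] by simp
  finally have "exp \<mu> * (\<Sum>c\<in>UNIV. x c * exp (h c - \<mu>)) \<le> exp \<mu> * exp ((1 / 2 + \<rho>) * var)"
    by (intro mult_left_mono) auto
  moreover have "exp \<mu> * (\<Sum>c\<in>UNIV. x c * exp (h c - \<mu>)) = (\<Sum>c\<in>UNIV. x c * exp (h c))"
    unfolding sum_distrib_left by (rule sum.cong) (auto simp: exp_diff)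
  ultimately show ?thesis by (simp only: exp_add var)
qed

text \<open>A discrete substitute for the Hubbard--Stratonovich identity: the Gaussian integral
  linearising \<open>exp (\<kappa> t\<^sup>2 / 2)\<close> is replaced by a sum over integers \<open>j\<close>, the term with
  \<open>j\<close> next to \<open>t\<close> being large enough.\<close>

lemma exp_square_le_sum:
  fixes t \<kappa> :: real
  assumes \<kappa>: "\<kappa> \<ge> 0" and t: "\<bar>t\<bar> + 1 \<le> real K"
  shows "exp (\<kappa> / 2 * t\<^sup>2) \<le> exp (\<kappa> / 2) * (\<Sum>j\<in>{- int K..int K}. exp (\<kappa> * real_of_int j * t - \<kappa> / 2 * (real_of_int j)\<^sup>2))"
proof -
  define j where "j = \<lfloor>t\<rfloor>"
  have j: "real_of_int j \<le> t" "t < real_of_int j + 1" unfolding j_def by linarith+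
  have jK: "j \<in> {- int K..int K}" using j t by (simp add: abs_le_iff) linarith
  \<comment> \<open>The distance to the floor is at most 1, which is the origin of the loss
    \<open>exp (\<kappa> / 2)\<close>.\<close>
  have "(t - real_of_int j)\<^sup>2 \<le> 1" using j by (intro power_le_one) auto
  then have "\<kappa> / 2 * (t - real_of_int j)\<^sup>2 \<le> \<kappa> / 2 * 1" using \<kappa> by (intro mult_left_mono) auto
  then have "\<kappa> / 2 * t\<^sup>2 \<le> \<kappa> / 2 + (\<kappa> * real_of_int j * t - \<kappa> / 2 * (real_of_int j)\<^sup>2)"
    by (simp add: power2_diff algebra_simps)
  then have "exp (\<kappa> / 2 * t\<^sup>2) \<le> exp (\<kappa> / 2) * exp (\<kappa> * real_of_int j * t - \<kappa> / 2 * (real_of_int j)\<^sup>2)"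
    by (simp only: exp_add[symmetric] exp_le_cancel_iff)
  also have "\<dots> \<le> exp (\<kappa> / 2) * (\<Sum>j\<in>{- int K..int K}. exp (\<kappa> * real_of_int j * t - \<kappa> / 2 * (real_of_int j)\<^sup>2))"
    using jK by (intro mult_left_mono member_le_sum) auto
  finally show ?thesis .
qed

text \<open>Completing the square with b + 1 in place of b leaves a spare factor exp (- |j|), whose
  sum is bounded independently of \<open>K\<close>.\<close>

lemma gaussian_sum_bounded:
  fixes c b :: real
  assumes c: "c > 0"
  shows "(\<Sum>j\<in>{- int K..int K}. exp (b * \<bar>real_of_int j\<bar> - c * (real_of_int j)\<^sup>2)) \<le> 3 * exp ((b + 1)\<^sup>2 / (4 * c))"
proof -
  define E where "E = exp ((b + 1)\<^sup>2 / (4 * c))"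
  have "exp (b * \<bar>real_of_int j\<bar> - c * (real_of_int j)\<^sup>2) \<le> E * exp (- \<bar>real_of_int j\<bar>)" for j
  proof -
    define y where "y = \<bar>real_of_int j\<bar>"
    have "0 \<le> c * (y - (b + 1) / (2 * c))\<^sup>2" using c by simp
    also have "c * (y - (b + 1) / (2 * c))\<^sup>2 = c * y\<^sup>2 - (b + 1) * y + (b + 1)\<^sup>2 / (4 * c)"
    proof -
      define e where "e = (b + 1) / (2 * c)"
      have ce: "c * e = (b + 1) / 2" using c by (simp add: e_def)
      have "c * (y - e)\<^sup>2 = c * y\<^sup>2 - 2 * (c * e) * y + (c * e) * e"
        by (simp add: power2_eq_square algebra_simps)
      also have "(c * e) * e = (b + 1)\<^sup>2 / (4 * c)" unfolding ce by (simp add: e_def power2_eq_square)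
      also have "2 * (c * e) * y = (b + 1) * y" unfolding ce by simp
      finally show ?thesis by (simp add: e_def)
    qed
    finally have "b * y - c * y\<^sup>2 \<le> (b + 1)\<^sup>2 / (4 * c) + - y" by (simp add: distrib_right)
    then have "exp (b * y - c * y\<^sup>2) \<le> E * exp (- y)"
      unfolding E_def by (simp only: exp_add[symmetric] exp_le_cancel_iff)
    then show ?thesis by (simp add: y_def)
  qed
  then have "(\<Sum>j\<in>{- int K..int K}. exp (b * \<bar>real_of_int j\<bar> - c * (real_of_int j)\<^sup>2))
      \<le> E * (\<Sum>j\<in>{- int K..int K}. exp (- \<bar>real_of_int j\<bar>))"
    unfolding sum_distrib_left by (intro sum_mono)
  \<comment> \<open>The subtracted term makes the induction close: a step adds twice e^(- K - 1),
    and e^(- 1) \<le> 1/2.\<close>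
  moreover have "(\<Sum>j\<in>{- int K..int K}. exp (- \<bar>real_of_int j\<bar>)) \<le> 3 - 2 * exp (- 1) ^ K"
  proof (induction K)
    case (Suc K)
    have "{- int (Suc K)..int (Suc K)} = insert (- int (Suc K)) (insert (int (Suc K)) {- int K..int K})" by auto
    then have "(\<Sum>j\<in>{- int (Suc K)..int (Suc K)}. exp (- \<bar>real_of_int j\<bar>))
       = 2 * exp (- real (Suc K)) + (\<Sum>j\<in>{- int K..int K}. exp (- \<bar>real_of_int j\<bar>))" by simp
    also have "exp (- real (Suc K)) = exp (- 1) ^ Suc K" by (simp only: exp_of_nat_mult[symmetric]) simp
    also have "2 * exp (- 1) ^ Suc K + (\<Sum>j\<in>{- int K..int K}. exp (- \<bar>real_of_int j\<bar>))
       \<le> 3 - 2 * exp (- 1) ^ K + 2 * (exp (- 1) * exp (- 1) ^ K)" using Suc by simp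
    also have "\<dots> \<le> 3 - 2 * exp (- 1) ^ Suc K"
    proof -
      have "exp (- 1 :: real) \<le> 1 / 2"
        using exp_ge_add_one_self[of "1::real"] by (simp add: exp_minus inverse_eq_divide field_simps)
      then have "exp (- 1) * exp (- 1) ^ K \<le> 1 / 2 * exp (- 1 :: real) ^ K" by (intro mult_right_mono) auto
      then show ?thesis by simp
    qed
    finally show ?case .
  qed simp
  then have "E * (\<Sum>j\<in>{- int K..int K}. exp (- \<bar>real_of_int j\<bar>)) \<le> E * 3"
  proof -
    assume "(\<Sum>j\<in>{- int K..int K}. exp (- \<bar>real_of_int j\<bar>)) \<le> 3 - 2 * exp (- 1) ^ K"
    moreover have "0 \<le> exp (- 1 :: real) ^ K" by simp
    ultimately have "(\<Sum>j\<in>{- int K..int K}. exp (- \<bar>real_of_int j\<bar>)) \<le> 3" by linarith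
    then show ?thesis by (intro mult_left_mono) (auto simp: E_def)
  qed
  ultimately have "(\<Sum>j\<in>{- int K..int K}. exp (b * \<bar>real_of_int j\<bar> - c * (real_of_int j)\<^sup>2)) \<le> E * 3"
    by linarith
  then show ?thesis by (simp add: E_def mult.commute)
qed

lemma sum_UNIV_prod:
  fixes F :: "'a::finite \<Rightarrow> 'b::finite \<Rightarrow> real"
  shows "(\<Sum>p\<in>UNIV. F (fst p) (snd p)) = (\<Sum>k\<in>UNIV. \<Sum>c\<in>UNIV. F k c)"
  by (simp add: sum.cartesian_product split_def)

section \<open>Sharp bound for the Gibbs mass near a minimizer\<close>

context block_spin_potts
begin

text \<open>Each block contributes a quadratic term controlled by its variance and the linear error
  (n - N/s) \<mu>. Since the field is \<open>\<kappa> * f p / sqrt (real N)\<close>, the deviation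
  hypothesis bounds the linear error by \<open>C0 * \<kappa> * \<bar>f p\<bar>\<close> summed over
  the colours, without growth in N.\<close>

lemma centred_mgf_le:
  fixes x :: "real ^ 'q::finite" and f :: "'s \<times> 'q \<Rightarrow> real"
  assumes x: "x \<in> potts_minimizers g" and N: "N > 0"
    and var: "\<And>v :: real ^ 'q. (\<Sum>c\<in>UNIV. x $ c * (v $ c)\<^sup>2) - (\<Sum>c\<in>UNIV. x $ c * v $ c)\<^sup>2
      \<le> (\<Sum>c\<in>UNIV. (v $ c)\<^sup>2) / real CARD('q)"
    and \<kappa>: "\<kappa> \<ge> 0" and \<rho>: "0 \<le> \<rho>" "\<rho> \<le> 1 / 2"
    and f: "\<And>p. \<kappa> * \<bar>f p\<bar> / sqrt (real N) \<le> \<rho>"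
    and dev: "\<And>k. \<bar>block_dev N k\<bar> \<le> C0 * sqrt (real N)"
    and card: "\<And>k. real (card (S N k)) \<le> (1 + \<rho>) * (real N / real CARD('s))"
  shows "(\<Sum>\<omega>\<in>configs N. product_weight (S N) x \<omega> *
      exp (\<Sum>p\<in>UNIV. \<kappa> * f p * (sqrt (real N) * (mag N \<omega> - constant_rows x) $ fst p $ snd p)))
    \<le> exp (\<Sum>p\<in>UNIV. C0 * \<kappa> * \<bar>f p\<bar>
        + (1 / 2 + \<rho>) * (1 + \<rho>) * \<kappa>\<^sup>2 / (real CARD('s) * real CARD('q)) * (f p)\<^sup>2)"
proof -
  let ?y = "\<lambda>\<omega>. mag N \<omega> - constant_rows x"
  define s q R where "s = real CARD('s)" and "q = real CARD('q)" and "R = sqrt (real N)"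
  have R: "R > 0" "R * R = real N" using N by (auto simp: R_def)
  have s: "s > 0" and q: "q > 0" by (simp_all add: s_def q_def)
  have C0: "C0 \<ge> 0"
  proof -
    have "0 \<le> C0 * R" using order_trans[OF abs_ge_zero dev] by (simp add: R_def)
    then show ?thesis using R(1) by (simp add: zero_le_mult_iff)
  qed
  have xpos: "0 \<le> x $ c" for c using potts_minimizer_pos[OF g_pos x, of c] by simp
  have xsum: "(\<Sum>c\<in>UNIV. x $ c) = 1" by (rule potts_minimizer_sum[OF g_pos x])
  have xle: "x $ c \<le> 1" for c
    using member_le_sum[of c UNIV "\<lambda>c. x $ c"] xpos xsum by simp
  define h where "h k c = \<kappa> * f (k, c) / R" for k c
  define \<mu> where "\<mu> k = (\<Sum>c\<in>UNIV. x $ c * h k c)" for k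
  define T where "T = (1 / 2 + \<rho>) * (1 + \<rho>) * \<kappa>\<^sup>2 / (s * q)"
  let ?\<psi> = "\<lambda>p. C0 * \<kappa> * \<bar>f p\<bar> + T * (f p)\<^sup>2"
  have habs: "\<bar>h k c\<bar> = \<kappa> * \<bar>f (k, c)\<bar> / R" for k c
    using \<kappa> R by (simp add: h_def abs_mult)
  have lin: "(\<Sum>p\<in>UNIV. \<kappa> * f p * (R * ?y \<omega> $ fst p $ snd p))
     = real N * pairing h (mag N \<omega>)
       - real N / s * (\<Sum>k\<in>UNIV. \<mu> k)" for \<omega>
  proof -
    have Nh: "real N * h k c = \<kappa> * f (k, c) * R" for k c
      using R by (simp add: h_def R(2)[symmetric])
    have "(\<Sum>p\<in>UNIV. \<kappa> * f p * (R * ?y \<omega> $ fst p $ snd p))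
      = (\<Sum>k\<in>UNIV. \<Sum>c\<in>UNIV. \<kappa> * f (k, c) * (R * ?y \<omega> $ k $ c))"
      using sum_UNIV_prod[of "\<lambda>k c. \<kappa> * f (k, c) * (R * ?y \<omega> $ k $ c)"]
      by simp
    also have "\<dots> = (\<Sum>k\<in>UNIV. \<Sum>c\<in>UNIV. real N * (h k c * mag N \<omega> $ k $ c) - real N / s * (x $ c * h k c))"
    proof (intro sum.cong refl)
      fix k c
      have "\<kappa> * f (k, c) * (R * ?y \<omega> $ k $ c)
        = (real N * h k c) * (mag N \<omega> $ k $ c - x $ c / s)"
        unfolding Nh by (simp add: constant_rows_def s_def mult.assoc)
      then show "\<kappa> * f (k, c) * (R * ?y \<omega> $ k $ c)
        = real N * (h k c * mag N \<omega> $ k $ c) - real N / s * (x $ c * h k c)"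
        by (simp add: right_diff_distrib mult_ac)
    qed
    finally show ?thesis unfolding sum_subtractf sum_distrib_left[symmetric] \<mu>_def .
  qed
  have "(\<Sum>\<omega>\<in>configs N. product_weight (S N) x \<omega> *
      exp (\<Sum>p\<in>UNIV. \<kappa> * f p * (R * ?y \<omega> $ fst p $ snd p)))
    = (\<Sum>\<omega>\<in>configs N. exp (- (real N / s * (\<Sum>k\<in>UNIV. \<mu> k))) * (product_weight (S N) x \<omega> *
      exp (real N * pairing h (mag N \<omega>))))"
    unfolding lin by (intro sum.cong refl) (simp add: exp_diff exp_minus divide_inverse mult_ac)
  also have "\<dots> = exp (- (real N / s * (\<Sum>k\<in>UNIV. \<mu> k))) *
      (\<Prod>k\<in>UNIV. (\<Sum>c\<in>UNIV. x $ c * exp (h k c)) ^ card (S N k))"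
    unfolding sum_distrib_left[symmetric] sum_configs_mgf[OF blocks N] ..
  also have "\<dots> \<le> exp (- (real N / s * (\<Sum>k\<in>UNIV. \<mu> k))) *
      (\<Prod>k\<in>UNIV. exp (real N / s * \<mu> k + (\<Sum>c\<in>UNIV. ?\<psi> (k, c))))"
  proof (intro mult_left_mono prod_mono conjI)
    fix k
    define n where "n = real (card (S N k))"
    define B where "B = (\<Sum>c\<in>UNIV. (h k c)\<^sup>2) / q"
    have B: "B \<ge> 0" using q by (simp add: B_def sum_nonneg)
    show "0 \<le> (\<Sum>c\<in>UNIV. x $ c * exp (h k c)) ^ card (S N k)"
      using xpos by (intro zero_le_power sum_nonneg mult_nonneg_nonneg) auto
    have "(\<Sum>c\<in>UNIV. x $ c * exp (h k c)) \<le> exp (\<mu> k + (1 / 2 + \<rho>) * ((\<Sum>c\<in>UNIV. x $ c * (h k c)\<^sup>2) - (\<mu> k)\<^sup>2))"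
      unfolding \<mu>_def using f \<rho> xpos xsum
      by (intro mgf_le_exp_variance) (auto simp: habs R_def)
    also have "\<dots> \<le> exp (\<mu> k + (1 / 2 + \<rho>) * B)"
    proof -
      have "(\<Sum>c\<in>UNIV. x $ c * (h k c)\<^sup>2) - (\<mu> k)\<^sup>2 \<le> B"
        using var[of "\<chi> c. h k c"] by (simp add: \<mu>_def B_def q_def)
      then have "(1 / 2 + \<rho>) * ((\<Sum>c\<in>UNIV. x $ c * (h k c)\<^sup>2) - (\<mu> k)\<^sup>2) \<le> (1 / 2 + \<rho>) * B"
        using \<rho> by (intro mult_left_mono) auto
      then show ?thesis by simp
    qed
    finally have "(\<Sum>c\<in>UNIV. x $ c * exp (h k c)) ^ card (S N k) \<le> exp (\<mu> k + (1 / 2 + \<rho>) * B) ^ card (S N k)"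
      using xpos by (intro power_mono sum_nonneg mult_nonneg_nonneg) auto
    also have "\<dots> = exp (n * (\<mu> k + (1 / 2 + \<rho>) * B))" by (simp only: n_def exp_of_nat_mult)
    also have "\<dots> \<le> exp (real N / s * \<mu> k + (\<Sum>c\<in>UNIV. ?\<psi> (k, c)))"
    proof -
      have "(n - real N / s) * \<mu> k \<le> \<bar>n - real N / s\<bar> * \<bar>\<mu> k\<bar>"
        unfolding abs_mult[symmetric] by (rule abs_ge_self)
      also have "\<dots> \<le> (C0 * R) * (\<Sum>c\<in>UNIV. \<bar>h k c\<bar>)"
      proof (intro mult_mono)
        show "\<bar>n - real N / s\<bar> \<le> C0 * R" using dev[of k] by (simp add: n_def s_def R_def)
        have "\<bar>\<mu> k\<bar> \<le> (\<Sum>c\<in>UNIV. \<bar>x $ c * h k c\<bar>)" unfolding \<mu>_def by (rule sum_abs)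
        also have "\<dots> \<le> (\<Sum>c\<in>UNIV. \<bar>h k c\<bar>)"
          using xpos xle by (intro sum_mono) (simp add: abs_mult mult_left_le_one_le)
        finally show "\<bar>\<mu> k\<bar> \<le> (\<Sum>c\<in>UNIV. \<bar>h k c\<bar>)" .
      qed (use C0 R in auto)
      also have "\<dots> = (\<Sum>c\<in>UNIV. C0 * \<kappa> * \<bar>f (k, c)\<bar>)"
        unfolding sum_distrib_left habs using R by (intro sum.cong) auto
      finally have 1: "(n - real N / s) * \<mu> k \<le> (\<Sum>c\<in>UNIV. C0 * \<kappa> * \<bar>f (k, c)\<bar>)" .
      have "n * ((1 / 2 + \<rho>) * B) \<le> ((1 + \<rho>) * (real N / s)) * ((1 / 2 + \<rho>) * B)"
        using card[of k] \<rho> B by (intro mult_right_mono) (auto simp: n_def s_def)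
      also have "\<dots> = (\<Sum>c\<in>UNIV. T * (f (k, c))\<^sup>2)"
      proof -
        have "B = (\<Sum>c\<in>UNIV. \<kappa>\<^sup>2 / (real N * q) * (f (k, c))\<^sup>2)"
          unfolding B_def sum_divide_distrib h_def using R
          by (intro sum.cong refl) (simp add: power_divide power_mult_distrib power2_eq_square)
        then have "B = \<kappa>\<^sup>2 / (real N * q) * (\<Sum>c\<in>UNIV. (f (k, c))\<^sup>2)" by (simp only: sum_distrib_left)
        then show ?thesis unfolding sum_distrib_left[symmetric] T_def using N by (simp add: mult_ac)
      qed
      finally have 2: "n * ((1 / 2 + \<rho>) * B) \<le> (\<Sum>c\<in>UNIV. T * (f (k, c))\<^sup>2)" .
      have "n * (\<mu> k + (1 / 2 + \<rho>) * B) = real N / s * \<mu> k + (n - real N / s) * \<mu> k + n * ((1 / 2 + \<rho>) * B)"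
        by (simp add: algebra_simps)
      then show ?thesis unfolding exp_le_cancel_iff sum.distrib using 1 2 by linarith
    qed
    finally show "(\<Sum>c\<in>UNIV. x $ c * exp (h k c)) ^ card (S N k)
      \<le> exp (real N / s * \<mu> k + (\<Sum>c\<in>UNIV. ?\<psi> (k, c)))" .
  qed simp
  also have "\<dots> = exp (\<Sum>k\<in>UNIV. \<Sum>c\<in>UNIV. ?\<psi> (k, c))"
    unfolding exp_sum[OF finite, symmetric] exp_add[symmetric] sum.distrib[of "\<lambda>k. real N / s * \<mu> k"]
      sum_distrib_left[symmetric] by simp
  also have "(\<Sum>k\<in>UNIV. \<Sum>c\<in>UNIV. ?\<psi> (k, c))
    = (\<Sum>p\<in>UNIV. ?\<psi> p)"
    using sum_UNIV_prod[of "\<lambda>k c. ?\<psi> (k, c)"] by simp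
  finally show ?thesis by (simp only: R_def T_def s_def q_def)
qed

text \<open>Linearisation brings in Gaussian weights with coefficient \<kappa>/2, and averaging over
  configurations gives back at most \<open>T\<close>. Because T < \<kappa>/2, the sum over integers
  stays bounded in N.\<close>

lemma local_mass_bounded:
  fixes x :: "real ^ 'q::finite"
  assumes x: "x \<in> potts_minimizers g"
    and var: "\<And>v :: real ^ 'q. (\<Sum>c\<in>UNIV. x $ c * (v $ c)\<^sup>2) - (\<Sum>c\<in>UNIV. x $ c * v $ c)\<^sup>2
      \<le> (\<Sum>c\<in>UNIV. (v $ c)\<^sup>2) / real CARD('q)"
    and gq: "g < real CARD('q)"
    and dev: "\<forall>\<^sub>F N in sequentially. \<forall>k. \<bar>block_dev N k\<bar> \<le> C0 * sqrt (real N)"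
  obtains \<delta> C where "\<delta> > 0" "C \<ge> 0"
    "\<forall>\<^sub>F N in sequentially. mass N {m. \<forall>k c. \<bar>(m - constant_rows x) $ k $ c\<bar> < \<delta>} \<le> C * exp (- real N * free_energy g x)"
proof -
  define s q where "s = real CARD('s)" and "q = real CARD('q)"
  have s: "s > 0" and q: "q > 0" by (simp_all add: s_def q_def)
  define d where "d = CARD('s \<times> 'q)"
  define \<kappa> where "\<kappa> = g * s"
  have \<kappa>: "\<kappa> > 0" using g_pos s by (simp add: \<kappa>_def)
  \<comment> \<open>Chosen so that g (1 + \<rho>) (1 + 2 \<rho>) \<le> g (1 + 4 \<rho>) < q, which
    gives c > 0; the cap 1/2 meets the requirement of \<open>mgf_le_exp_variance\<close>.\<close>
  define \<rho> where "\<rho> = min (1 / 2) ((q - g) / (8 * g))"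
  have \<rho>: "0 < \<rho>" "\<rho> \<le> 1 / 2" using gq g_pos by (auto simp: \<rho>_def q_def)
  \<comment> \<open>The integers used reach about R \<delta>, so the fields reach about \<kappa>
    \<delta> = \<rho>/2; the other half of \<rho> covers rounding once sqrt N \<ge> 4 \<kappa> /
    \<rho>.\<close>
  define \<delta> where "\<delta> = \<rho> / (2 * \<kappa>)"
  have \<delta>: "\<delta> > 0" using \<rho> \<kappa> by (simp add: \<delta>_def)
  define b where "b = C0 * \<kappa>"
  define T where "T = (1 / 2 + \<rho>) * (1 + \<rho>) * \<kappa>\<^sup>2 / (s * q)"
  define c where "c = \<kappa> / 2 - T"
  have c: "c > 0"
  proof -
    have "(1 + \<rho>) * (1 + 2 * \<rho>) = 1 + 3 * \<rho> + 2 * \<rho> * \<rho>" by (simp add: algebra_simps)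
    also have "\<dots> \<le> 1 + 4 * \<rho>" using \<rho> mult_right_mono[of \<rho> "1 / 2" \<rho>] by simp
    finally have "g * ((1 + \<rho>) * (1 + 2 * \<rho>)) \<le> g * (1 + 4 * \<rho>)" using g_pos by (intro mult_left_mono) auto
    also have "\<dots> < q"
    proof -
      have "\<rho> \<le> (q - g) / (8 * g)" by (simp add: \<rho>_def)
      then have "8 * g * \<rho> \<le> q - g" using g_pos by (simp add: pos_le_divide_eq mult.commute)
      moreover have "g < q" using gq by (simp add: q_def)
      ultimately have "4 * (g * \<rho>) < q - g" by linarith
      then show ?thesis by (simp add: algebra_simps)
    qed
    finally have "g * ((1 + \<rho>) * (1 + 2 * \<rho>)) / q < 1" using q by simp
    then have "\<kappa> / 2 * (g * ((1 + \<rho>) * (1 + 2 * \<rho>)) / q) < \<kappa> / 2 * 1"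
      using \<kappa> by (intro mult_strict_left_mono) auto
    moreover have "T = \<kappa> / 2 * (g * ((1 + \<rho>) * (1 + 2 * \<rho>)) / q)"
    proof -
      have "T = (1 / 2 + \<rho>) * (1 + \<rho>) * (\<kappa> * (g * s)) / (s * q)"
        by (simp add: T_def \<kappa>_def power2_eq_square)
      also have "\<dots> = (1 / 2 + \<rho>) * (1 + \<rho>) * (\<kappa> * g) / q" using s by simp
      finally show ?thesis by (simp add: algebra_simps add_divide_distrib)
    qed
    ultimately show ?thesis by (simp add: c_def)
  qed
  define D where "D = 3 * exp ((b + 1)\<^sup>2 / (4 * c))"
  define C where "C = exp (\<kappa> / 2) ^ d * D ^ d"
  define V where "V = {m :: real ^ 'q ^ 's. \<forall>k c. \<bar>(m - constant_rows x) $ k $ c\<bar> < \<delta>}"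
  define G where "G = free_energy g x"
  have xpos: "0 \<le> x $ c" for c using potts_minimizer_pos[OF g_pos x, of c] by simp
  have "\<forall>\<^sub>F N in sequentially. imbalance N < \<rho> / s"
    using imbalance_tendsto_0 \<rho> s by (intro order_tendstoD(2)) auto
  moreover have "\<forall>\<^sub>F N in sequentially. sqrt (real N) \<ge> 4 * \<kappa> / \<rho>"
    using filterlim_compose[OF sqrt_at_top filterlim_real_sequentially]
    unfolding filterlim_at_top by blast
  ultimately have "\<forall>\<^sub>F N in sequentially. mass N V \<le> C * exp (- real N * G)"
    using dev eventually_gt_at_top[of 0]
  proof eventually_elim
    case (elim N)
    define R where "R = sqrt (real N)"
    have R: "R > 0" "R\<^sup>2 = real N" using elim(4) by (auto simp: R_def)
    define K where "K = nat \<lceil>R * \<delta>\<rceil> + 1"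
    have K: "R * \<delta> + 1 \<le> real K" "real K \<le> R * \<delta> + 2"
    proof -
      have "0 \<le> R * \<delta>" using R \<delta> by simp
      then have "real (nat \<lceil>R * \<delta>\<rceil>) = real_of_int \<lceil>R * \<delta>\<rceil>" by simp
      then show "R * \<delta> + 1 \<le> real K" "real K \<le> R * \<delta> + 2" unfolding K_def by linarith+
    qed
    define J where "J = {- int K..int K}"
    define Fs where "Fs = (UNIV :: ('s \<times> 'q) set) \<rightarrow>\<^sub>E J"
    let ?m = "\<lambda>\<omega>. mag N \<omega> - constant_rows x"
    let ?I = "\<lambda>\<omega>. interaction \<alpha> \<beta> (?m \<omega>)"
    define y where "y \<omega> p = ?m \<omega> $ fst p $ snd p" for \<omega> p
    let ?\<phi> = "\<lambda>\<omega> p j. exp (\<kappa> * real_of_int j * (R * y \<omega> p) - \<kappa> / 2 * (real_of_int j)\<^sup>2)"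
    let ?\<psi> = "\<lambda>j. b * \<bar>real_of_int j\<bar> + T * (real_of_int j)\<^sup>2"
    let ?\<chi> = "\<lambda>j. exp (b * \<bar>real_of_int j\<bar> - c * (real_of_int j)\<^sup>2)"
    define e where "e f \<omega> = exp (\<Sum>p\<in>UNIV. \<kappa> * real_of_int (f p) * (R * y \<omega> p))" for f \<omega>
    define w where "w f = (\<Prod>p\<in>UNIV. exp (- (\<kappa> / 2 * (real_of_int (f p))\<^sup>2)))" for f :: "'s \<times> 'q \<Rightarrow> int"
    have kRK: "\<kappa> * real K / R \<le> \<rho>"
    proof -
      have "\<kappa> * real K \<le> \<kappa> * (R * \<delta> + 2)" using K \<kappa> by (intro mult_left_mono) auto
      also have "\<dots> = R * (\<rho> / 2) + 2 * \<kappa>" using \<kappa> by (simp add: \<delta>_def algebra_simps)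
      also have "2 * \<kappa> \<le> R * (\<rho> / 2)" using elim(2) \<rho> by (simp add: R_def pos_divide_le_eq)
      finally have "\<kappa> * real K \<le> R * \<rho>" by simp
      then show ?thesis using R by (simp add: pos_divide_le_eq mult.commute)
    qed
    \<comment> \<open>The row spread enters with a negative sign and is dropped. The remaining
      squares are linearised entry by entry, and expanding the product gives one term for each
      choice \<open>f\<close> of an integer per matrix entry.\<close>
    have linearise: "exp (real N * ?I \<omega>)
      \<le> exp (\<kappa> / 2) ^ d * (\<Sum>f\<in>Fs. e f \<omega> * w f)"
      if "mag N \<omega> \<in> V" for \<omega>
    proof -
      have "?I \<omega>
        \<le> \<kappa> / 2 * sq_sum (?m \<omega>)"
        unfolding interaction_eq[OF g] \<kappa>_def s_def 
        using \<alpha> row_spread_nonneg[of "mag N \<omega> - constant_rows x"] by simp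
      also have "sq_sum (?m \<omega>)
        = (\<Sum>p\<in>UNIV. (y \<omega> p)\<^sup>2)"
        unfolding y_def by (rule sum_UNIV_prod[symmetric])
      finally have "real N * ?I \<omega>
        \<le> real N * (\<kappa> / 2 * (\<Sum>p\<in>UNIV. (y \<omega> p)\<^sup>2))" by (intro mult_left_mono) auto
      also have "\<dots> = (\<Sum>p\<in>UNIV. \<kappa> / 2 * (R * y \<omega> p)\<^sup>2)"
        by (simp add: sum_distrib_left power_mult_distrib R(2) mult_ac)
      finally have "exp (real N * ?I \<omega>)
        \<le> (\<Prod>p\<in>UNIV. exp (\<kappa> / 2 * (R * y \<omega> p)\<^sup>2))"
        unfolding exp_sum[OF finite, symmetric] by (simp only: exp_le_cancel_iff)
      also have "\<dots> \<le> (\<Prod>p\<in>UNIV. exp (\<kappa> / 2) *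
          (\<Sum>j\<in>J. ?\<phi> \<omega> p j))"
      proof (intro prod_mono conjI)
        fix p
        have "\<bar>y \<omega> p\<bar> < \<delta>" using that by (simp add: V_def y_def)
        then have "R * \<bar>y \<omega> p\<bar> \<le> R * \<delta>" using R by (intro mult_left_mono) auto
        moreover have "\<bar>R * y \<omega> p\<bar> = R * \<bar>y \<omega> p\<bar>" using R(1) by (simp only: abs_mult abs_of_pos)
        ultimately have "\<bar>R * y \<omega> p\<bar> + 1 \<le> real K" using K(1) by linarith
        then show "exp (\<kappa> / 2 * (R * y \<omega> p)\<^sup>2) \<le> exp (\<kappa> / 2) *
          (\<Sum>j\<in>J. ?\<phi> \<omega> p j)"
          unfolding J_def using \<kappa> by (intro exp_square_le_sum) auto
      qed simp
      also have "\<dots> = exp (\<kappa> / 2) ^ d *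
          (\<Prod>p\<in>UNIV. \<Sum>j\<in>J. ?\<phi> \<omega> p j)"
        unfolding prod.distrib by (simp add: d_def)
      also have "(\<Prod>p\<in>UNIV. \<Sum>j\<in>J. ?\<phi> \<omega> p j)
        = (\<Sum>f\<in>Fs. \<Prod>p\<in>UNIV. ?\<phi> \<omega> p (f p))"
        unfolding Fs_def by (rule prod_sum_PiE) (auto simp: J_def)
      also have "\<dots> = (\<Sum>f\<in>Fs. e f \<omega> * w f)"
        unfolding e_def w_def exp_sum[OF finite] prod.distrib[symmetric] exp_add[symmetric] by simp
      finally show ?thesis .
    qed
    have "mass N V = (\<Sum>\<omega> | \<omega> \<in> configs N \<and> mag N \<omega> \<in> V. exp (- real N * G) *
      product_weight (S N) x \<omega> * exp (real N * ?I \<omega>))"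
      unfolding config_mass_def G_def gibbs_weight_eq[OF blocks elim(4) g g_pos x] ..
    also have "\<dots> \<le> (\<Sum>\<omega> | \<omega> \<in> configs N \<and> mag N \<omega> \<in> V. exp (- real N * G) *
      product_weight (S N) x \<omega> * (exp (\<kappa> / 2) ^ d * (\<Sum>f\<in>Fs. e f \<omega> * w f)))"
      using linearise xpos by (intro sum_mono mult_left_mono mult_nonneg_nonneg product_weight_nonneg) auto
    also have "\<dots> \<le> (\<Sum>\<omega>\<in>configs N. exp (- real N * G) *
      product_weight (S N) x \<omega> * (exp (\<kappa> / 2) ^ d * (\<Sum>f\<in>Fs. e f \<omega> * w f)))"
      using xpos by (intro sum_mono2[OF finite_configs] mult_nonneg_nonneg product_weight_nonneg sum_nonneg)
        (auto simp: e_def w_def prod_nonneg)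
    also have "\<dots> = exp (- real N * G) * exp (\<kappa> / 2) ^ d *
      (\<Sum>f\<in>Fs. w f * (\<Sum>\<omega>\<in>configs N. product_weight (S N) x \<omega> * e f \<omega>))"
      unfolding sum_distrib_left
      by (subst sum.swap) (intro sum.cong refl, simp add: mult_ac)
    also have "\<dots> \<le> exp (- real N * G) * exp (\<kappa> / 2) ^ d *
      (\<Sum>f\<in>Fs. w f * exp (\<Sum>p\<in>UNIV. ?\<psi> (f p)))"
    proof (intro mult_left_mono sum_mono)
      fix f assume f: "f \<in> Fs"
      have fp: "\<bar>real_of_int (f p)\<bar> \<le> real K" for p
      proof -
        have "f p \<in> J" using f by (auto simp: Fs_def)
        then show ?thesis unfolding J_def by (simp add: abs_le_iff)
      qed
      show "(\<Sum>\<omega>\<in>configs N. product_weight (S N) x \<omega> * e f \<omega>)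
        \<le> exp (\<Sum>p\<in>UNIV. ?\<psi> (f p))"
        unfolding e_def b_def T_def R_def y_def s_def q_def
      proof (rule centred_mgf_le[OF x elim(4) var])
        show "\<kappa> * \<bar>real_of_int (f p)\<bar> / sqrt (real N) \<le> \<rho>" for p
        proof -
          have "\<kappa> * \<bar>real_of_int (f p)\<bar> / R \<le> \<kappa> * real K / R"
            using fp \<kappa> R by (intro divide_right_mono mult_left_mono) auto
          then show ?thesis using kRK by (simp add: R_def)
        qed
        show "real (card (S N k)) \<le> (1 + \<rho>) * (real N / real CARD('s))" for k
        proof -
          have "\<bar>real (card (S N k)) / real N - 1 / s\<bar> \<le> \<rho> / s"
            using block_deviation_le_imbalance[of N k] elim(1) by (simp add: s_def)
          then have "real (card (S N k)) / real N \<le> (1 + \<rho>) / s" by (simp add: add_divide_distrib abs_le_iff)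
          then show ?thesis using elim(4) by (simp add: s_def pos_divide_le_eq)
        qed
      qed (use \<kappa> \<rho> elim(3) in auto)
    qed (auto simp: w_def prod_nonneg)
    also have "(\<Sum>f\<in>Fs. w f * exp (\<Sum>p\<in>UNIV. ?\<psi> (f p)))
      = (\<Sum>f\<in>Fs. \<Prod>p\<in>UNIV. ?\<chi> (f p))"
      unfolding w_def exp_sum[OF finite] prod.distrib[symmetric] exp_add[symmetric]
      by (simp add: c_def algebra_simps)
    also have "\<dots> = (\<Prod>p\<in>(UNIV :: ('s \<times> 'q) set). \<Sum>j\<in>J. ?\<chi> j)"
      unfolding Fs_def by (rule prod_sum_PiE[symmetric]) (auto simp: J_def)
    also have "\<dots> = (\<Sum>j\<in>J. ?\<chi> j) ^ d"
      by (simp add: d_def)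
    also have "exp (- real N * G) * exp (\<kappa> / 2) ^ d * \<dots> \<le> exp (- real N * G) * exp (\<kappa> / 2) ^ d * D ^ d"
      unfolding D_def J_def using c by (intro mult_left_mono power_mono gaussian_sum_bounded sum_nonneg) auto
    finally show ?case by (simp add: C_def mult_ac)
  qed
  moreover have "C \<ge> 0" by (simp add: C_def D_def)
  ultimately show thesis using \<delta> that unfolding V_def G_def by blast
qed

end

section \<open>Comparison of the phases at the critical temperature\<close>

context block_spin_potts
begin

text \<open>All minimizers share the value \<open>G\<close>, so finitely many local bounds and the
  exponentially small rest bound the partition function by a constant times
  \<open>exp (- real N * G)\<close>; \<open>mass_ge_pmass\<close> matches this from below near every
  minimizer.\<close>

lemma law_bounded_below:
  fixes x :: "real ^ 'q::finite" and U :: "(real ^ 'q ^ 's) set"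
  assumes q: "CARD('q) \<ge> 3" and crit: "g = potts_zeta CARD('q)"
    and dev: "\<And>k. (\<lambda>N. block_dev N k) \<in> O(\<lambda>N. sqrt (real N))"
    and x: "x \<in> potts_minimizers g" and U: "open U" "constant_rows x \<in> U"
  shows "\<exists>c>0. \<forall>\<^sub>F N in sequentially. c \<le> measure (law N) U"
proof -
  let ?X = "potts_minimizers g :: (real ^ 'q) set"
  define G where "G = free_energy g x"
  let ?E = "\<lambda>N. exp (- real N * G)"
  have Xeq: "?X = insert (colour_vec undefined 0) (range (\<lambda>i. colour_vec i ((real CARD('q) - 2) / (real CARD('q) - 1))))"
    unfolding crit by (rule potts_minimizers_critical(2)[OF q refl refl])
  have finX: "finite ?X" unfolding Xeq by simp
  have G: "free_energy g y = G" if "y \<in> ?X" for y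
    using that x unfolding G_def potts_minimizers_def by (auto intro: order_antisym)
  let ?P = "\<lambda>k C. \<forall>\<^sub>F N in sequentially. \<bar>block_dev N k\<bar> \<le> C * sqrt (real N)"
  have "\<exists>C0. \<forall>\<^sub>F N in sequentially. \<forall>k. \<bar>block_dev N k\<bar> \<le> C0 * sqrt (real N)"
  proof -
    have "\<exists>C. ?P k C" for k
    proof -
      obtain C where "\<forall>\<^sub>F N in sequentially. norm (block_dev N k) \<le> C * norm (sqrt (real N))"
        by (rule landau_o.bigE[OF dev[of k]])
      then have "?P k C"
        by eventually_elim simp
      then show ?thesis by blast
    qed
    then have "\<forall>k. \<exists>C. ?P k C" ..
    from choice[OF this] obtain C where C: "\<forall>k. ?P k (C k)" ..
    \<comment> \<open>Summing absolute values gives one constant for all blocks, whatever the signs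
      of the individual ones.\<close>
    have le: "C k \<le> (\<Sum>k\<in>UNIV. \<bar>C k\<bar>)" for k
      using member_le_sum[of k UNIV "\<lambda>k. \<bar>C k\<bar>"] by simp
    have "\<forall>\<^sub>F N in sequentially. \<forall>k. \<bar>block_dev N k\<bar> \<le> C k * sqrt (real N)"
      by (rule eventually_all_finite) (rule spec[OF C])
    then have "\<forall>\<^sub>F N in sequentially. \<forall>k. \<bar>block_dev N k\<bar>
        \<le> (\<Sum>k\<in>UNIV. \<bar>C k\<bar>) * sqrt (real N)"
    proof eventually_elim
      case (elim N)
      show ?case
      proof
        fix k
        show "\<bar>block_dev N k\<bar> \<le> (\<Sum>k\<in>UNIV. \<bar>C k\<bar>) * sqrt (real N)"
          by (rule order_trans[OF spec[OF elim] mult_right_mono[OF le]]) simp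
      qed
    qed
    then show ?thesis by blast
  qed
  then obtain C0 where C0: "\<forall>\<^sub>F N in sequentially. \<forall>k. \<bar>block_dev N k\<bar> \<le> C0 * sqrt (real N)" ..
  have gq: "g < real CARD('q)" unfolding crit by (rule potts_zeta_less[OF q])
  define V where "V \<delta> y = {m :: real ^ 'q ^ 's. \<forall>k c. \<bar>(m - constant_rows y) $ k $ c\<bar> < \<delta>}" for \<delta> y
  have "\<forall>y\<in>?X. \<exists>p. fst p > 0 \<and> snd p \<ge> 0 \<and>
    (\<forall>\<^sub>F N in sequentially. mass N (V (fst p) y) \<le> snd p * ?E N)"
  proof
    fix y assume y: "y \<in> ?X"
    obtain \<delta> C where *: "\<delta> > 0" "C \<ge> 0"
      "\<forall>\<^sub>F N in sequentially. mass N (V \<delta> y) \<le> C * exp (- real N * free_energy g y)"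
      unfolding V_def
      by (rule local_mass_bounded[OF y potts_minimizer_variance_critical[OF q y[unfolded crit]] gq C0])
    show "\<exists>p. fst p > 0 \<and> snd p \<ge> 0 \<and>
        (\<forall>\<^sub>F N in sequentially. mass N (V (fst p) y) \<le> snd p * ?E N)"
      by (rule exI[of _ "(\<delta>, C)"]) (use * in \<open>simp add: G[OF y]\<close>)
  qed
  from bchoice[OF this] obtain F where F: "\<forall>y\<in>?X. fst (F y) > 0 \<and> snd (F y) \<ge> 0 \<and>
    (\<forall>\<^sub>F N in sequentially. mass N (V (fst (F y)) y) \<le> snd (F y) * ?E N)" ..
  define \<delta> C where "\<delta> y = fst (F y)" and "C y = snd (F y)" for y
  have \<delta>: "\<delta> y > 0" and C: "C y \<ge> 0"
    and VC: "\<forall>\<^sub>F N in sequentially. mass N (V (\<delta> y) y) \<le> C y * ?E N" if "y \<in> ?X" for y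
    using bspec[OF F that] unfolding \<delta>_def C_def by blast+
  define W where "W = (\<Union>y\<in>?X. V (\<delta> y) y)"
  have "open (V \<epsilon> y)" for \<epsilon> y
  proof -
    have "V \<epsilon> y = (\<Inter>k\<in>UNIV. \<Inter>c\<in>UNIV. {m. \<bar>(m - constant_rows y) $ k $ c\<bar> < \<epsilon>})"
      unfolding V_def by auto
    then show ?thesis by (auto intro!: open_INT open_Collect_less continuous_intros)
  qed
  then have W: "open W" unfolding W_def by blast
  have XW: "constant_rows ` ?X \<subseteq> W" unfolding W_def V_def using \<delta> by fastforce
  obtain \<epsilon> where \<epsilon>: "\<epsilon> > 0" "\<forall>\<^sub>F N in sequentially. mass N (- W) \<le> exp (- real N * (G + \<epsilon>))"
    unfolding G_def using mass_complement_exp_small[OF W XW x] by blast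
  \<comment> \<open>The summand 1 accounts for the mass outside all local neighbourhoods and makes
    \<open>D\<close> positive.\<close>
  define D where "D = (\<Sum>y\<in>?X. C y) + 1"
  have D: "D > 0" unfolding D_def using C by (simp add: add_nonneg_pos sum_nonneg)
  have "\<forall>\<^sub>F N in sequentially. \<forall>y\<in>?X. mass N (V (\<delta> y) y) \<le> C y * ?E N"
    using finX VC by (intro eventually_ball_finite) auto
  moreover have "\<forall>\<^sub>F N in sequentially. pmass N x U > 1 / 2"
    using pmass_concentrates[OF x U] by (intro order_tendstoD(1)) auto
  ultimately have "\<forall>\<^sub>F N in sequentially. 1 / (2 * D) \<le> measure (law N) U"
    using \<epsilon>(2) eventually_gt_at_top[of 0]
  proof eventually_elim
    case (elim N)
    have "mass N (UNIV :: (real ^ 'q ^ 's) set) \<le> mass N W + mass N (- W)"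
      using config_mass_Un_le[of "\<lambda>\<omega>. exp (- hamiltonian \<alpha> \<beta> N (S N) \<omega>)" N "S N" W "- W"] by simp
    also have "mass N W \<le> (\<Sum>y\<in>?X. mass N (V (\<delta> y) y))"
      unfolding W_def by (rule config_mass_UN_le[OF _ finX]) simp
    also have "\<dots> \<le> (\<Sum>y\<in>?X. C y * ?E N)" using elim(1) by (intro sum_mono) auto
    also have "\<dots> = (\<Sum>y\<in>?X. C y) * ?E N" by (simp only: sum_distrib_right)
    also have "mass N (- W) \<le> 1 * ?E N"
    proof -
      have "real N * G \<le> real N * (G + \<epsilon>)" using \<epsilon>(1) by (intro mult_left_mono) auto
      then have "exp (- real N * (G + \<epsilon>)) \<le> ?E N" by simp
      then show ?thesis using elim(3) by linarith
    qed
    finally have "mass N (UNIV :: (real ^ 'q ^ 's) set) \<le> D * ?E N"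
      by (simp add: D_def distrib_right)
    then show ?case by (intro law_ge_inverse[OF x U(1) elim(4,2)]) (simp add: G_def)
  qed
  then show ?thesis using D by (intro exI[of _ "1 / (2 * D)"]) auto
qed

text \<open>A positive lower bound excludes convergence to 0 near minimizers; elsewhere the
  exponential decay already forces it.\<close>

lemma limit_points_law_critical:
  assumes q: "CARD('q::finite) \<ge> 3" and crit: "g = potts_zeta CARD('q)"
    and dev: "\<And>k. (\<lambda>N. block_dev N k) \<in> O(\<lambda>N. sqrt (real N))"
    and closed: "closed (constant_rows ` potts_minimizers g :: (real ^ 'q ^ 's) set)"
  shows "limit_points (law :: nat \<Rightarrow> (real ^ 'q ^ 's) measure) = constant_rows ` potts_minimizers g"
proof (intro equalityI subsetI)
  fix y :: "real ^ 'q ^ 's" assume "y \<in> constant_rows ` potts_minimizers g"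
  then obtain x where x: "x \<in> potts_minimizers g" "y = constant_rows x" by blast
  show "y \<in> limit_points law"
    unfolding limit_points_def
  proof (intro CollectI allI impI notI)
    fix U :: "(real ^ 'q ^ 's) set"
    assume U: "open U \<and> y \<in> U" and lim: "(\<lambda>N. measure (law N) U) \<longlonglongrightarrow> 0"
    obtain c where c: "c > 0" "\<forall>\<^sub>F N in sequentially. c \<le> measure (law N) U"
      using law_bounded_below[OF q crit dev x(1), of U] U x(2) by blast
    have "c \<le> 0" by (rule tendsto_lowerbound[OF lim c(2)]) simp
    then show False using c(1) by simp
  qed
next
  fix y :: "real ^ 'q ^ 's" assume y: "y \<in> limit_points law"
  show "y \<in> constant_rows ` potts_minimizers g"
  proof (rule ccontr)
    assume "y \<notin> constant_rows ` potts_minimizers g"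
    with closed obtain W \<epsilon> where W: "open W" "y \<in> W" and \<epsilon>: "\<epsilon> > 0"
      "\<forall>\<^sub>F N in sequentially. measure (law N) W \<le> exp (- \<epsilon> * real N)"
      by (rule law_exp_small_near_nonminimizer)
    have "(\<lambda>N. measure (law N) W) \<longlonglongrightarrow> 0"
      by (rule tendsto_0_of_exp_small[OF \<epsilon>(1) _ \<epsilon>(2)]) simp
    then show False using y W unfolding limit_points_def by blast
  qed
qed

lemma minimizer_matrices_critical:
  assumes q: "CARD('q::finite) \<ge> 3" and crit: "g = potts_zeta CARD('q)"
  shows "constant_rows ` potts_minimizers g = insert Q_matrix (range (nu g) :: (real ^ 'q ^ 's) set)"
proof -
  have u: "potts_u CARD('q) g = (real CARD('q) - 2) / (real CARD('q) - 1)"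
    unfolding crit by (rule potts_minimizers_critical(1)[where 'q='q, OF q refl refl])
  have "potts_minimizers g = insert (colour_vec (undefined :: 'q) 0) (range (\<lambda>i. colour_vec i (potts_u CARD('q) g)))"
    unfolding u unfolding crit by (rule potts_minimizers_critical(2)[OF q refl refl])
  then show ?thesis
    by (simp add: nu_eq_constant_rows[abs_def] Q_matrix_eq_constant_rows[of "undefined :: 'q"] image_image)
qed

end

theorem theorem4p7:
  fixes S :: "nat \<Rightarrow> 's::finite \<Rightarrow> nat set"
    and \<alpha> \<beta> g :: real
    and law :: "nat \<Rightarrow> (real ^ 'q::finite ^ 's) measure"
  assumes s: "CARD('s) \<ge> 2"
    and q: "CARD('q) \<ge> 3"
    and \<alpha>: "0 < \<alpha>" and \<alpha>\<beta>: "\<alpha> < \<beta>"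
    and blocks: "\<And>N. block_partition N (S N)"
    and uniform: "\<And>k. (\<lambda>N. real (card (S N k)) / real N) \<longlonglongrightarrow> 1 / real CARD('s)"
    and g: "g = (\<beta> + (real CARD('s) - 1) * \<alpha>) / real CARD('s)"
    and law: "law = (\<lambda>N. magnetization_law \<alpha> \<beta> N (S N))"
  shows "(g < potts_zeta CARD('q) \<longrightarrow> weakly_converges law (return borel Q_matrix))
    \<and> (g > potts_zeta CARD('q) \<longrightarrow> weakly_converges law (uniform_dirac_mixture (nu g)))
    \<and> (g = potts_zeta CARD('q) \<longrightarrow>
         ld_limit_points law = insert Q_matrix (range (nu g))
         \<and> ((\<forall>k. (\<lambda>N. real (card (S N k)) - real N / real CARD('s)) \<in> O(\<lambda>N. sqrt (real N)))
             \<longrightarrow> limit_points law = insert Q_matrix (range (nu g))))"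
proof -
  interpret block_spin_potts S \<alpha> \<beta> g
    by unfold_locales (fact \<alpha> \<alpha>\<beta> blocks uniform g)+
  \<comment> \<open>Closedness comes from finiteness: at criticality the limit matrices are
    \<open>Q_matrix\<close> and one matrix per colour.\<close>
  have crit: "constant_rows ` potts_minimizers g = insert Q_matrix (range (nu g) :: (real ^ 'q ^ 's) set)"
    and closed: "closed (constant_rows ` potts_minimizers g :: (real ^ 'q ^ 's) set)"
    if "g = potts_zeta CARD('q)"
    using minimizer_matrices_critical[OF q that] by (simp_all add: finite_imp_closed)
  show ?thesis
  proof (intro conjI impI)
    show "weakly_converges law (return borel Q_matrix)" if "g < potts_zeta CARD('q)"
      unfolding law by (rule weak_limit_subcritical[OF q that])
    show "weakly_converges law (uniform_dirac_mixture (nu g))" if "g > potts_zeta CARD('q)"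
      unfolding law by (rule weak_limit_supercritical[OF q that])
    show "ld_limit_points law = insert Q_matrix (range (nu g))" if "g = potts_zeta CARD('q)"
      unfolding law crit[OF that, symmetric] by (rule ld_limit_points_law[OF closed[OF that]])
    show "limit_points law = insert Q_matrix (range (nu g))"
      if "g = potts_zeta CARD('q)"
        "\<forall>k. (\<lambda>N. real (card (S N k)) - real N / real CARD('s)) \<in> O(\<lambda>N. sqrt (real N))"
      unfolding law crit[OF that(1), symmetric]
      using limit_points_law_critical[OF q that(1) _ closed[OF that(1)]] that(2) by blast
  qed
qed

end
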